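(* Let $N>2$ and assume $f_1$, $\alpha_*$ and $f_2$ satisfy $(H_1)$–$(H_5)$ below with $\gamma=\infty$. Let $\epsilon$, $A$ be constants as in the conclusion of the following result: there exist $\bar\epsilon,\bar A>0$ such that for $0<\epsilon<\bar\epsilon$, $A>\bar A$ the problem with the nonlinearity $f$ below has at least two ground states. If, in addition, $f$ satisfies condition (GST) below, then the problem $$\Delta u+f(u)=0\ \text{in }\mathbb R^N,\qquad \lim_{|x|\to\infty}u(x)=0,$$ with $$f(s)=\begin{cases}f_1(s), & 0\le s\le\alpha_*+\epsilon,\\ L(s), & \alpha_*+\epsilon\le s\le\alpha_*+2\epsilon,\\ A^2f_2(s), & s\ge\alpha_*+2\epsilon,\end{cases}$$ (extended oddly) has at least three ground state solutions.
   Context: $L$ denotes the affine function whose graph is the segment from $(\alpha_*+\epsilon,f_1(\alpha_*+\epsilon))$ to $(\alpha_*+2\epsilon,A^2f_2(\alpha_*+2\epsilon))$. A ground state is a nonnegative, nontrivial solution (compactly supported ones allowed). Hypotheses: $(H_1)$ $f_1\in C[0,\infty)\cap C^1(0,\infty)$, $f_1(0)=0$, there is $b\ge0$ with $f_1(s)>0$ for $s>b$, $f_1(s)\le0$ on $[0,b]$, and $f_1<0$ on $(0,\epsilon_0)$ for some $\epsilon_0>0$; with $F_1(s)=\int_0^sf_1$, there is a unique finite $\beta\ge b$ with $F_1(\beta)=0$. $(H_2)$ $(F_1/f_1)'(s)>(N-2)/(2N)$ for all $s>\beta$. $(H_3)$ $f_1(s)/(s-b)$ is increasing for $s>b$. $(H_4)$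 the solution of $u''+\frac{N-1}{r}u'+f_1(u)=0$, $u(0)=\alpha_*$, $u'(0)=0$ is a ground state. $(H_5)$ $f_2$ is a positive continuous function on $[\alpha_*,\gamma)$. Condition (GST) (with $\gamma=\infty$): with $F(s)=\int_0^sf$ and $Q(s)=2NF(s)-(N-2)sf(s)$, $Q$ is bounded below near $s=0$, and there exist $\bar b>\beta$ and $\theta\in(0,1)$ such that $Q(s)>0$ for all $s>\bar b$ and $\limsup_{s\to\infty}\inf_{s_1,s_2\in[\theta s,s]}Q(s_2)\bigl(s/f(s_1)\bigr)^{N/2}=\infty$. *)

theory Defs
  imports "HOL-Analysis.Analysis"
begin

definition prim :: "(real \<Rightarrow> real) \<Rightarrow> real \<Rightarrow> real" where
  "prim f s = integral {0..s} f"

text \<open>Radial ground state of Delta u + g(u) = 0 in R^N, u -> 0 at infinity: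
  u(r) a nonnegative, nontrivial solution of u'' + (N-1)/r u' + g(u) = 0 (r > 0),
  u'(0) = 0, u(r) -> 0 as r -> infinity (compactly supported ones allowed).\<close>
definition radial_ground_state :: "nat \<Rightarrow> (real \<Rightarrow> real) \<Rightarrow> (real \<Rightarrow> real) \<Rightarrow> bool" where
  "radial_ground_state N g u \<longleftrightarrow>
     (\<exists>u'. (\<forall>r\<ge>0. (u has_real_derivative u' r) (at r within {0..}))
          \<and> u' 0 = 0
          \<and> (\<forall>r>0. (u' has_real_derivative (- (real N - 1) / r * u' r - g (u r))) (at r)))
     \<and> (\<forall>r\<ge>0. u r \<ge> 0)
     \<and> (\<exists>r\<ge>0. u r \<noteq> 0)
     \<and> (u \<longlongrightarrow> 0) at_top"

definition glued_pos :: "(real \<Rightarrow> real) \<Rightarrow> (real \<Rightarrow> real) \<Rightarrow> real \<Rightarrow> real \<Rightarrow> real \<Rightarrow> real \<Rightarrow> real" where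
  "glued_pos f1 f2 a eps A s =
     (if s \<le> a + eps then f1 s
      else if s \<le> a + 2 * eps then
        f1 (a + eps) + (s - (a + eps)) / eps * (A\<^sup>2 * f2 (a + 2 * eps) - f1 (a + eps))
      else A\<^sup>2 * f2 s)"

definition glued :: "(real \<Rightarrow> real) \<Rightarrow> (real \<Rightarrow> real) \<Rightarrow> real \<Rightarrow> real \<Rightarrow> real \<Rightarrow> real \<Rightarrow> real" where
  "glued f1 f2 a eps A s =
     (if s \<ge> 0 then glued_pos f1 f2 a eps A s else - glued_pos f1 f2 a eps A (- s))"

definition GST :: "nat \<Rightarrow> real \<Rightarrow> (real \<Rightarrow> real) \<Rightarrow> bool" where
  "GST N \<beta> f \<longleftrightarrow>
     (let Q = (\<lambda>s. 2 * real N * prim f s - (real N - 2) * s * f s) in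
       (\<exists>\<delta>>0. \<exists>M. \<forall>s. 0 \<le> s \<and> s < \<delta> \<longrightarrow> Q s \<ge> M)
     \<and> (\<exists>bb \<theta>. bb > \<beta> \<and> 0 < \<theta> \<and> \<theta> < 1
          \<and> (\<forall>s>bb. Q s > 0)
          \<and> (\<forall>M S. \<exists>s>S. \<forall>s1\<in>{\<theta> * s .. s}. \<forall>s2\<in>{\<theta> * s .. s}.
                 Q s2 * (s / f s1) powr (real N / 2) \<ge> M)))"

end

theory Submission
  imports Defs "HOL-Complex_Analysis.Great_Picard"
begin

text \<open>
  Call a solution of the radial problem crossing if it becomes negative and trapped if its energy
  \<open>u'^2 / 2 + F(u)\<close> becomes negative while it is still positive; a solution starting above \<open>\<beta>\<close> that is neither
  yields a ground state. A shooting argument finds a ground state between an initial value all of whose solutions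
  cross and one all of whose solutions are trapped. Since \<open>f2\<close> is only continuous, initial value problems need not
  be uniquely solvable, and the shooting is carried out on Tonelli's delayed approximations.

  (H1)--(H3) imply that for \<open>f1\<close> a solution that is not trapped cannot start below one that does not cross:
  the two intersect above \<open>b\<close> by a Sturm argument based on (H3), the upper one is the steeper one down to \<open>\<beta>\<close>
  by an Erbe--Tang argument based on (H2), and below \<open>\<beta>\<close> the monotonicity of \<open>r sqrt (u'^2 + 2 F(u))\<close> (Peletier--Serrin)
  forces \<open>r |u'|\<close> to stay away from \<open>0\<close>, which is impossible. Hence solutions starting slightly above \<open>\<alpha>\<close> cross.
  A solution starting at \<open>\<alpha> + \<eta>\<close> falls within the time \<open>O(1/A)\<close> to a level slightly below \<open>\<alpha>\<close> and then follows a solution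
  of the problem for \<open>f1\<close> with that initial value; it is trapped. Under (GST) the Pohozaev functional gets so large
  that all solutions from some large initial value cross. So there is one ground state from \<open>\<alpha>\<close>, one between \<open>\<alpha>\<close>
  and \<open>\<alpha> + \<eta>\<close>, and one above \<open>\<alpha> + \<eta>\<close>.
\<close>

section \<open>Radial solutions\<close>

text \<open>Extending by zero makes the potential vanish on the negative axis. Negative energy then
  confines a solution to positive levels forever, so trapped and crossing exclude each other, and
  both properties pass to nearby solutions. What is neither includes a solution touching 0 with
  slope 0 at a finite radius: \<open>f1\<close> is only continuous at 0, and such a solution, cut
  off there, is a compactly supported ground state. Compactness replaces continuous dependence: one
  theorem on approximate solutions of the once integrated equation, away from the origin, serves
  Tonelli's approximants, exact solutions, and solutions whose initial boundary layer has been
  frozen. It asks for a bounded nonlinearity; the cut-offs made for this are invisible because the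
  solutions concerned never exceed their initial value. The size \<eta> is fixed before eps and A,
  and the threshold for A is found by contradiction along sequences with free eps. Only the largest
  crossing height, supplied by (GST), depends on eps and A.\<close>

lemma first_zero:
  fixes f :: "real \<Rightarrow> real"
  assumes "a \<le> b" "continuous_on {a..b} f" "f a < 0" "f b \<ge> 0"
  obtains c where "a < c" "c \<le> b" "f c = 0" "\<And>x. a \<le> x \<Longrightarrow> x < c \<Longrightarrow> f x < 0"
proof -
  define S where "S = {x \<in> {a..b}. f x \<ge> 0}"
  have cl: "closed S"
    unfolding S_def using continuous_closed_preimage[OF assms(2) closed_atLeastAtMost closed_atLeast[of 0]]
    by (simp add: vimage_def Int_def)
  have ne: "S \<noteq> {}" and bd: "bdd_below S" using assms by (auto simp: S_def intro!: bdd_belowI[of _ a])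
  define c where "c = Inf S"
  have cS: "c \<in> S" unfolding c_def by (rule closed_contains_Inf[OF ne bd cl])
  have lt: "f x < 0" if "a \<le> x" "x < c" for x
  proof (rule ccontr)
    assume "\<not> f x < 0"
    moreover have "c \<le> b" using cS by (auto simp: S_def)
    ultimately have "x \<in> S" using that by (auto simp: S_def)
    then have "c \<le> x" unfolding c_def by (rule cInf_lower[OF _ bd])
    with that show False by simp
  qed
  have ac: "a < c" using cS assms(3) by (cases "a = c") (auto simp: S_def)
  have "f c = 0"
  proof (rule ccontr)
    assume "f c \<noteq> 0"
    with cS have "f c > 0" by (auto simp: S_def)
    have "\<exists>x\<ge>a. x \<le> c \<and> f x = 0"
      by (rule IVT') (use assms cS \<open>f c > 0\<close> in \<open>auto simp: S_def intro: continuous_on_subset\<close>)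
    then obtain x where "a \<le> x" "x \<le> c" "f x = 0" by auto
    with lt[of x] \<open>f c > 0\<close> show False by (cases "x = c") auto
  qed
  with that ac lt cS show ?thesis by (auto simp: S_def)
qed

lemma decreasing_escape:
  fixes u v :: "real \<Rightarrow> real"
  assumes der: "\<And>r. r > R \<Longrightarrow> (u has_real_derivative v r) (at r)"
    and low: "\<And>r. r > R \<Longrightarrow> u r \<ge> 0" and k: "\<kappa> > 0" and slope: "\<And>r. r > R \<Longrightarrow> v r \<le> - \<kappa>"
  shows False
proof -
  \<comment> \<open>The line of slope -\<kappa> through the point of the graph over
    \<open>?a\<close> reaches -1 at \<open>?b\<close>. The start is \<open>R + 1\<close> because the
    hypotheses hold only beyond \<open>R\<close>.\<close>
  let ?a = "R + 1" let ?b = "R + 1 + (u (R+1) + 1) / \<kappa>"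
  have ab: "?a < ?b" using low[of ?a] k by (simp add: add_nonneg_pos)
  have "(\<lambda>r. u r + \<kappa> * r) ?b \<le> (\<lambda>r. u r + \<kappa> * r) ?a"
  proof (rule DERIV_nonpos_imp_nonincreasing[where f = "\<lambda>r. u r + \<kappa> * r"])
    fix x assume x: "?a \<le> x" "x \<le> ?b"
    have "((\<lambda>r. u r + \<kappa> * r) has_real_derivative (v x + \<kappa>)) (at x)"
      using x by (auto intro!: derivative_eq_intros der)
    then show "\<exists>y. ((\<lambda>r. u r + \<kappa> * r) has_real_derivative y) (at x) \<and> y \<le> 0"
      using slope[of x] x by auto
  qed (use ab in simp)
  moreover have "\<kappa> * ?b = \<kappa> * ?a + (u (R+1) + 1)" using k by (simp add: field_simps)
  ultimately have "u ?b \<le> -1" by simp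
  with low[of ?b] ab show False by auto
qed

text \<open>The equation is imposed only for \<open>r > 0\<close>, where its coefficient is finite.
  Continuity of \<open>v\<close> at 0 is not demanded; it is derived in
  \<open>sol_continuous_v\<close>.\<close>

definition sol :: "nat \<Rightarrow> (real \<Rightarrow> real) \<Rightarrow> (real \<Rightarrow> real) \<Rightarrow> (real \<Rightarrow> real) \<Rightarrow> bool" where
  "sol N g u v \<longleftrightarrow>
     (\<forall>r\<ge>0. (u has_real_derivative v r) (at r within {0..})) \<and> v 0 = 0 \<and>
     (\<forall>r>0. (v has_real_derivative (- (real N - 1) / r * v r - g (u r))) (at r))"

lemma radial_ground_state_iff:
  "radial_ground_state N g u \<longleftrightarrow>
     (\<exists>v. sol N g u v) \<and> (\<forall>r\<ge>0. u r \<ge> 0) \<and> (\<exists>r\<ge>0. u r \<noteq> 0) \<and> (u \<longlongrightarrow> 0) at_top"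
  by (simp add: radial_ground_state_def sol_def)

lemma sol_cong:
  assumes "sol N g u v" "\<And>r. r > 0 \<Longrightarrow> g (u r) = h (u r)"
  shows "sol N h u v"
  using assms by (simp add: sol_def)

definition energy :: "(real \<Rightarrow> real) \<Rightarrow> (real \<Rightarrow> real) \<Rightarrow> (real \<Rightarrow> real) \<Rightarrow> real \<Rightarrow> real" where
  "energy g u v r = (v r)\<^sup>2 / 2 + prim g (u r)"

lemma sol_deriv_u:
  assumes "sol N g u v" "r > 0"
  shows "(u has_real_derivative v r) (at r)"
proof -
  have "(u has_real_derivative v r) (at r within {0..})" using assms by (auto simp: sol_def)
  then have "(u has_real_derivative v r) (at r within {0<..})" by (rule DERIV_subset) auto
  then show ?thesis using assms(2) at_within_open[of r "{0<..}"] by simp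
qed

lemma sol_deriv_v:
  assumes "sol N g u v" "r > 0"
  shows "(v has_real_derivative (- (real N - 1) / r * v r - g (u r))) (at r)"
  using assms by (auto simp: sol_def)

lemma sol_continuous_u: "sol N g u v \<Longrightarrow> continuous_on {0..} u"
  unfolding continuous_on_eq_continuous_within sol_def
  using DERIV_continuous by blast

lemma sol_v0: "sol N g u v \<Longrightarrow> v 0 = 0"
  by (simp add: sol_def)

section \<open>Divergence form and behaviour at the origin\<close>

text \<open>Multiplication by \<open>r^(N-1)\<close> absorbs the singular first-order term, so that
  the equation can be integrated from the origin.\<close>

lemma sol_mass_deriv:
  assumes "sol N g u v" "r > 0" "N > 2"
  shows "((\<lambda>r. r ^ (N-1) * v r) has_real_derivative - (r ^ (N-1) * g (u r))) (at r)"
proof -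
  obtain m where m: "N = Suc (Suc m)" using assms(3) by (metis Suc_1 less_imp_Suc_add plus_1_eq_Suc add_Suc)
  have "((\<lambda>r. r ^ Suc m * v r) has_real_derivative
      real (Suc m) * r ^ m * v r + r ^ Suc m * (- (real N - 1) / r * v r - g (u r))) (at r)"
    using DERIV_mult[OF DERIV_pow[of "Suc m" r] sol_deriv_v[OF assms(1,2)]] by (simp add: algebra_simps)
  moreover have "real (Suc m) * r ^ m * v r + r ^ Suc m * (- (real N - 1) / r * v r - g (u r)) = - (r ^ Suc m * g (u r))"
    using assms(2) by (simp add: m field_simps)
  ultimately show ?thesis by (simp add: m)
qed

lemma sol_bounded_on:
  assumes "sol N g u v" "continuous_on UNIV g"
  obtains K where "K > 0" "\<And>t. 0 \<le> t \<Longrightarrow> t \<le> R \<Longrightarrow> \<bar>g (u t)\<bar> \<le> K"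
proof -
  have "continuous_on {0..R} (\<lambda>t. g (u t))"
    by (rule continuous_on_compose2[OF assms(2)])
       (auto intro: continuous_on_subset[OF sol_continuous_u[OF assms(1)]])
  then have "compact ((\<lambda>t. g (u t)) ` {0..R})" by (rule compact_continuous_image) simp
  then obtain K where "\<forall>x\<in>(\<lambda>t. g (u t)) ` {0..R}. \<bar>x\<bar> \<le> K"
    using compact_imp_bounded bounded_iff by (metis real_norm_def)
  then show ?thesis using that[of "\<bar>K\<bar> + 1"] by force
qed

text \<open>Nothing is known yet about \<open>v\<close> near 0. Since \<open>u\<close> has
  derivative 0 there, the mean value theorem supplies points \<open>z\<close> arbitrarily close to 0
  with small \<open>v z\<close>; from \<open>z\<close> on, the mass is Lipschitz by the divergence
  form.\<close>

lemma sol_mass_small: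
  assumes s: "sol N g u v" and g: "continuous_on UNIV g" and N: "N > 2"
  obtains K where "K > 0" "\<And>r. 0 \<le> r \<Longrightarrow> r \<le> 1 \<Longrightarrow> \<bar>r ^ (N-1) * v r\<bar> \<le> K * r"
proof -
  obtain K where K: "K > 0" "\<And>t. 0 \<le> t \<Longrightarrow> t \<le> 1 \<Longrightarrow> \<bar>g (u t)\<bar> \<le> K"
    using sol_bounded_on[OF s g, of 1] by blast
  have main: "\<bar>r ^ (N-1) * v r\<bar> \<le> K * r + e" if r: "0 < r" "r \<le> 1" and e: "e > 0" for r e
  proof -
    have "(u has_real_derivative 0) (at 0 within {0..})" using s by (force simp: sol_def)
    then have "((\<lambda>x. (u x - u 0) / x) \<longlongrightarrow> 0) (at 0 within {0..})"
      by (simp add: has_field_derivative_iff)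
    then have "eventually (\<lambda>x. \<bar>(u x - u 0) / x\<bar> < e) (at 0 within {0..})"
      using e by (auto simp: tendsto_iff dist_real_def)
    then obtain d where d: "d > 0" "\<And>x. x > 0 \<Longrightarrow> x < d \<Longrightarrow> \<bar>(u x - u 0) / x\<bar> < e"
      by (auto simp: eventually_at dist_real_def)
    define x where "x = min (d/2) r"
    have x: "0 < x" "x < d" "x \<le> r" using d r by (auto simp: x_def)
    have "\<exists>l z. 0 < z \<and> z < x \<and> (u has_real_derivative l) (at z) \<and> u x - u 0 = (x - 0) * l"
      by (rule MVT) (use x s in \<open>auto intro: continuous_on_subset[OF sol_continuous_u[OF s]] intro!: sol_deriv_u[THEN real_differentiable_def[THEN iffD2, OF exI]]\<close>)
    then obtain l z where z: "0 < z" "z < x" "(u has_real_derivative l) (at z)" "u x - u 0 = (x - 0) * l" by auto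
    have "l = v z" using DERIV_unique[OF z(3) sol_deriv_u[OF s z(1)]] .
    with z x d(2)[of x] have vz: "\<bar>v z\<bar> < e" by auto
    have "z ^ (N-1) \<le> 1" using z x r by (intro power_le_one) auto
    then have mz: "\<bar>z ^ (N-1) * v z\<bar> \<le> e"
      using vz z by (simp add: abs_mult) (smt (verit) mult_left_le_one_le zero_le_power)
    have "\<bar>r ^ (N-1) * v r - z ^ (N-1) * v z\<bar> \<le> K * \<bar>r - z\<bar>"
    proof -
      have "norm ((\<lambda>r. r ^ (N-1) * v r) r - (\<lambda>r. r ^ (N-1) * v r) z) \<le> K * norm (r - z)"
      proof (rule field_differentiable_bound[of "{z..r}"])
        fix t assume t: "t \<in> {z..r}"
        then show "((\<lambda>r. r ^ (N-1) * v r) has_field_derivative - (t ^ (N-1) * g (u t))) (at t within {z..r})"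
          using sol_mass_deriv[OF s _ N, of t] z by (auto intro: has_field_derivative_at_within)
        have "t ^ (N-1) \<le> 1" "0 \<le> t ^ (N-1)" using t r z by (auto intro!: power_le_one)
        then show "norm (- (t ^ (N-1) * g (u t))) \<le> K"
          using mult_mono[of "t ^ (N-1)" 1 "\<bar>g (u t)\<bar>" K] K(2)[of t] t z r by (simp add: abs_mult)
      qed (use z x in auto)
      then show ?thesis by simp
    qed
    also have "\<dots> \<le> K * r" using z x K by (intro mult_left_mono) auto
    finally show ?thesis using mz by linarith
  qed
  have "\<bar>r ^ (N-1) * v r\<bar> \<le> K * r" if "0 \<le> r" "r \<le> 1" for r
  proof (cases "r = 0")
    case True with N show ?thesis by (simp add: sol_v0[OF s])
  next
    case False then show ?thesis using main[of r] that by (metis field_le_epsilon less_eq_real_def)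
  qed
  with K(1) that show ?thesis by blast
qed

lemma sol_mass_continuous:
  assumes s: "sol N g u v" and g: "continuous_on UNIV g" and N: "N > 2"
  shows "continuous_on {0..} (\<lambda>r. r ^ (N-1) * v r)"
proof -
  obtain K where K: "K > 0" "\<And>r. 0 \<le> r \<Longrightarrow> r \<le> 1 \<Longrightarrow> \<bar>r ^ (N-1) * v r\<bar> \<le> K * r"
    using sol_mass_small[OF assms] by blast
  show ?thesis
    unfolding continuous_on_eq_continuous_within
  proof
    fix x :: real assume x: "x \<in> {0..}"
    show "continuous (at x within {0..}) (\<lambda>r. r ^ (N-1) * v r)"
    proof (cases "x = 0")
      case False
      with x show ?thesis using DERIV_isCont[OF sol_mass_deriv[OF s _ N, of x]]
        by (simp add: continuous_at_imp_continuous_at_within)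
    next
      case True
      have "((\<lambda>r. r ^ (N-1) * v r) \<longlongrightarrow> 0) (at 0 within {0..})"
      proof (rule Lim_null_comparison)
        show "\<forall>\<^sub>F r in at 0 within {0..}. norm (r ^ (N-1) * v r) \<le> K * r"
          unfolding eventually_at by (rule exI[of _ 1]) (use K in \<open>auto simp: dist_real_def\<close>)
        show "((\<lambda>r. K * r) \<longlongrightarrow> 0) (at 0 within {0..})" by (auto intro!: tendsto_eq_intros)
      qed
      then show ?thesis using True N by (simp add: continuous_within sol_v0[OF s])
    qed
  qed
qed

text \<open>Comparison with the constant nonlinearity \<kappa>, whose solutions have slope
  \<open>- \<kappa> * r / N\<close>: the divergence form is integrated from 0 and divided by
  \<open>r^(N-1)\<close>.\<close>

lemma sol_slope_le:
  assumes s: "sol N g u v" and g: "continuous_on UNIV g" and N: "N > 2" and r: "r \<ge> 0"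
    and low: "\<And>t. 0 < t \<Longrightarrow> t < r \<Longrightarrow> g (u t) \<ge> \<kappa>"
  shows "v r \<le> - \<kappa> * r / N"
proof (cases "r = 0")
  case True then show ?thesis by (simp add: sol_v0[OF s])
next
  case False
  with r have r: "r > 0" by simp
  let ?h = "\<lambda>r. r ^ (N-1) * v r + \<kappa> * r ^ N / N"
  have "?h r \<le> ?h 0"
  proof (rule DERIV_nonpos_imp_decreasing_open[where f = ?h])
    fix x assume x: "0 < x" "x < r"
    have "(?h has_real_derivative - (x ^ (N-1) * g (u x)) + \<kappa> * x ^ (N-1)) (at x)"
      by (rule derivative_eq_intros sol_mass_deriv[OF s x(1) N] refl)+ (use N in auto)
    moreover have "x ^ (N-1) * \<kappa> \<le> x ^ (N-1) * g (u x)" using low[OF x] x by (intro mult_left_mono) auto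
    ultimately show "\<exists>y. (?h has_real_derivative y) (at x) \<and> y \<le> 0" by (force simp: algebra_simps)
  next
    show "continuous_on {0..r} ?h"
      by (intro continuous_intros continuous_on_subset[OF sol_mass_continuous[OF s g N]]) (use N in auto)
  qed (use r in auto)
  then have "r ^ (N-1) * (v r + \<kappa> * r / N) \<le> 0"
    using N by (simp add: algebra_simps sol_v0[OF s] power_eq_if[of _ N] power_0_left)
  moreover have "r ^ (N-1) > 0" using r by simp
  ultimately have "v r + \<kappa> * r / N \<le> 0" by (simp add: mult_le_0_iff)
  then show ?thesis by simp
qed

lemma sol_uminus:
  assumes "sol N g u v" shows "sol N (\<lambda>s. - g (- s)) (\<lambda>r. - u r) (\<lambda>r. - v r)"
  using assms unfolding sol_def by (auto intro!: derivative_eq_intros)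

lemma sol_slope_ge:
  assumes s: "sol N g u v" and g: "continuous_on UNIV g" and N: "N > 2" and r: "r \<ge> 0"
    and up: "\<And>t. 0 < t \<Longrightarrow> t < r \<Longrightarrow> g (u t) \<le> \<kappa>"
  shows "v r \<ge> - \<kappa> * r / N"
proof -
  have "- v r \<le> - (- \<kappa>) * r / N"
    by (rule sol_slope_le[OF sol_uminus[OF s] _ N r])
       (use up in \<open>auto intro!: continuous_intros continuous_on_compose2[OF g]\<close>)
  then show ?thesis by simp
qed

lemma sol_slope_abs:
  assumes s: "sol N g u v" and g: "continuous_on UNIV g" and N: "N > 2" and r: "r \<ge> 0"
    and bd: "\<And>t. 0 < t \<Longrightarrow> t < r \<Longrightarrow> \<bar>g (u t)\<bar> \<le> K"
  shows "\<bar>v r\<bar> \<le> K * r / N"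
proof -
  have "v r \<le> - (-K) * r / N" by (rule sol_slope_le[OF s g N r]) (use bd in force)
  moreover have "v r \<ge> - K * r / N" by (rule sol_slope_ge[OF s g N r]) (use bd in force)
  ultimately show ?thesis by simp
qed

lemma sol_continuous_v:
  assumes s: "sol N g u v" and g: "continuous_on UNIV g" and N: "N > 2"
  shows "continuous_on {0..} v"
  unfolding continuous_on_eq_continuous_within
proof
  fix x :: real assume x: "x \<in> {0..}"
  show "continuous (at x within {0..}) v"
  proof (cases "x = 0")
    case False
    with x show ?thesis using DERIV_isCont[OF sol_deriv_v[OF s, of x]]
      by (simp add: continuous_at_imp_continuous_at_within)
  next
    case True
    obtain K where K: "K > 0" "\<And>t. 0 \<le> t \<Longrightarrow> t \<le> 1 \<Longrightarrow> \<bar>g (u t)\<bar> \<le> K"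
      using sol_bounded_on[OF s g, of 1] by blast
    have "(v \<longlongrightarrow> 0) (at 0 within {0..})"
    proof (rule Lim_null_comparison)
      show "\<forall>\<^sub>F r in at 0 within {0..}. norm (v r) \<le> K * r / N"
        unfolding eventually_at
        by (rule exI[of _ 1]) (use N in \<open>auto simp: dist_real_def intro!: sol_slope_abs[OF s g N] K\<close>)
      show "((\<lambda>r. K * r / N) \<longlongrightarrow> 0) (at 0 within {0..})"
        using N by (auto intro!: tendsto_eq_intros)
    qed
    then show ?thesis using True by (simp add: continuous_within sol_v0[OF s])
  qed
qed

text \<open>For \<open>s < 0\<close> the integral runs over an empty interval and is 0, which is
  consistent with a \<open>g\<close> vanishing there. Integration starts at some
  \<open>a < 0\<close> so that the point 0 causes no one-sided derivative.\<close>

lemma prim_deriv: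
  assumes g: "continuous_on UNIV g" and g0: "\<And>s. s \<le> 0 \<Longrightarrow> g s = 0"
  shows "(prim g has_real_derivative g s) (at s)"
proof -
  define a where "a = - \<bar>s\<bar> - 1"
  define b where "b = \<bar>s\<bar> + 1"
  have int: "g integrable_on {c..d}" for c d
    by (intro integrable_continuous_interval continuous_on_subset[OF g]) auto
  have eq: "integral {a..x} g = prim g x" if "x \<in> {a<..<b}" for x
  proof (cases "x \<ge> 0")
    case True
    have "integral {a..0} g = 0" using integral_cong[of "{a..0}" g "\<lambda>_. 0"] g0 by auto
      
    then show ?thesis
      using Henstock_Kurzweil_Integration.integral_combine[of a 0 x g] True int by (simp add: prim_def a_def)
  next
    case False
    have "integral {a..x} g = integral {a..x} (\<lambda>_. 0)" by (rule integral_cong) (use False g0 in auto)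
    then show ?thesis using False by (simp add: prim_def)
  qed
  have "((\<lambda>x. integral {a..x} g) has_real_derivative g s) (at s within {a..b})"
    by (rule integral_has_real_derivative) (auto simp: a_def b_def intro: continuous_on_subset[OF g])
  then have "((\<lambda>x. integral {a..x} g) has_real_derivative g s) (at s)"
  proof -
    have "s \<in> interior {a..b}" by (auto simp: a_def b_def)
    then show ?thesis using \<open>((\<lambda>x. integral {a..x} g) has_real_derivative g s) (at s within {a..b})\<close>
      by (simp only: at_within_interior)
  qed
  then show ?thesis
    by (rule has_field_derivative_transform_within_open[of _ _ _ "{a<..<b}"]) (use eq in \<open>auto simp: a_def b_def\<close>)
qed

lemma prim_nonpos [simp]: "s \<le> 0 \<Longrightarrow> prim g s = 0"
  by (cases "s = 0") (auto simp: prim_def)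

section \<open>Potential wells\<close>

lemma cut_deriv:
  fixes f :: "real \<Rightarrow> real"
  assumes "(f has_real_derivative 0) (at x)" "f x = 0"
  shows "((\<lambda>r. if r \<le> x then f r else 0) has_real_derivative 0) (at x)"
  unfolding has_field_derivative_iff
proof (rule filterlim_split_at_real)
  have "((\<lambda>y. (f y - f x) / (y - x)) \<longlongrightarrow> 0) (at_left x)"
    using assms(1) unfolding has_field_derivative_iff by (rule filterlim_mono) (auto simp: at_le)
  moreover have "\<forall>\<^sub>F y in at_left x. (f y - f x) / (y - x) = ((if y \<le> x then f y else 0) - (if x \<le> x then f x else 0)) / (y - x)"
    unfolding eventually_at_filter by (auto intro: always_eventually)
  ultimately show "((\<lambda>y. ((if y \<le> x then f y else 0) - (if x \<le> x then f x else 0)) / (y - x)) \<longlongrightarrow> 0) (at_left x)"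
    by (rule Lim_transform_eventually)
  have "\<forall>\<^sub>F y in at_right x. 0 = ((if y \<le> x then f y else 0) - (if x \<le> x then f x else 0)) / (y - x)"
    unfolding eventually_at_filter by (auto intro: always_eventually simp: assms(2))
  then show "((\<lambda>y. ((if y \<le> x then f y else 0) - (if x \<le> x then f x else 0)) / (y - x)) \<longlongrightarrow> 0) (at_right x)"
    by (rule Lim_transform_eventually[OF tendsto_const])
qed

text \<open>This produces the compactly supported ground states: a solution arriving at 0 with slope
  0 is continued by zero, whatever it did afterwards.\<close>

lemma sol_cut:
  assumes s: "sol N g u v" and x: "x > 0" "u x = 0" "v x = 0" and g0: "g 0 = 0"
  shows "sol N g (\<lambda>r. if r \<le> x then u r else 0) (\<lambda>r. if r \<le> x then v r else 0)"
proof -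
  have cut: "((\<lambda>r. if r \<le> x then f r else 0) has_real_derivative (if r \<le> x then D else 0)) (at r)"
    if "(f has_real_derivative D) (at r)" "f x = 0" "r = x \<Longrightarrow> D = 0" for f D and r :: real
  proof (cases r x rule: linorder_cases)
    case less
    have "((\<lambda>r. if r \<le> x then f r else 0) has_real_derivative D) (at r)"
      by (rule has_field_derivative_transform_within_open[OF that(1), of "{..<x}"]) (use less in auto)
    then show ?thesis using less by simp
  next
    case equal then show ?thesis using cut_deriv[of f x] that by simp
  next
    case greater
    have "((\<lambda>r. if r \<le> x then f r else 0) has_real_derivative 0) (at r)"
      by (rule has_field_derivative_transform_within_open[OF DERIV_const[of 0], of "{x<..}"]) (use greater in auto)
    then show ?thesis using greater by simp
  qed
  have "((\<lambda>r. if r \<le> x then u r else 0) has_real_derivative (if r \<le> x then v r else 0)) (at r within {0..})"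
    if "r \<ge> 0" for r
  proof (cases "r = 0")
    case True
    have "(u has_real_derivative v 0) (at 0 within {0..})" using s unfolding sol_def by blast
    then have "((\<lambda>r. if r \<le> x then u r else 0) has_real_derivative v 0) (at 0 within {0..})"
      by (rule has_field_derivative_transform_within[of _ _ _ _ x]) (use x in \<open>auto simp: dist_real_def\<close>)
    then show ?thesis using True x by simp
  next
    case False
    then show ?thesis using cut[OF sol_deriv_u[OF s, of r]] that x
      by (auto intro: has_field_derivative_at_within)
  qed
  moreover have "((\<lambda>r. if r \<le> x then v r else 0) has_real_derivative
      - (real N - 1) / r * (if r \<le> x then v r else 0) - g (if r \<le> x then u r else 0)) (at r)" if "r > 0" for r
  proof -
    have *: "- (real N - 1) / r * (if r \<le> x then v r else 0) - g (if r \<le> x then u r else 0) =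
      (if r \<le> x then - (real N - 1) / r * v r - g (u r) else 0)" by (simp add: g0)
    show ?thesis unfolding * by (rule cut[OF sol_deriv_v[OF s that]]) (use x g0 in auto)
  qed
  ultimately show ?thesis using s x by (simp add: sol_def)
qed

text \<open>A trapped solution has entered the well of negative potential energy while still positive and never leaves it.\<close>
definition trapped :: "(real \<Rightarrow> real) \<Rightarrow> (real \<Rightarrow> real) \<Rightarrow> (real \<Rightarrow> real) \<Rightarrow> bool" where
  "trapped g u v \<longleftrightarrow> (\<exists>R\<ge>0. energy g u v R < 0 \<and> (\<forall>r\<in>{0..R}. u r > 0))"

text \<open>An abstract version of \<open>f1\<close> extended by zero, weak enough to hold also for
  the glued nonlinearity and for its cut-offs, which differ from it only above \<beta>. The
  potential is negative exactly on the interval from 0 to \<beta>.\<close>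

locale well =
  fixes N :: nat and g :: "real \<Rightarrow> real" and b \<beta> :: real
  assumes N: "N > 2"
    and g_cont: "continuous_on UNIV g"
    and g_zero: "s \<le> 0 \<Longrightarrow> g s = 0"
    and g_nonpos: "0 \<le> s \<Longrightarrow> s \<le> b \<Longrightarrow> g s \<le> 0"
    and g_neg: "\<exists>e0>0. \<forall>s\<in>{0<..<e0}. g s < 0"
    and g_pos: "s > b \<Longrightarrow> g s > 0"
    and b_pos: "b > 0" and \<beta>_gt: "\<beta> > b" and prim_\<beta>: "prim g \<beta> = 0"
begin

section \<open>Shape of the potential\<close>

lemma F_deriv: "(prim g has_real_derivative g s) (at s)"
  by (rule prim_deriv[OF g_cont g_zero])

lemma F_isCont: "isCont (prim g) s"
  by (rule DERIV_isCont[OF F_deriv])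

lemma F_cont: "continuous_on A (prim g)"
  by (simp add: continuous_at_imp_continuous_on F_isCont)

lemma F_mono: assumes "b \<le> s" "s < t" shows "prim g s < prim g t"
proof (rule DERIV_pos_imp_increasing_open[OF assms(2)])
  fix x assume "s < x" "x < t"
  then show "\<exists>y. (prim g has_real_derivative y) (at x) \<and> 0 < y"
    using F_deriv[of x] g_pos[of x] assms by (intro exI[of _ "g x"]) auto
qed (rule F_cont)

lemma F_anti: assumes "0 \<le> s" "s \<le> t" "t \<le> b" shows "prim g t \<le> prim g s"
  by (rule DERIV_nonpos_imp_nonincreasing[OF assms(2)])
     (meson F_deriv g_nonpos assms order_trans)

lemma F_neg: assumes "0 < s" "s < \<beta>" shows "prim g s < 0"
proof (cases "s \<le> b")
  case True
  obtain e0 where e0: "e0 > 0" "\<forall>s\<in>{0<..<e0}. g s < 0" using g_neg by blast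
  define t where "t = min s (e0/2)"
  have t: "0 < t" "t < e0" "t \<le> s" using e0 assms by (auto simp: t_def)
  have "prim g t < prim g 0"
  proof (rule DERIV_neg_imp_decreasing_open[of 0 t])
    fix x assume "0 < x" "x < t"
    then show "\<exists>y. (prim g has_real_derivative y) (at x) \<and> y < 0"
      using F_deriv[of x] e0 t by (intro exI[of _ "g x"]) auto
  qed (use t F_cont in auto)
  moreover have "prim g s \<le> prim g t" by (rule F_anti) (use t True in auto)
  ultimately show ?thesis by simp
next
  case False
  then show ?thesis using F_mono[of s \<beta>] assms prim_\<beta> by simp
qed

lemma F_pos: "s > \<beta> \<Longrightarrow> prim g s > 0"
  using F_mono[of \<beta> s] \<beta>_gt prim_\<beta> by simp

lemma F_nonneg_imp: "prim g s \<ge> 0 \<Longrightarrow> s > 0 \<Longrightarrow> s \<ge> \<beta>"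
  using F_neg by force

lemma F_neg_imp: "prim g s < 0 \<Longrightarrow> 0 < s \<and> s < \<beta>"
  using F_pos[of s] prim_\<beta> by (cases s \<beta> rule: linorder_cases) (auto simp: not_less intro: ccontr)

lemma F_level: assumes "e > 0" obtains c where "c > 0" "\<And>s. prim g s \<le> - e \<Longrightarrow> s \<ge> c"
proof -
  have "isCont (prim g) 0" by (rule F_isCont)
  then obtain d where d: "d > 0" "\<And>x. dist x 0 < d \<Longrightarrow> dist (prim g x) (prim g 0) < e"
    using assms unfolding continuous_at_eps_delta by blast
  have "s \<ge> d" if "prim g s \<le> - e" for s
    using d(2)[of s] F_neg_imp[of s] that assms by (auto simp: dist_real_def) (smt (verit))
  with d(1) that show ?thesis by blast
qed

section \<open>Energy dissipation, turning points and descent\<close>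

lemma energy_deriv:
  assumes s: "sol N g u v" and r: "r > 0"
  shows "(energy g u v has_real_derivative - (real N - 1) / r * (v r)\<^sup>2) (at r)"
proof -
  have "((\<lambda>r. prim g (u r)) has_real_derivative g (u r) * v r) (at r)"
    by (rule DERIV_chain2[OF F_deriv sol_deriv_u[OF s r]])
  then have "(energy g u v has_real_derivative (2 * v r * (- (real N - 1) / r * v r - g (u r))) / 2 + g (u r) * v r) (at r)"
    unfolding energy_def using sol_deriv_v[OF s r] by (auto intro!: derivative_eq_intros)
  moreover have "(2 * v r * (- (real N - 1) / r * v r - g (u r))) / 2 + g (u r) * v r = - (real N - 1) / r * (v r)\<^sup>2"
    using r by (simp add: field_simps power2_eq_square)
  ultimately show ?thesis by simp
qed

lemma energy_cont: assumes s: "sol N g u v" shows "continuous_on {0..} (energy g u v)"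
  unfolding energy_def
  by (intro continuous_intros continuous_on_compose2[OF F_cont[of UNIV]] sol_continuous_u[OF s] sol_continuous_v[OF s g_cont N]) auto

lemma energy_anti:
  assumes s: "sol N g u v" and "0 \<le> r" "r \<le> t" shows "energy g u v t \<le> energy g u v r"
proof (rule DERIV_nonpos_imp_decreasing_open[OF assms(3)])
  fix x assume "r < x" "x < t"
  then show "\<exists>y. (energy g u v has_real_derivative y) (at x) \<and> y \<le> 0"
    using energy_deriv[OF s, of x] assms N by (intro exI[of _ "- (real N - 1) / x * (v x)\<^sup>2"]) (auto simp: mult_nonpos_nonneg divide_nonpos_pos)
qed (use assms in \<open>auto intro: continuous_on_subset[OF energy_cont[OF s]]\<close>)

lemma F_le_energy: "prim g (u r) \<le> energy g u v r"
  by (simp add: energy_def)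

text \<open>The energy does not increase and bounds the potential from above; the potential is
  continuous with value 0 at 0, so staying below a negative number keeps \<open>u\<close> away from
  0.\<close>

lemma trap:
  assumes s: "sol N g u v" and R: "R \<ge> 0" "energy g u v R < 0"
  obtains c where "c > 0" "\<And>r. r \<ge> R \<Longrightarrow> u r \<ge> c"
proof -
  obtain c where c: "c > 0" "\<And>s. prim g s \<le> - (- energy g u v R) \<Longrightarrow> s \<ge> c"
    using F_level[of "- energy g u v R"] R by auto
  have "u r \<ge> c" if "r \<ge> R" for r
    using c(2)[of "u r"] F_le_energy[of u r v] energy_anti[OF s R(1) that] by simp
  with c(1) that show ?thesis by blast
qed

text \<open>The initial energy is purely potential, and the potential increases above
  \<open>b\<close>: a higher level could not be paid for.\<close>

lemma sol_le_initial:
  assumes s: "sol N g u v" and "u 0 \<ge> b" "r \<ge> 0" shows "u r \<le> u 0"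
proof (rule ccontr)
  assume "\<not> u r \<le> u 0"
  then have "prim g (u 0) < prim g (u r)" using F_mono assms by simp
  also have "\<dots> \<le> energy g u v r" by (rule F_le_energy)
  also have "\<dots> \<le> energy g u v 0" using energy_anti[OF s, of 0 r] assms by simp
  also have "\<dots> = prim g (u 0)" by (simp add: energy_def sol_v0[OF s])
  finally show False by simp
qed

lemma v_neg:
  assumes s: "sol N g u v" and r: "r > 0" and u: "\<And>t. 0 < t \<Longrightarrow> t < r \<Longrightarrow> u t > b"
  shows "v r < 0"
proof -
  have "r ^ (N-1) * v r < 0 ^ (N-1) * v 0"
  proof (rule DERIV_neg_imp_decreasing_open[OF r, where f = "\<lambda>r. r ^ (N-1) * v r"])
    fix x assume "0 < x" "x < r"
    then show "\<exists>y. ((\<lambda>r. r ^ (N-1) * v r) has_real_derivative y) (at x) \<and> y < 0"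
      using sol_mass_deriv[OF s _ N, of x] g_pos[OF u[of x]] by (intro exI conjI) auto
  qed (rule continuous_on_subset[OF sol_mass_continuous[OF s g_cont N]], simp)
  then have "r ^ (N-1) * v r < 0" using N by (simp add: sol_v0[OF s])
  then show ?thesis using r by (simp add: mult_less_0_iff not_less)
qed

lemma strict_dec:
  assumes s: "sol N g u v" and "0 \<le> x" "x < y" and neg: "\<And>t. x < t \<Longrightarrow> t < y \<Longrightarrow> v t < 0"
  shows "u y < u x"
proof (rule DERIV_neg_imp_decreasing_open[OF assms(3)])
  fix t assume "x < t" "t < y"
  then show "\<exists>z. (u has_real_derivative z) (at t) \<and> z < 0"
    using sol_deriv_u[OF s, of t] neg[of t] assms by (intro exI[of _ "v t"]) auto
qed (use assms in \<open>auto intro: continuous_on_subset[OF sol_continuous_u[OF s]]\<close>)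

text \<open>Up to a first turning point \<open>u\<close> decreases, so turning above
  \<open>b\<close> would mean having stayed above \<open>b\<close>, where the mass strictly
  decreases from 0.\<close>

lemma turning_level:
  assumes s: "sol N g u v" and r: "r > 0" "v r = 0" and neg: "\<And>t. 0 < t \<Longrightarrow> t < r \<Longrightarrow> v t < 0"
  shows "u r \<le> b"
proof (rule ccontr)
  assume *: "\<not> u r \<le> b"
  have "v r < 0"
  proof (rule v_neg[OF s r(1)])
    fix t assume "0 < t" "t < r"
    then have "u r < u t" by (intro strict_dec[OF s]) (use neg in auto)
    with * show "u t > b" by simp
  qed
  with r show False by simp
qed

lemma initially_dec:
  assumes s: "sol N g u v" and "u 0 > b"
  obtains d where "d > 0" "\<And>r. 0 < r \<Longrightarrow> r \<le> d \<Longrightarrow> v r < 0"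
proof -
  have "continuous (at 0 within {0..}) u"
    using sol_continuous_u[OF s] by (auto simp: continuous_on_eq_continuous_within)
  then have "\<forall>e>0. \<exists>d>0. \<forall>x\<in>{0..}. dist x 0 < d \<longrightarrow> dist (u x) (u 0) < e"
    by (simp add: continuous_within_eps_delta)
  then obtain d where d: "d > 0" "\<And>x. x \<ge> 0 \<Longrightarrow> x < d \<Longrightarrow> \<bar>u x - u 0\<bar> < u 0 - b"
    using assms(2) by (auto simp: dist_real_def dest!: spec[of _ "u 0 - b"])
  have "v r < 0" if "0 < r" "r \<le> d" for r
  proof (rule v_neg[OF s that(1)])
    show "u t > b" if "0 < t" "t < r" for t
      using d(2)[of t] that \<open>r \<le> d\<close> by (simp add: abs_less_iff)
  qed
  with d(1) that show ?thesis by blast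
qed

lemma first_turning:
  assumes s: "sol N g u v" and u0: "u 0 > b" and r: "r > 0" "v r \<ge> 0"
  obtains t where "0 < t" "t \<le> r" "v t = 0" "\<And>x. 0 < x \<Longrightarrow> x < t \<Longrightarrow> v x < 0"
proof -
  obtain d where d: "d > 0" "\<And>r. 0 < r \<Longrightarrow> r \<le> d \<Longrightarrow> v r < 0" using initially_dec[OF s u0] by blast
  have dr: "d < r" using d(2)[of r] r by force
  obtain c where c: "d < c" "c \<le> r" "v c = 0" "\<And>x. d \<le> x \<Longrightarrow> x < c \<Longrightarrow> v x < 0"
    by (rule first_zero[of d r v]) (use d dr r in \<open>auto intro: continuous_on_subset[OF sol_continuous_v[OF s g_cont N]]\<close>)
  have "v x < 0" if "0 < x" "x < c" for x using d(2)[of x] c(4)[of x] that by (cases "x \<le> d") auto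
  with c d that show ?thesis by (metis order_less_trans)
qed

text \<open>At a first turning point the energy is \<open>prim g (u t)\<close>, nonnegative at a
  positive level only from \<beta> upwards, whereas turning happens at or below \<open>b\<close>,
  which is less than \<beta>.\<close>

lemma dec_while:
  assumes s: "sol N g u v" and u0: "u 0 > \<beta>"
    and pos: "\<And>r. 0 < r \<Longrightarrow> r < R \<Longrightarrow> u r > 0 \<and> energy g u v r \<ge> 0" and r: "0 < r" "r < R"
  shows "v r < 0"
proof (rule ccontr)
  assume "\<not> v r < 0"
  then have "v r \<ge> 0" by simp
  then obtain t where t: "0 < t" "t \<le> r" "v t = 0" "\<And>x. 0 < x \<Longrightarrow> x < t \<Longrightarrow> v x < 0"
    using first_turning[OF s less_trans[OF \<beta>_gt u0] r(1)] by blast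
  have "prim g (u t) \<ge> 0" "u t > 0" using pos[of t] t r by (auto simp: energy_def)
  then have "u t \<ge> \<beta>" by (rule F_nonneg_imp)
  with turning_level[OF s t(1,3,4)] \<beta>_gt show False by simp
qed

lemma g_lower:
  assumes "c > b" obtains \<gamma> where "\<gamma> > 0" "\<And>s. c \<le> s \<Longrightarrow> s \<le> d \<Longrightarrow> g s \<ge> \<gamma>"
proof (cases "c \<le> d")
  case True
  have "\<exists>x\<in>{c..d}. \<forall>y\<in>{c..d}. g x \<le> g y"
    by (rule continuous_attains_inf) (use True in \<open>auto intro: continuous_on_subset[OF g_cont]\<close>)
  then show ?thesis using that g_pos assms by (metis atLeastAtMost_iff less_le_trans)
next
  case False with that[of 1] show ?thesis by auto
qed

lemma reach:
  assumes s: "sol N g u v" and c: "b < c" "c < u 0"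
  obtains r where "r > 0" "u r = c" "\<And>x. 0 \<le> x \<Longrightarrow> x < r \<Longrightarrow> u x > c" "\<And>x. 0 < x \<Longrightarrow> x \<le> r \<Longrightarrow> v x < 0"
proof -
  have "\<exists>r\<ge>0. u r \<le> c"
  proof (rule ccontr)
    assume "\<not> ?thesis"
    then have gt: "u r > c" if "r \<ge> 0" for r using that by force
    obtain \<gamma> where \<gamma>: "\<gamma> > 0" "\<And>s. c \<le> s \<Longrightarrow> s \<le> u 0 \<Longrightarrow> g s \<ge> \<gamma>" using g_lower[OF c(1), of "u 0"] by blast
    have "v r \<le> - (\<gamma> / N)" if "r > 1" for r
    proof -
      have "v r \<le> - \<gamma> * r / N"
        by (rule sol_slope_le[OF s g_cont N])
           (use gt sol_le_initial[OF s] c that in \<open>auto intro!: \<gamma>(2) less_imp_le[OF gt]\<close>)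
      also have "\<dots> \<le> - (\<gamma> / N)" using that \<gamma> N by (simp add: field_simps)
      finally show ?thesis .
    qed
    then show False
      using decreasing_escape[of 1 u v "\<gamma> / N"] sol_deriv_u[OF s] gt c b_pos \<gamma> N
      by (smt (verit, best) divide_pos_pos of_nat_0_less_iff zero_less_numeral less_trans)
  qed
  then obtain R where R: "R \<ge> 0" "u R \<le> c" by blast
  obtain r where r: "0 < r" "r \<le> R" "c - u r = 0" "\<And>x. 0 \<le> x \<Longrightarrow> x < r \<Longrightarrow> c - u x < 0"
    by (rule first_zero[of 0 R "\<lambda>r. c - u r"])
       (use R c in \<open>auto intro!: continuous_intros continuous_on_subset[OF sol_continuous_u[OF s]]\<close>)
  have gt: "u x > c" if "0 \<le> x" "x < r" for x using r(4)[OF that] by simp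
  have "v x < 0" if "0 < x" "x \<le> r" for x
  proof (rule v_neg[OF s that(1)])
    show "u t > b" if "0 < t" "t < x" for t
      using gt[of t] that \<open>x \<le> r\<close> c by simp
  qed
  with r(1,3) gt that[of r] show ?thesis by simp
qed

text \<open>Otherwise \<open>u\<close> would decrease forever and end up between \<open>c\<close>
  and a level below \<beta>, where the potential has a negative maximum; nonnegative energy then
  keeps the speed away from 0 and \<open>u\<close> leaves the interval after all.\<close>

lemma becomes_small:
  assumes s: "sol N g u v" and u0: "u 0 > \<beta>" and E: "\<And>r. r \<ge> 0 \<Longrightarrow> u r > 0 \<Longrightarrow> energy g u v r \<ge> 0" and c: "c > 0"
  obtains r where "r \<ge> 0" "u r < c"
proof (rule ccontr)
  assume "\<not> thesis"
  with that have ge: "u r \<ge> c" if "r \<ge> 0" for r using that by force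
  have neg: "v r < 0" if "r > 0" for r
  proof (rule dec_while[OF s u0, of "r + 1"])
    show "u x > 0 \<and> energy g u v x \<ge> 0" if "0 < x" "x < r + 1" for x
      using E[of x] ge[of x] c that by auto
  qed (use that in auto)
  \<comment> \<open>The midpoint lies above \<open>b\<close>, so that it is reached, and below
    \<beta>, so that the potential is negative from there down.\<close>
  obtain r0 where r0: "r0 > 0" "u r0 = (b + \<beta>) / 2"
  proof -
    have "b < (b + \<beta>) / 2" "(b + \<beta>) / 2 < u 0" using u0 \<beta>_gt by simp_all
    from reach[OF s this] that show thesis by blast
  qed
  have "c \<le> u r0" using ge r0 by simp
  have "\<exists>x\<in>{c..u r0}. \<forall>y\<in>{c..u r0}. prim g y \<le> prim g x"
    by (rule continuous_attains_sup) (use \<open>c \<le> u r0\<close> F_cont in auto)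
  then obtain x where x: "c \<le> x" "x \<le> u r0" "\<And>y. c \<le> y \<Longrightarrow> y \<le> u r0 \<Longrightarrow> prim g y \<le> prim g x" by auto
  have Fx: "prim g x < 0" using F_neg[of x] x c r0 \<beta>_gt by simp
  have "v r \<le> - sqrt (- 2 * prim g x)" if r: "r > r0" for r
  proof -
    have "u r < u r0" by (rule strict_dec[OF s]) (use r r0 neg in auto)
    then have "prim g (u r) \<le> prim g x" using x(3) ge[of r] r r0 by simp
    moreover have "energy g u v r \<ge> 0" using E[of r] ge[of r] c r r0 by force
    ultimately have "- 2 * prim g x \<le> (v r)\<^sup>2" by (simp add: energy_def)
    then have "sqrt (- 2 * prim g x) \<le> \<bar>v r\<bar>" by (simp add: real_le_rsqrt real_sqrt_le_iff flip: real_sqrt_abs)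
    with neg[of r] r r0 show ?thesis by simp
  qed
  then show False
    using decreasing_escape[of r0 u v "sqrt (- 2 * prim g x)"] sol_deriv_u[OF s] ge c r0 Fx
    by (smt (verit) real_sqrt_gt_0_iff)
qed

text \<open>Positivity, and with it nonnegative energy, persists a little beyond \<open>r\<close>.
  This puts \<open>r\<close> inside an open interval on which \<open>dec_while\<close> applies; and
  as the energy strictly decreases at \<open>r\<close>, it must still be positive there.\<close>

lemma not_trapped_dec:
  assumes s: "sol N g u v" and u0: "u 0 > \<beta>" and nt: "\<not> trapped g u v"
    and r: "r > 0" and pos: "\<And>x. 0 \<le> x \<Longrightarrow> x \<le> r \<Longrightarrow> u x > 0"
  shows "v r < 0" "energy g u v r > 0"
proof -
  have "isCont u r" using DERIV_isCont[OF sol_deriv_u[OF s r]] .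
  then obtain d where d: "d > 0" "\<And>x. \<bar>x - r\<bar> < d \<Longrightarrow> \<bar>u x - u r\<bar> < u r"
    using pos[of r] r unfolding continuous_at_eps_delta dist_real_def by (metis less_eq_real_def)
  have pos': "u x > 0" if "0 \<le> x" "x < r + d" for x
    using pos[of x] d(2)[of x] that by (cases "x \<le> r") auto
  have E: "energy g u v x \<ge> 0" if "0 \<le> x" "x < r + d" for x
    using nt pos' that unfolding trapped_def by (force simp: not_less)
  show neg: "v r < 0"
    by (rule dec_while[OF s u0, of "r + d"]) (use pos' E r d in auto)
  have "- (real N - 1) / r * (v r)\<^sup>2 < 0" using neg r N by (simp add: mult_neg_pos divide_neg_pos)
  then obtain h where h: "h > 0" "\<And>k. 0 < k \<Longrightarrow> k < h \<Longrightarrow> energy g u v r > energy g u v (r + k)"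
    using DERIV_neg_dec_right[OF energy_deriv[OF s r]] by blast
  have "energy g u v (r + min (h/2) (d/2)) < energy g u v r" using h(2)[of "min (h/2) (d/2)"] h(1) d(1) by auto
  moreover have "energy g u v (r + min (h/2) (d/2)) \<ge> 0" using E[of "r + min (h/2) (d/2)"] h(1) d(1) r by auto
  ultimately show "energy g u v r > 0" by simp
qed

lemma not_trapped_hits:
  assumes s: "sol N g u v" and u0: "u 0 > \<beta>" and nt: "\<not> trapped g u v" and c: "0 < c" "c < u 0"
  obtains r where "r > 0" "u r = c" "\<And>x. 0 \<le> x \<Longrightarrow> x < r \<Longrightarrow> u x > c" "\<And>x. 0 < x \<Longrightarrow> x \<le> r \<Longrightarrow> v x < 0"
proof -
  have "\<exists>r\<ge>0. u r \<le> c"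
  proof (rule ccontr)
    assume "\<not> ?thesis"
    then have gt: "u r > c" if "r \<ge> 0" for r using that by force
    have pos: "u r > 0" if "r \<ge> 0" for r using gt[OF that] c by simp
    have "energy g u v r \<ge> 0" if "r \<ge> 0" for r
      using nt that pos unfolding trapped_def by (force simp: not_less)
    then obtain r where "r \<ge> 0" "u r < c"
      using becomes_small[OF s u0 _ c(1)] by blast
    with gt show False by force
  qed
  then obtain R where R: "R \<ge> 0" "u R \<le> c" by blast
  obtain r where r: "0 < r" "r \<le> R" "c - u r = 0" "\<And>x. 0 \<le> x \<Longrightarrow> x < r \<Longrightarrow> c - u x < 0"
    by (rule first_zero[of 0 R "\<lambda>r. c - u r"])
       (use R c in \<open>auto intro!: continuous_intros continuous_on_subset[OF sol_continuous_u[OF s]]\<close>)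
  have gt: "u x > c" if "0 \<le> x" "x < r" for x using r(4)[OF that] by simp
  have "v x < 0" if "0 < x" "x \<le> r" for x
  proof (rule not_trapped_dec[OF s u0 nt that(1)])
    show "u t > 0" if "0 \<le> t" "t \<le> x" for t
      using gt[of t] that \<open>x \<le> r\<close> c r(3) by (cases "t = r") auto
  qed
  with r(1,3) gt that[of r] show ?thesis by simp
qed

text \<open>A zero of a nonnegative solution is a minimum, hence has slope 0, and the solution can
  be cut off. Without a zero the solution decreases, and \<open>becomes_small\<close> makes it tend
  to 0.\<close>

lemma trichotomy:
  assumes s: "sol N g u v" and u0: "u 0 > \<beta>" and nn: "\<And>r. r \<ge> 0 \<Longrightarrow> u r \<ge> 0" and nt: "\<not> trapped g u v"
  obtains w where "radial_ground_state N g w" "w 0 = u 0"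
proof -
  have u0': "u 0 \<noteq> 0" using u0 \<beta>_gt b_pos by simp
  show ?thesis
  proof (cases "\<exists>x\<ge>0. u x = 0")
    case True
    then obtain x where x: "x \<ge> 0" "u x = 0" by blast
    then have x0: "x > 0" using u0' by (cases "x = 0") auto
    have "v x = 0"
      by (rule DERIV_local_min[OF sol_deriv_u[OF s x0], of x]) (use x0 x nn in auto)
    then have cut: "sol N g (\<lambda>r. if r \<le> x then u r else 0) (\<lambda>r. if r \<le> x then v r else 0)"
      using sol_cut[OF s x0 x(2)] g_zero by simp
    have "((\<lambda>r. if r \<le> x then u r else 0) \<longlongrightarrow> 0) at_top"
      by (rule tendsto_eventually, rule eventually_mono[OF eventually_gt_at_top[of x]]) auto
    then have "radial_ground_state N g (\<lambda>r. if r \<le> x then u r else 0)"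
      unfolding radial_ground_state_iff
    proof (intro conjI)
      show "\<exists>v. sol N g (\<lambda>r. if r \<le> x then u r else 0) v" using cut by blast
      show "\<forall>r\<ge>0. 0 \<le> (if r \<le> x then u r else 0)" using nn by simp
      show "\<exists>r\<ge>0. (if r \<le> x then u r else 0) \<noteq> 0" using u0' x0 by (intro exI[of _ 0]) simp
    qed
    then show ?thesis using that[of "\<lambda>r. if r \<le> x then u r else 0"] x0 by simp
  next
    case False
    with nn have pos: "u r > 0" if "r \<ge> 0" for r using that by (metis less_eq_real_def)
    have "(u \<longlongrightarrow> 0) at_top"
    proof (rule order_tendstoI)
      fix a :: real assume "a < 0"
      then show "\<forall>\<^sub>F x in at_top. a < u x"
        by (intro eventually_mono[OF eventually_ge_at_top[of 0]]) (use nn in \<open>metis less_le_trans\<close>)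
    next
      fix a :: real assume a: "0 < a"
      have E: "energy g u v r \<ge> 0" if "r \<ge> 0" for r
        using nt pos that unfolding trapped_def by (force simp: not_less)
      obtain r where r: "r \<ge> 0" "u r < a" using becomes_small[OF s u0 E a] by blast
      have "u x < a" if "x \<ge> r" for x
      proof (cases "x = r")
        case False
        then have "u x < u r"
          by (intro strict_dec[OF s]) (use r that not_trapped_dec(1)[OF s u0 nt] pos in auto)
        with r show ?thesis by simp
      qed (use r in simp)
      then show "\<forall>\<^sub>F x in at_top. u x < a" by (meson eventually_at_top_linorder)
    qed
    then have "radial_ground_state N g u"
      unfolding radial_ground_state_iff using s nn u0' order_refl by blast
    then show ?thesis using that by blast
  qed
qed

lemma vanishing_energy_nonneg:
  assumes s: "sol N g u v" and lim: "(u \<longlongrightarrow> 0) at_top" and R: "R \<ge> 0"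
  shows "energy g u v R \<ge> 0"
proof (rule ccontr)
  assume "\<not> ?thesis"
  then obtain c where c: "c > 0" "\<And>r. r \<ge> R \<Longrightarrow> u r \<ge> c" using trap[OF s R] by auto
  have "\<forall>\<^sub>F r in at_top. u r < c" using order_tendstoD(2)[OF lim c(1)] .
  then have "\<forall>\<^sub>F r in at_top. u r < c \<and> r \<ge> R" using eventually_ge_at_top[of R] by eventually_elim simp
  then obtain r where "u r < c" "r \<ge> R" by (metis (mono_tags, lifting) eventually_at_top_linorder order_refl)
  with c show False by force
qed

lemma vanishing_not_trapped:
  assumes s: "sol N g u v" and lim: "(u \<longlongrightarrow> 0) at_top"
  shows "\<not> trapped g u v"
  using vanishing_energy_nonneg[OF assms] unfolding trapped_def by force

text \<open>From a start at or below \<beta> the energy is at most 0, and it cannot be negative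
  because \<open>u\<close> tends to 0. So it is constantly 0, its derivative forces
  \<open>v = 0\<close>, and \<open>u\<close> is constant, hence trivial. Applied to (H4) this
  locates \<alpha> above \<beta>.\<close>

lemma ground_state_height:
  assumes gs: "radial_ground_state N g u"
  shows "u 0 > \<beta>"
proof (rule ccontr)
  assume le: "\<not> u 0 > \<beta>"
  obtain v where s: "sol N g u v" and nn: "\<And>r. r \<ge> 0 \<Longrightarrow> u r \<ge> 0" and nz: "\<exists>r\<ge>0. u r \<noteq> 0" and lim: "(u \<longlongrightarrow> 0) at_top"
    using gs unfolding radial_ground_state_iff by blast
  have "prim g (u 0) \<le> 0"
    using F_neg[of "u 0"] le nn[of 0] prim_\<beta> by (cases "u 0 = 0"; cases "u 0 = \<beta>") auto
  then have E0: "energy g u v r = 0" if "r \<ge> 0" for r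
    using energy_anti[OF s order_refl that] vanishing_energy_nonneg[OF s lim that]
    by (simp add: energy_def sol_v0[OF s])
  have v0: "v r = 0" if "r > 0" for r
  proof -
    have "(energy g u v has_real_derivative 0) (at r)"
      by (rule has_field_derivative_transform_within_open[OF DERIV_const[of 0], of "{0<..}"]) (use that E0 in auto)
    from DERIV_unique[OF this energy_deriv[OF s that]] that N show ?thesis by simp
  qed
  have const: "u r = u 0" if "r \<ge> 0" for r
  proof (rule ccontr)
    assume "u r \<noteq> u 0"
    with that have r: "r > 0" by (cases "r = 0") auto
    have "u r = u 0"
    proof (rule DERIV_isconst2[of 0 r u r])
      show "(u has_real_derivative 0) (at x)" if "0 < x" "x < r" for x
        using sol_deriv_u[OF s that(1)] v0[OF that(1)] by simp
    qed (use r in \<open>auto intro: continuous_on_subset[OF sol_continuous_u[OF s]]\<close>)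
    with \<open>u r \<noteq> u 0\<close> show False by simp
  qed
  have "\<forall>\<^sub>F r in at_top. u r = u 0" using eventually_ge_at_top[of 0] by eventually_elim (rule const)
  then have "(u \<longlongrightarrow> u 0) at_top" by (rule tendsto_eventually)
  then have "u 0 = 0" using tendsto_unique[OF _ lim] by force
  with nz const show False by auto
qed

end

section \<open>Comparison of two solutions\<close>

text \<open>Two solutions are compared at equal levels, so radius becomes a function of level.
  \<open>J\<close> is an initial segment without last point; every positive point of it then has a
  two-sided neighbourhood in \<open>J\<close>, and the inverse has a two-sided derivative.\<close>

lemma level_inverse:
  assumes s: "sol N g u v" and J: "J \<subseteq> {0..}" "\<And>x. x \<in> J \<Longrightarrow> {0..x} \<subseteq> J" "\<And>x. x \<in> J \<Longrightarrow> \<exists>y\<in>J. x < y"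
    and neg: "\<And>x. x \<in> J \<Longrightarrow> x > 0 \<Longrightarrow> v x < 0"
  obtains \<rho> where "\<And>x. x \<in> J \<Longrightarrow> \<rho> (u x) = x"
    "\<And>x. x \<in> J \<Longrightarrow> x > 0 \<Longrightarrow> (\<rho> has_real_derivative inverse (v x)) (at (u x))"
proof -
  have dec: "u y < u x" if "x \<in> J" "y \<in> J" "x < y" for x y
  proof (rule DERIV_neg_imp_decreasing_open[OF that(3)])
    fix t assume t: "x < t" "t < y"
    then have "t \<in> J" "t > 0" using J that by force+
    then show "\<exists>z. (u has_real_derivative z) (at t) \<and> z < 0"
      using sol_deriv_u[OF s, of t] neg by blast
  next
    show "continuous_on {x..y} u"
      by (rule continuous_on_subset[OF sol_continuous_u[OF s]]) (use J(1) that in force)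
  qed
  have inj: "inj_on u J"
    by (rule inj_onI) (metis dec less_irrefl linorder_neqE_linordered_idom)
  define \<rho> where "\<rho> = the_inv_into J u"
  have inv: "\<rho> (u x) = x" if "x \<in> J" for x
    unfolding \<rho>_def by (rule the_inv_into_f_f[OF inj that])
  have "(\<rho> has_real_derivative inverse (v x)) (at (u x))" if x: "x \<in> J" "x > 0" for x
  proof -
    obtain y where y: "y \<in> J" "x < y" using J(3)[OF x(1)] by blast
    define d where "d = min (x/2) (y - x)"
    have d: "d > 0" "x - d > 0" "x + d \<le> y" using x y by (auto simp: d_def min_def)
    have near: "z \<in> J \<and> z > 0" if "\<bar>z - x\<bar> \<le> d" for z
      using J(2)[OF y(1)] d that by (auto simp: abs_le_iff)
    have cont: "isCont u z" if "\<bar>z - x\<bar> \<le> d" for z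
      using near[OF that] DERIV_isCont[OF sol_deriv_u[OF s, of z]] by blast
    have "isCont \<rho> (u x)"
      by (rule isCont_inverse_function[of d x \<rho> u]) (use d(1) near inv cont in auto)
    moreover have lt: "u (x + d) < u x" "u x < u (x - d)"
      using near[of "x+d"] near[of "x-d"] d(1) x by (auto intro!: dec)
    moreover have "u (\<rho> w) = w" if w: "u (x + d) < w" "w < u (x - d)" for w
    proof -
      have "\<exists>z\<ge>x-d. z \<le> x+d \<and> u z = w"
        by (rule IVT2') (use w d in \<open>auto intro!: continuous_at_imp_continuous_on cont simp: abs_le_iff\<close>)
      then obtain z where z: "x - d \<le> z" "z \<le> x + d" "u z = w" by blast
      then have "z \<in> J" using near[of z] by (simp add: abs_le_iff)
      then show ?thesis using inv z by metis
    qed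
    moreover have "(u has_real_derivative v x) (at (\<rho> (u x)))" using sol_deriv_u[OF s x(2)] inv[OF x(1)] by simp
    ultimately show ?thesis
      using DERIV_inverse_function[of u "v x" \<rho> "u x" "u (x+d)" "u (x-d)"] neg[OF x] by auto
  qed
  with inv that show ?thesis by blast
qed

text \<open>The Pohozaev-type functional of \<open>et_quot_lower\<close>, divided by \<open>r^(N-1) |v|\<close> and stripped of the term
  \<open>2 N F / g\<close>, which depends on the level only and cancels when two solutions are compared at equal levels.\<close>
definition et_quot :: "(real \<Rightarrow> real) \<Rightarrow> (real \<Rightarrow> real) \<Rightarrow> (real \<Rightarrow> real) \<Rightarrow> real \<Rightarrow> real" where
  "et_quot g u v t = t * ((v t)\<^sup>2 + 2 * prim g (u t)) / (- v t)"

text \<open>To be read with \<open>p = |v1|\<close>, \<open>q = |v2|\<close>,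
  \<open>\<phi> = - F\<close> and \<open>n = N - 2\<close>: both sides are rates of decrease of
  \<open>r sqrt (v^2 + 2 F)\<close>, and \<open>q / p\<close> converts the radius of
  \<open>u1\<close> to that of \<open>u2\<close>. The two parts of the numerator are compared
  separately, by \<open>q / a2 \<le> p / a1\<close> and \<open>p * a1 \<le> q * a2\<close>.\<close>

lemma peletier_serrin_rate:
  fixes p q a1 a2 n \<phi> :: real
  assumes "n \<ge> 0" "\<phi> \<ge> 0" "0 < p" "p \<le> q" "a1 > 0" "a2 > 0" "a1\<^sup>2 = p\<^sup>2 - 2*\<phi>" "a2\<^sup>2 = q\<^sup>2 - 2*\<phi>"
  shows "(n * q\<^sup>2 + 2*\<phi>) / a2 \<le> q / p * ((n * p\<^sup>2 + 2*\<phi>) / a1)"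
proof -
  have q: "q > 0" using assms by linarith
  have pq: "p\<^sup>2 \<le> q\<^sup>2" using assms by (intro power_mono) auto
  then have "a1\<^sup>2 \<le> a2\<^sup>2" using assms by simp
  then have a: "a1 \<le> a2" using power2_le_imp_le[of a1 a2] assms(6) by linarith
  have "(q * a1)\<^sup>2 \<le> (p * a2)\<^sup>2"
    unfolding power_mult_distrib assms(7,8) using mult_left_mono[OF pq, of "2*\<phi>"] assms(2) by (simp add: algebra_simps)
  moreover have "p * a2 \<ge> 0" using assms by simp
  ultimately have "q * a1 \<le> p * a2" by (rule power2_le_imp_le)
  then have "q / a2 \<le> p / a1" using assms(5,6) by (simp add: field_simps)
  then have 1: "n * (q / a2) \<le> n * (p / a1)" using assms(1) by (rule mult_left_mono)
  have "p * a1 \<le> q * a2" by (rule mult_mono) (use a assms(3-6) q in linarith)+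
  then have 2: "2*\<phi> / (q * a2) \<le> 2*\<phi> / (p * a1)" using assms(2,3,5,6) q by (intro divide_left_mono mult_pos_pos) auto
  have "(n * q\<^sup>2 + 2*\<phi>) / a2 = q * (n * (q / a2) + 2*\<phi> / (q * a2))"
    using assms(6) q by (simp add: field_simps power2_eq_square)
  also have "\<dots> \<le> q * (n * (p / a1) + 2*\<phi> / (p * a1))" using add_mono[OF 1 2] q by (intro mult_left_mono) auto
  also have "\<dots> = q / p * ((n * p\<^sup>2 + 2*\<phi>) / a1)"
    using assms(3,5) q by (simp add: field_simps power2_eq_square)
  finally show ?thesis .
qed

context well
begin

lemma F_comp_deriv:
  assumes "sol N g u v" "r > 0"
  shows "((\<lambda>r. prim g (u r)) has_real_derivative g (u r) * v r) (at r)"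
  by (rule DERIV_chain2[OF F_deriv sol_deriv_u[OF assms]])

lemma kinetic_deriv:
  assumes "sol N g u v" "r > 0"
  shows "((\<lambda>r. (v r)\<^sup>2 + 2 * prim g (u r)) has_real_derivative - 2 * (real N - 1) / r * (v r)\<^sup>2) (at r)"
proof -
  have "((\<lambda>r. 2 * energy g u v r) has_real_derivative 2 * (- (real N - 1) / r * (v r)\<^sup>2)) (at r)"
    by (rule DERIV_cmult[OF energy_deriv[OF assms]])
  then show ?thesis by (simp add: energy_def algebra_simps)
qed

lemma DERIV_pow_N: "((\<lambda>x::real. x ^ N) has_real_derivative real N * r ^ (N-1)) (at r)"
  using DERIV_pow[of N r] by simp

end

locale uniq = well +
  assumes H2: "s > \<beta> \<Longrightarrow> \<exists>D. ((\<lambda>t. prim g t / g t) has_real_derivative D) (at s) \<and> 2 * real N * D > real N - 2"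
    and H3: "strict_mono_on {b<..} (\<lambda>s. g s / (s - b))"
begin

section \<open>Comparison at equal levels above and below \<beta>\<close>

lemma et_quot_deriv:
  assumes s: "sol N g u v" and t: "t > 0" "v t < 0"
  shows "(et_quot g u v has_real_derivative
     (real N - 2) * v t - 2 * real N * prim g (u t) / v t + g (u t) / v t * et_quot g u v t) (at t)"
proof -
  have "(et_quot g u v has_real_derivative
     ((1 * ((v t)\<^sup>2 + 2 * prim g (u t)) + (- 2 * (real N - 1) / t * (v t)\<^sup>2) * t) * (- v t)
      - t * ((v t)\<^sup>2 + 2 * prim g (u t)) * (- (- (real N - 1) / t * v t - g (u t)))) / (- v t * - v t)) (at t)"
    unfolding et_quot_def using t
    by (intro DERIV_divide DERIV_mult DERIV_ident DERIV_minus kinetic_deriv[OF s] sol_deriv_v[OF s]) auto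
  moreover have "((1 * ((v t)\<^sup>2 + 2 * prim g (u t)) + (- 2 * (real N - 1) / t * (v t)\<^sup>2) * t) * (- v t)
      - t * ((v t)\<^sup>2 + 2 * prim g (u t)) * (- (- (real N - 1) / t * v t - g (u t)))) / (- v t * - v t) =
     (real N - 2) * v t - 2 * real N * prim g (u t) / v t + g (u t) / v t * et_quot g u v t"
    using t by (simp add: et_quot_def divide_simps) (simp add: algebra_simps power2_eq_square)
  ultimately show ?thesis by simp
qed

text \<open>The functional \<open>r^N (v^2 + 2 F) + 2 N (F / g) r^(N-1) v\<close> vanishes at \<open>0\<close> and (H2) says that it increases.\<close>
lemma et_quot_lower:
  assumes s: "sol N g u v" and t: "t > 0" and neg: "\<And>x. 0 < x \<Longrightarrow> x \<le> t \<Longrightarrow> v x < 0" and ut: "u t \<ge> \<beta>"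
  shows "g (u t) * et_quot g u v t > 2 * real N * prim g (u t)"
proof -
  define \<mu> where "\<mu> = (\<lambda>r. r ^ (N-1) * v r)"
  define P where "P = (\<lambda>r. r * \<mu> r * v r + 2 * r ^ N * prim g (u r) + 2 * real N * (prim g (u r) / g (u r)) * \<mu> r)"
  have ugt: "u x > \<beta>" if "0 \<le> x" "x < t" for x
    using strict_dec[OF s that] neg that ut by force
  have ub: "u x > b" if "0 \<le> x" "x \<le> t" for x
    using ugt[of x] ut that \<beta>_gt by (cases "x = t") auto
  have rN: "r ^ N = r * r ^ (N-1)" for r :: real using N by (simp add: power_eq_if)
  have gne: "g (u x) \<noteq> 0" if "x \<in> {0..t}" for x using g_pos[of "u x"] ub[of x] that by auto
  have cu: "continuous_on {0..t} u" and cv: "continuous_on {0..t} v" and cm: "continuous_on {0..t} \<mu>"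
    unfolding \<mu>_def
    by (rule continuous_on_subset[OF sol_continuous_u[OF s]] continuous_on_subset[OF sol_continuous_v[OF s g_cont N]]
       continuous_on_subset[OF sol_mass_continuous[OF s g_cont N]], simp)+
  have "continuous_on {0..t} P"
    unfolding P_def
    by (intro continuous_intros cu cv cm continuous_on_compose2[OF F_cont[of UNIV] cu] continuous_on_compose2[OF g_cont cu])
       (use gne in auto)
  moreover have "\<exists>y. (P has_real_derivative y) (at r) \<and> y > 0" if r: "0 < r" "r < t" for r
  proof -
    obtain D where D: "((\<lambda>t. prim g t / g t) has_real_derivative D) (at (u r))" "2 * real N * D > real N - 2"
      using H2[OF ugt[of r]] r by auto
    have d: "((\<lambda>r. prim g (u r) / g (u r)) has_real_derivative D * v r) (at r)"
      using DERIV_chain2[OF D(1) sol_deriv_u[OF s r(1)]] .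
    have dm: "(\<mu> has_real_derivative - (r ^ (N-1) * g (u r))) (at r)"
      unfolding \<mu>_def by (rule sol_mass_deriv[OF s r(1) N])
    have "(P has_real_derivative
       ((1 * \<mu> r + - (r ^ (N-1) * g (u r)) * r) * v r + (- (real N - 1) / r * v r - g (u r)) * (r * \<mu> r))
       + ((2 * (real N * r ^ (N-1))) * prim g (u r) + (g (u r) * v r) * (2 * r ^ N))
       + (2 * real N * (D * v r) * \<mu> r + - (r ^ (N-1) * g (u r)) * (2 * real N * (prim g (u r) / g (u r))))) (at r)"
      unfolding P_def
      by (intro DERIV_add DERIV_mult[OF DERIV_mult[OF DERIV_ident dm] sol_deriv_v[OF s r(1)]]
           DERIV_mult[OF DERIV_cmult[OF DERIV_pow_N] F_comp_deriv[OF s r(1)]] DERIV_mult[OF DERIV_cmult[OF d] dm])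
    \<comment> \<open>All terms containing \<open>g\<close> or the potential itself cancel; what
      remains has exactly the sign prescribed by (H2).\<close>
    moreover have "((1 * \<mu> r + - (r ^ (N-1) * g (u r)) * r) * v r + (- (real N - 1) / r * v r - g (u r)) * (r * \<mu> r))
       + ((2 * (real N * r ^ (N-1))) * prim g (u r) + (g (u r) * v r) * (2 * r ^ N))
       + (2 * real N * (D * v r) * \<mu> r + - (r ^ (N-1) * g (u r)) * (2 * real N * (prim g (u r) / g (u r))))
       = r ^ (N-1) * (v r)\<^sup>2 * (2 * real N * D - (real N - 2))"
      unfolding \<mu>_def rN using r gne[of r] by (simp add: field_simps power2_eq_square)
    moreover have "r ^ (N-1) * (v r)\<^sup>2 * (2 * real N * D - (real N - 2)) > 0"
      using D(2) r neg[of r] by (intro mult_pos_pos) auto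
    ultimately show ?thesis by metis
  qed
  ultimately have "P 0 < P t" by (intro DERIV_pos_imp_increasing_open[OF t]) auto
  then have "0 < P t" using N by (simp add: P_def \<mu>_def sol_v0[OF s] power_0_left)
  also have "P t = t ^ (N-1) * (- v t) / g (u t) * (g (u t) * et_quot g u v t - 2 * real N * prim g (u t))"
    unfolding P_def \<mu>_def rN et_quot_def using neg[of t] t gne[of t] by (simp add: field_simps power2_eq_square)
  finally have "0 < t ^ (N-1) * (- v t) / g (u t) * (g (u t) * et_quot g u v t - 2 * real N * prim g (u t))" .
  moreover have "t ^ (N-1) * (- v t) / g (u t) > 0"
    using t neg[of t] g_pos[of "u t"] ub[of t] by (intro divide_pos_pos mult_pos_pos) auto
  ultimately have "0 < g (u t) * et_quot g u v t - 2 * real N * prim g (u t)"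
    by (rule zero_less_mult_pos)
  then show ?thesis by simp
qed

text \<open>Both solutions are observed at the same level: \<open>\<tau> r\<close> is the time at which \<open>u2\<close> takes the value \<open>u1 r\<close>.\<close>
lemma erbe_tang:
  assumes s1: "sol N g u1 v1" and s2: "sol N g u2 v2" and R: "R > 0"
    and neg1: "\<And>r. 0 < r \<Longrightarrow> r \<le> R \<Longrightarrow> v1 r < 0" and ge: "u1 R \<ge> \<beta>"
    and \<tau>: "\<And>r. 0 \<le> r \<Longrightarrow> r \<le> R \<Longrightarrow> \<tau> r > 0 \<and> u2 (\<tau> r) = u1 r"
    and neg2: "\<And>r x. 0 \<le> r \<Longrightarrow> r \<le> R \<Longrightarrow> 0 < x \<Longrightarrow> x \<le> \<tau> r \<Longrightarrow> v2 x < 0"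
    and \<tau>d: "\<And>r. 0 < r \<Longrightarrow> r \<le> R \<Longrightarrow> (\<tau> has_real_derivative v1 r / v2 (\<tau> r)) (at r)"
    and \<tau>c: "continuous_on {0..R} \<tau>"
  shows "\<And>r. 0 \<le> r \<Longrightarrow> r \<le> R \<Longrightarrow> v2 (\<tau> r) < v1 r"
    and "R * ((v1 R)\<^sup>2 + 2 * prim g (u1 R)) < (- v1 R) * et_quot g u2 v2 (\<tau> R)"
proof -
  define V where "V = (\<lambda>r. v2 (\<tau> r))"
  \<comment> \<open>The functional \<open>P\<close> of \<open>et_quot_lower\<close> for
    \<open>u1\<close> minus the one for \<open>u2\<close> at radius \<open>\<tau> r\<close>, the
    latter multiplied by the quotient of the masses of \<open>u1\<close> and \<open>u2\<close>. At
    equal levels this weight cancels the two terms with \<open>F / g\<close>.\<close>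
  define D where "D = (\<lambda>r. r ^ N * ((v1 r)\<^sup>2 + 2 * prim g (u1 r)) + r ^ (N-1) * v1 r * et_quot g u2 v2 (\<tau> r))"
  have rN: "r ^ N = r * r ^ (N-1)" for r :: real using N by (simp add: power_eq_if)
  have Vneg: "V r < 0" if "0 \<le> r" "r \<le> R" for r unfolding V_def using neg2[OF that] \<tau>[OF that] by auto
  have uge: "u1 x \<ge> \<beta>" if "0 \<le> x" "x \<le> R" for x
    using strict_dec[OF s1, of x R] neg1 ge that by (cases "x = R") force+
  have u2ge: "u2 (\<tau> r) \<ge> \<beta>" if "0 \<le> r" "r \<le> R" for r using \<tau>[OF that] uge[OF that] by simp
  have YL: "g (u1 r) * et_quot g u2 v2 (\<tau> r) > 2 * real N * prim g (u1 r)" if "0 \<le> r" "r \<le> R" for r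
    using et_quot_lower[OF s2 _ _ u2ge[OF that]] \<tau>[OF that] neg2[OF that] by auto
  have cV: "continuous_on {0..R} V"
    unfolding V_def by (rule continuous_on_compose2[OF sol_continuous_v[OF s2 g_cont N] \<tau>c]) (use \<tau> in force)
  have cY: "continuous_on {0..R} (\<lambda>r. et_quot g u2 v2 (\<tau> r))"
  proof (rule continuous_on_compose2[OF _ \<tau>c])
    show "continuous_on (\<tau> ` {0..R}) (et_quot g u2 v2)"
    proof (rule continuous_at_imp_continuous_on, rule ballI)
      fix x assume "x \<in> \<tau> ` {0..R}"
      then obtain r where "0 \<le> r" "r \<le> R" "x = \<tau> r" by auto
      then show "isCont (et_quot g u2 v2) x" using DERIV_isCont[OF et_quot_deriv[OF s2]] \<tau>[of r] neg2[of r x] by auto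
    qed
  qed simp
  have Dc: "continuous_on {0..R} D"
    unfolding D_def
    by (intro continuous_intros cY continuous_on_compose2[OF F_cont[of UNIV]]
        continuous_on_subset[OF sol_continuous_u[OF s1]] continuous_on_subset[OF sol_continuous_v[OF s1 g_cont N]]) auto
  have Vd: "(V has_real_derivative (- (real N - 1) / \<tau> r * V r - g (u1 r)) * (v1 r / V r)) (at r)"
    if r: "0 < r" "r \<le> R" for r
    unfolding V_def using DERIV_chain2[OF sol_deriv_v[OF s2] \<tau>d[OF r]] \<tau>[of r] r by simp
  have Dd: "(D has_real_derivative - (r ^ (N-1) * (1 - (v1 r)\<^sup>2 / (V r)\<^sup>2) * (g (u1 r) * et_quot g u2 v2 (\<tau> r) - 2 * real N * prim g (u1 r)))) (at r)"
    if r: "0 < r" "r \<le> R" for r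
  proof -
    define y where "y = et_quot g u2 v2 (\<tau> r)"
    have t: "\<tau> r > 0" "u2 (\<tau> r) = u1 r" "v2 (\<tau> r) < 0" using \<tau>[of r] r neg2[of r "\<tau> r"] by auto
    have dY: "((\<lambda>r. et_quot g u2 v2 (\<tau> r)) has_real_derivative
      ((real N - 2) * V r - 2 * real N * prim g (u1 r) / V r + g (u1 r) / V r * y) * (v1 r / V r)) (at r)"
      using DERIV_chain2[OF et_quot_deriv[OF s2 t(1,3)] \<tau>d[OF r]] unfolding V_def y_def t(2) .
    have "(D has_real_derivative
      ((real N * r ^ (N-1)) * ((v1 r)\<^sup>2 + 2 * prim g (u1 r))
         + (- 2 * (real N - 1) / r * (v1 r)\<^sup>2) * r ^ N)
      + ((- (r ^ (N-1) * g (u1 r))) * y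
         + (((real N - 2) * V r - 2 * real N * prim g (u1 r) / V r + g (u1 r) / V r * y) * (v1 r / V r)) * (r ^ (N-1) * v1 r))) (at r)"
      unfolding D_def y_def
      by (intro DERIV_add DERIV_mult[OF DERIV_pow_N kinetic_deriv[OF s1 r(1)]]
          DERIV_mult[OF sol_mass_deriv[OF s1 r(1) N] dY[unfolded y_def]])
    moreover have "((real N * r ^ (N-1)) * ((v1 r)\<^sup>2 + 2 * prim g (u1 r))
         + (- 2 * (real N - 1) / r * (v1 r)\<^sup>2) * r ^ N)
      + ((- (r ^ (N-1) * g (u1 r))) * y
         + (((real N - 2) * V r - 2 * real N * prim g (u1 r) / V r + g (u1 r) / V r * y) * (v1 r / V r)) * (r ^ (N-1) * v1 r))
      = - (r ^ (N-1) * (1 - (v1 r)\<^sup>2 / (V r)\<^sup>2) * (g (u1 r) * y - 2 * real N * prim g (u1 r)))"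
      unfolding rN using r Vneg[of r] by (simp add: field_simps power2_eq_square)
    ultimately show ?thesis unfolding y_def by simp
  qed
  \<comment> \<open>As long as \<open>u2\<close> is steeper, both nontrivial factors of the
    derivative of \<open>D\<close> in \<open>Dd\<close> are positive, the second one by
    \<open>et_quot_lower\<close> for \<open>u2\<close>.\<close>
  have D_neg: "D c < 0" if c: "0 < c" "c \<le> R" and lt: "\<And>r. 0 \<le> r \<Longrightarrow> r < c \<Longrightarrow> V r < v1 r" for c
  proof -
    have "D c < D 0"
    proof (rule DERIV_neg_imp_decreasing_open[OF c(1)])
      fix r assume r: "0 < r" "r < c"
      have "v1 r < 0" "V r < v1 r" using neg1[of r] lt[of r] r c by auto
      then have "(- v1 r)\<^sup>2 < (- V r)\<^sup>2" by (intro power_strict_mono) auto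
      then have "(v1 r)\<^sup>2 < (V r)\<^sup>2" by simp
      then have "(v1 r)\<^sup>2 / (V r)\<^sup>2 < 1" using Vneg[of r] r c by (simp add: divide_less_eq_1)
      then have "r ^ (N-1) * (1 - (v1 r)\<^sup>2 / (V r)\<^sup>2) * (g (u1 r) * et_quot g u2 v2 (\<tau> r) - 2 * real N * prim g (u1 r)) > 0"
        using YL[of r] r c by (intro mult_pos_pos) auto
      then show "\<exists>y. (D has_real_derivative y) (at r) \<and> y < 0" using Dd[of r] r c by force
    qed (use c in \<open>auto intro: continuous_on_subset[OF Dc]\<close>)
    also have "D 0 = 0" using N by (simp add: D_def sol_v0[OF s1] power_0_left)
    finally show ?thesis .
  qed
  have D_imp: "r * ((v1 r)\<^sup>2 + 2 * prim g (u1 r)) < (- v1 r) * et_quot g u2 v2 (\<tau> r)" if "D r < 0" "r > 0" for r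
  proof -
    have "r ^ (N-1) * (r * ((v1 r)\<^sup>2 + 2 * prim g (u1 r)) + v1 r * et_quot g u2 v2 (\<tau> r)) < 0"
      using that(1) unfolding D_def rN by (simp add: algebra_simps)
    moreover have "r ^ (N-1) > 0" using that by simp
    ultimately have "r * ((v1 r)\<^sup>2 + 2 * prim g (u1 r)) + v1 r * et_quot g u2 v2 (\<tau> r) < 0"
      using mult_less_0_iff that(2) by (metis less_asym)
    then show ?thesis by simp
  qed
  have main: "V r < v1 r" if r: "0 \<le> r" "r \<le> R" for r
  proof (rule ccontr)
    assume "\<not> V r < v1 r"
    then obtain c where c: "0 < c" "c \<le> r" "V c - v1 c = 0" "\<And>x. 0 \<le> x \<Longrightarrow> x < c \<Longrightarrow> V x - v1 x < 0"
      using first_zero[of 0 r "\<lambda>r. V r - v1 r"] r Vneg[of 0] R sol_v0[OF s1]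
        continuous_on_diff[OF continuous_on_subset[OF cV] continuous_on_subset[OF sol_continuous_v[OF s1 g_cont N]], of "{0..r}"]
      by auto
    have cR: "c \<le> R" using c r by simp
    have "D c < 0" by (rule D_neg[OF c(1) cR]) (use c(4) in force)
    then have "c * ((v1 c)\<^sup>2 + 2 * prim g (u1 c)) < (- v1 c) * et_quot g u2 v2 (\<tau> c)" by (rule D_imp[OF _ c(1)])
    also have "(- v1 c) * et_quot g u2 v2 (\<tau> c) = \<tau> c * ((v1 c)\<^sup>2 + 2 * prim g (u1 c))"
      using c(3) neg1[OF c(1) cR] \<tau>[of c] c(1) cR by (simp add: et_quot_def V_def)
    finally have "(\<tau> c - c) * ((v1 c)\<^sup>2 + 2 * prim g (u1 c)) > 0" by (simp add: algebra_simps)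
    moreover have "prim g (u1 c) \<ge> 0"
      using F_pos[of "u1 c"] uge[of c] c(1) cR prim_\<beta> by (cases "u1 c = \<beta>") auto
    then have "(v1 c)\<^sup>2 + 2 * prim g (u1 c) > 0" using neg1[OF c(1) cR] by (simp add: add_pos_nonneg)
    \<comment> \<open>At the first radius with equal slopes, \<open>D < 0\<close> says that
      \<open>u2\<close> is at the larger radius. There its damping is weaker, so
      \<open>V - v1\<close> has a negative derivative at \<open>c\<close> and was positive just
      before, a contradiction.\<close>
    ultimately have lt: "c < \<tau> c" by (simp add: zero_less_mult_iff)
    have "((\<lambda>r. V r - v1 r) has_real_derivative
      (- (real N - 1) / \<tau> c * V c - g (u1 c)) * (v1 c / V c) - (- (real N - 1) / c * v1 c - g (u1 c))) (at c)"
      by (rule DERIV_diff[OF Vd[OF c(1) cR] sol_deriv_v[OF s1 c(1)]])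
    moreover have "(- (real N - 1) / \<tau> c * V c - g (u1 c)) * (v1 c / V c) - (- (real N - 1) / c * v1 c - g (u1 c))
       = (real N - 1) * (- v1 c) * (1 / \<tau> c - 1 / c)"
    proof -
      have "V c = v1 c" "v1 c \<noteq> 0" using c(3) neg1[OF c(1) cR] by auto
      moreover have "- (real N - 1) / \<tau> c * x - y - (- (real N - 1) / c * x - y) = (real N - 1) * (- x) * (1 / \<tau> c - 1 / c)" for x y
        by (simp add: right_diff_distrib left_diff_distrib diff_divide_distrib)
      ultimately show ?thesis by simp
    qed
    moreover have "(real N - 1) * (- v1 c) * (1 / \<tau> c - 1 / c) < 0"
      using lt c(1) neg1[OF c(1) cR] N by (intro mult_pos_neg mult_pos_pos) (auto simp: field_simps)
    ultimately obtain d where d: "d > 0" "\<And>h. 0 < h \<Longrightarrow> h < d \<Longrightarrow> V c - v1 c < V (c - h) - v1 (c - h)"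
      using DERIV_neg_dec_left[of "\<lambda>r. V r - v1 r" _ c] by (metis (no_types, lifting))
    define h where "h = min (d/2) (c/2)"
    have h: "0 < h" "h < d" "h < c" using d c(1) by (auto simp: h_def min_def)
    show False using d(2)[of h] c(3) c(4)[of "c - h"] h by simp
  qed
  then show "\<And>r. 0 \<le> r \<Longrightarrow> r \<le> R \<Longrightarrow> v2 (\<tau> r) < v1 r" by (simp add: V_def)
  show "R * ((v1 R)\<^sup>2 + 2 * prim g (u1 R)) < (- v1 R) * et_quot g u2 v2 (\<tau> R)"
    by (rule D_imp[OF D_neg[OF R]]) (use main R in auto)
qed

text \<open>Below the level \<open>\<beta>\<close> the difference of the quantities \<open>r sqrt (v^2 + 2 F)\<close>, taken at equal levels, does not
  decrease as long as \<open>u2\<close> is the steeper solution.\<close>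
lemma peletier_serrin:
  assumes s1: "sol N g u1 v1" and s2: "sol N g u2 v2" and ts: "ts > 0" "ts \<le> T"
    and \<sigma>: "\<And>t. ts \<le> t \<Longrightarrow> t \<le> T \<Longrightarrow> \<sigma> t > 0 \<and> u1 (\<sigma> t) = u2 t \<and> v1 (\<sigma> t) < 0 \<and> energy g u1 v1 (\<sigma> t) > 0"
    and u2: "\<And>t. ts \<le> t \<Longrightarrow> t \<le> T \<Longrightarrow> 0 < u2 t \<and> u2 t \<le> \<beta> \<and> v2 t < 0"
    and \<sigma>d: "\<And>t. ts \<le> t \<Longrightarrow> t \<le> T \<Longrightarrow> (\<sigma> has_real_derivative v2 t / v1 (\<sigma> t)) (at t)"
    and start: "ts \<le> \<sigma> ts" "\<sigma> ts * sqrt (2 * energy g u1 v1 (\<sigma> ts)) < ts * sqrt (2 * energy g u2 v2 ts)"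
  shows "T * (- v2 T) \<ge> ts * sqrt (2 * energy g u2 v2 ts) - \<sigma> ts * sqrt (2 * energy g u1 v1 (\<sigma> ts))"
proof -
  define a1 where "a1 = (\<lambda>t. sqrt (2 * energy g u1 v1 (\<sigma> t)))"
  define a2 where "a2 = (\<lambda>t. sqrt (2 * energy g u2 v2 t))"
  define V where "V = (\<lambda>t. v1 (\<sigma> t))"
  define w where "w = (\<lambda>t. t * a2 t - \<sigma> t * a1 t)"
  have F: "prim g (u2 t) \<le> 0" if "ts \<le> t" "t \<le> T" for t
    using F_neg[of "u2 t"] u2[OF that] prim_\<beta> by (cases "u2 t = \<beta>") auto
  have e1: "energy g u1 v1 (\<sigma> t) = (V t)\<^sup>2 / 2 + prim g (u2 t)" if "ts \<le> t" "t \<le> T" for t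
    using \<sigma>[OF that] by (simp add: energy_def V_def)
  have a1p: "a1 t > 0" if "ts \<le> t" "t \<le> T" for t unfolding a1_def using \<sigma>[OF that] by simp
  have a1sq: "(a1 t)\<^sup>2 = (V t)\<^sup>2 + 2 * prim g (u2 t)" if "ts \<le> t" "t \<le> T" for t
    unfolding a1_def using \<sigma>[OF that] e1[OF that] by simp
  have c\<sigma>: "continuous_on {ts..T} \<sigma>"
    by (rule continuous_at_imp_continuous_on) (use \<sigma>d DERIV_isCont in fastforce)
  have cV: "continuous_on {ts..T} V"
    unfolding V_def by (rule continuous_on_compose2[OF sol_continuous_v[OF s1 g_cont N] c\<sigma>]) (use \<sigma> in force)
  have cv2: "continuous_on {ts..T} v2" by (rule continuous_on_subset[OF sol_continuous_v[OF s2 g_cont N]]) (use ts in auto)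
  have ca1: "continuous_on {ts..T} a1"
    unfolding a1_def by (intro continuous_intros continuous_on_compose2[OF energy_cont[OF s1] c\<sigma>]) (use \<sigma> in force)
  have ca2: "continuous_on {ts..T} a2"
    unfolding a2_def by (intro continuous_intros continuous_on_subset[OF energy_cont[OF s2]]) (use ts in auto)
  have cw: "continuous_on {ts..T} w" unfolding w_def by (intro continuous_intros ca1 ca2 c\<sigma>)
  have E2: "energy g u2 v2 t > 0 \<and> (a2 t)\<^sup>2 = (v2 t)\<^sup>2 + 2 * prim g (u2 t) \<and> a1 t \<le> a2 t"
    if t: "ts \<le> t" "t \<le> T" and lt: "v2 t \<le> V t" for t
  proof -
    have "(- V t)\<^sup>2 \<le> (- v2 t)\<^sup>2" by (rule power_mono) (use lt \<sigma>[OF t] in \<open>auto simp: V_def\<close>)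
    then have le: "energy g u1 v1 (\<sigma> t) \<le> energy g u2 v2 t" unfolding e1[OF t] by (simp add: energy_def)
    then have "energy g u2 v2 t > 0" using \<sigma>[OF t] by linarith
    then show ?thesis using le unfolding a1_def a2_def by (simp add: energy_def)
  qed
  have wd: "\<exists>y. (w has_real_derivative y) (at t) \<and> y \<ge> 0" if t: "ts \<le> t" "t \<le> T" and lt: "v2 t \<le> V t" for t
  proof -
    note E2 = E2[OF t lt]
    have t0: "t > 0" using t ts by simp
    have sg: "\<sigma> t > 0" "u1 (\<sigma> t) = u2 t" "V t < 0" "energy g u1 v1 (\<sigma> t) > 0" using \<sigma>[OF t] by (auto simp: V_def)
    have v2n: "v2 t < 0" using u2[OF t] by simp
    have a2p: "a2 t > 0" unfolding a2_def using E2 by simp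
    have d\<sigma>: "(\<sigma> has_real_derivative v2 t / V t) (at t)" using \<sigma>d[OF t] by (simp add: V_def)
    have d2: "(a2 has_real_derivative inverse (sqrt (2 * energy g u2 v2 t)) / 2 * (2 * (- (real N - 1) / t * (v2 t)\<^sup>2))) (at t)"
      unfolding a2_def using E2
      by (intro DERIV_chain2[OF DERIV_real_sqrt DERIV_cmult[OF energy_deriv[OF s2 t0]]]) auto
    have d1: "(a1 has_real_derivative inverse (sqrt (2 * energy g u1 v1 (\<sigma> t))) / 2 * (2 * (- (real N - 1) / \<sigma> t * (V t)\<^sup>2 * (v2 t / V t)))) (at t)"
      unfolding a1_def V_def using sg
      by (intro DERIV_chain2[OF DERIV_real_sqrt DERIV_cmult[OF DERIV_chain2[OF energy_deriv[OF s1] \<sigma>d[OF t]]]]) auto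
    have "(w has_real_derivative
       (1 * a2 t + (inverse (sqrt (2 * energy g u2 v2 t)) / 2 * (2 * (- (real N - 1) / t * (v2 t)\<^sup>2))) * t)
     - (v2 t / V t * a1 t + (inverse (sqrt (2 * energy g u1 v1 (\<sigma> t))) / 2 * (2 * (- (real N - 1) / \<sigma> t * (V t)\<^sup>2 * (v2 t / V t)))) * \<sigma> t)) (at t)"
      unfolding w_def
      by (intro DERIV_diff DERIV_mult[OF DERIV_ident d2] DERIV_mult[OF d\<sigma> d1])
    moreover have "1 * a2 t + (inverse (sqrt (2 * energy g u2 v2 t)) / 2 * (2 * (- (real N - 1) / t * (v2 t)\<^sup>2))) * t
        = - (((real N - 2) * (- v2 t)\<^sup>2 + 2 * (- prim g (u2 t))) / a2 t)"
    proof -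
      have "1 * a2 t + (inverse (a2 t) / 2 * (2 * (- (real N - 1) / t * (v2 t)\<^sup>2))) * t = ((a2 t)\<^sup>2 - (real N - 1) * (v2 t)\<^sup>2) / a2 t"
        using t0 a2p by (simp add: field_simps power2_eq_square)
      also have "\<dots> = - (((real N - 2) * (- v2 t)\<^sup>2 + 2 * (- prim g (u2 t))) / a2 t)"
        using E2 a2p by (simp add: field_simps)
      finally show ?thesis by (simp add: a2_def)
    qed
    moreover have "v2 t / V t * a1 t + (inverse (sqrt (2 * energy g u1 v1 (\<sigma> t))) / 2 * (2 * (- (real N - 1) / \<sigma> t * (V t)\<^sup>2 * (v2 t / V t)))) * \<sigma> t
        = - ((- v2 t) / (- V t) * (((real N - 2) * (- V t)\<^sup>2 + 2 * (- prim g (u2 t))) / a1 t))"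
    proof -
      have "v2 t / V t * a1 t + (inverse (a1 t) / 2 * (2 * (- (real N - 1) / \<sigma> t * (V t)\<^sup>2 * (v2 t / V t)))) * \<sigma> t
         = v2 t / V t * (((a1 t)\<^sup>2 - (real N - 1) * (V t)\<^sup>2) / a1 t)"
        using sg a1p[OF t] by (simp add: field_simps power2_eq_square)
      also have "\<dots> = - ((- v2 t) / (- V t) * (((real N - 2) * (- V t)\<^sup>2 + 2 * (- prim g (u2 t))) / a1 t))"
        unfolding a1sq[OF t] using sg a1p[OF t] by (simp add: field_simps)
      finally show ?thesis by (simp add: a1_def)
    qed
    moreover have "((real N - 2) * (- v2 t)\<^sup>2 + 2 * (- prim g (u2 t))) / a2 t
      \<le> (- v2 t) / (- V t) * (((real N - 2) * (- V t)\<^sup>2 + 2 * (- prim g (u2 t))) / a1 t)"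
      by (rule peletier_serrin_rate) (use N F[OF t] sg lt a1p[OF t] a2p a1sq[OF t] E2 in auto)
    ultimately show ?thesis by (metis (no_types, lifting) diff_ge_0_iff_ge neg_le_iff_le)
  qed
  \<comment> \<open>Bootstrap: \<open>grow\<close> turns steepness of \<open>u2\<close> on the past
    into growth of \<open>w\<close> and \<open>\<sigma> t \<ge> t\<close>, and \<open>step\<close>
    turns these two facts back into strict steepness at \<open>t\<close>. So a first radius of equal
    slopes cannot exist.\<close>
  have grow: "w t \<ge> w ts \<and> \<sigma> t \<ge> t" if t: "ts \<le> t" "t \<le> T" and lt: "\<And>x. ts \<le> x \<Longrightarrow> x < t \<Longrightarrow> v2 x \<le> V x" for t
  proof
    show "w t \<ge> w ts"
      by (rule DERIV_nonneg_imp_increasing_open[OF t(1)]) (use wd lt t cw in \<open>auto intro: continuous_on_subset\<close>)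
    have "\<sigma> ts - ts \<le> \<sigma> t - t"
    proof (rule DERIV_nonneg_imp_increasing_open[OF t(1)])
      fix x assume x: "ts < x" "x < t"
      have "((\<lambda>t. \<sigma> t - t) has_real_derivative v2 x / V x - 1) (at x)"
        unfolding V_def by (rule DERIV_diff[OF \<sigma>d DERIV_ident]) (use x t in auto)
      moreover have "v2 x / V x \<ge> 1" using lt[of x] \<sigma>[of x] x t by (simp add: V_def le_divide_eq)
      ultimately show "\<exists>y. ((\<lambda>t. \<sigma> t - t) has_real_derivative y) (at x) \<and> y \<ge> 0" by (meson diff_ge_0_iff_ge)
    qed (intro continuous_intros continuous_on_subset[OF c\<sigma>], use t in auto)
    then show "\<sigma> t \<ge> t" using start by simp
  qed
  have w0: "w ts > 0" using start by (simp add: w_def a1_def a2_def)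
  \<comment> \<open>Positivity of \<open>w\<close> reads
    \<open>\<sigma> t * a1 t < t * a2 t\<close>; since \<open>t \<le> \<sigma> t\<close> the radii
    can be removed, and at equal potential a larger \<open>a2\<close> means a larger speed.\<close>
  have step: "v2 t < V t" if t: "ts \<le> t" "t \<le> T" and g: "w t \<ge> w ts" "\<sigma> t \<ge> t" for t
  proof -
    have "\<sigma> t * a1 t < t * a2 t" using g w0 by (simp add: w_def)
    also have "\<dots> \<le> \<sigma> t * a2 t"
      using g(2) a1p[OF t] \<open>\<sigma> t * a1 t < t * a2 t\<close> t ts by (intro mult_right_mono) (auto, smt (verit) mult_nonneg_nonpos mult_pos_pos)
    finally have a: "a1 t < a2 t" using \<sigma>[OF t] by simp
    then have "energy g u1 v1 (\<sigma> t) < energy g u2 v2 t" by (simp add: a1_def a2_def)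
    then have "(V t)\<^sup>2 < (v2 t)\<^sup>2" unfolding e1[OF t] by (simp add: energy_def)
    then have "(- V t)\<^sup>2 < (- v2 t)\<^sup>2" by simp
    then have "- V t < - v2 t" by (rule power_less_imp_less_base) (use u2[OF t] in auto)
    then show ?thesis by simp
  qed
  have all: "v2 t < V t" if t: "ts \<le> t" "t \<le> T" for t
  proof (rule ccontr)
    assume n: "\<not> v2 t < V t"
    have "v2 ts < V ts" by (rule step) (use ts start in auto)
    then obtain c where c: "ts < c" "c \<le> t" "v2 c - V c = 0" "\<And>x. ts \<le> x \<Longrightarrow> x < c \<Longrightarrow> v2 x - V x < 0"
      using first_zero[of ts t "\<lambda>r. v2 r - V r"] n t
        continuous_on_subset[OF continuous_on_diff[OF cv2 cV], of "{ts..t}"] by auto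
    have "w c \<ge> w ts \<and> \<sigma> c \<ge> c" by (rule grow) (use c t in force)+
    then have "v2 c < V c" using step[of c] c t by auto
    with c(3) show False by simp
  qed
  have TT: "ts \<le> T" "T \<le> T" using ts by auto
  have "w ts \<le> w T" using grow[OF TT] all by force
  also have "\<dots> \<le> T * a2 T" unfolding w_def using a1p[OF TT] \<sigma>[OF TT] by simp
  also have "a2 T \<le> sqrt ((- v2 T)\<^sup>2)" unfolding a2_def by (rule real_sqrt_le_mono) (use F[OF TT] in \<open>simp add: energy_def\<close>)
  then have "T * a2 T \<le> T * (- v2 T)" using u2[OF TT] ts by (intro mult_left_mono) auto
  finally show ?thesis by (simp add: w_def a1_def a2_def)
qed

text \<open>\<open>W\<close> is the Wronskian of \<open>u1 - b\<close> and \<open>u2 - b\<close>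
  with weight \<open>r^(N-1)\<close>. It vanishes at 0, and (H3) gives its derivative a sign as long
  as both solutions are above \<open>b\<close> in the stated order.\<close>

lemma sturm:
  assumes s1: "sol N g u1 v1" and s2: "sol N g u2 v2" and r: "r > 0"
    and lt: "\<And>x. 0 < x \<Longrightarrow> x < r \<Longrightarrow> b < u1 x \<and> u1 x < u2 x"
  shows "v2 r * (u1 r - b) < v1 r * (u2 r - b)"
proof -
  define W where "W = (\<lambda>r. r ^ (N-1) * v2 r * (u1 r - b) - r ^ (N-1) * v1 r * (u2 r - b))"
  have "W r < W 0"
  proof (rule DERIV_neg_imp_decreasing_open[OF r])
    fix x assume x: "0 < x" "x < r"
    have l: "b < u1 x" "u1 x < u2 x" using lt[OF x] by auto
    have "(W has_real_derivative
       ((- (x ^ (N-1) * g (u2 x))) * (u1 x - b) + (v1 x - 0) * (x ^ (N-1) * v2 x))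
     - ((- (x ^ (N-1) * g (u1 x))) * (u2 x - b) + (v2 x - 0) * (x ^ (N-1) * v1 x))) (at x)"
      unfolding W_def
      by (intro DERIV_diff DERIV_mult sol_mass_deriv[OF s1 x(1) N] sol_mass_deriv[OF s2 x(1) N]
          sol_deriv_u[OF s1 x(1)] sol_deriv_u[OF s2 x(1)] DERIV_const)
    moreover have "g (u1 x) / (u1 x - b) < g (u2 x) / (u2 x - b)"
      using strict_mono_onD[OF H3, of "u1 x" "u2 x"] l by auto
    then have "g (u1 x) * (u2 x - b) < g (u2 x) * (u1 x - b)" using l by (simp add: field_simps)
    then have "x ^ (N-1) * (g (u1 x) * (u2 x - b)) < x ^ (N-1) * (g (u2 x) * (u1 x - b))" using x by simp
    ultimately show "\<exists>y. (W has_real_derivative y) (at x) \<and> y < 0" by (force simp: algebra_simps)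
  next
    show "continuous_on {0..r} W" unfolding W_def
      by (intro continuous_intros continuous_on_subset[OF sol_mass_continuous[OF s1 g_cont N]]
        continuous_on_subset[OF sol_mass_continuous[OF s2 g_cont N]]
        continuous_on_subset[OF sol_continuous_u[OF s1]] continuous_on_subset[OF sol_continuous_u[OF s2]]) auto
  qed
  also have "W 0 = 0" by (simp add: W_def sol_v0[OF s1] sol_v0[OF s2])
  finally have "r ^ (N-1) * (v2 r * (u1 r - b) - v1 r * (u2 r - b)) < 0" by (simp add: W_def algebra_simps)
  moreover have "r ^ (N-1) > 0" using r by simp
  ultimately have "v2 r * (u1 r - b) - v1 r * (u2 r - b) < 0" using mult_less_0_iff r by (metis less_asym)
  then show ?thesis by simp
qed

lemma log_escape:
  assumes s: "sol N g u v" and ts: "ts > 0" and d: "\<delta> > 0"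
    and slope: "\<And>t. t \<ge> ts \<Longrightarrow> t * (- v t) \<ge> \<delta>" and nn: "\<And>t. t \<ge> ts \<Longrightarrow> u t \<ge> 0"
  shows False
proof -
  \<comment> \<open>A slope of at most \<open>- \<delta> / t\<close> has a logarithmically divergent
    integral; at this \<open>T\<close> it has consumed \<open>u ts + 1\<close>.\<close>
  define T where "T = ts * exp ((u ts + 1) / \<delta>)"
  have T: "ts \<le> T" using ts d nn[of ts] by (simp add: T_def)
  have "u T + \<delta> * ln T \<le> u ts + \<delta> * ln ts"
  proof (rule DERIV_nonpos_imp_nonincreasing[OF T, where f = "\<lambda>t. u t + \<delta> * ln t"])
    fix x assume x: "ts \<le> x" "x \<le> T"
    have "((\<lambda>t. u t + \<delta> * ln t) has_real_derivative v x + \<delta> * (1 / x)) (at x)"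
      by (intro DERIV_add sol_deriv_u[OF s] DERIV_cmult DERIV_ln_divide) (use x ts in auto)
    moreover have "v x + \<delta> * (1 / x) \<le> 0" using slope[OF x(1)] x ts by (simp add: field_simps)
    ultimately show "\<exists>y. ((\<lambda>t. u t + \<delta> * ln t) has_real_derivative y) (at x) \<and> y \<le> 0" by blast
  qed
  moreover have "\<delta> * ln T = \<delta> * ln ts + (u ts + 1)" using ts d by (simp add: T_def ln_mult field_simps)
  ultimately show False using nn[OF T] by simp
qed

text \<open>The asymmetry of the hypotheses is what the two applications need: with a ground state
  as \<open>u1\<close>, solutions starting above it must cross; with a ground state as
  \<open>u2\<close>, solutions starting below it, but above \<beta>, must be trapped.\<close>

theorem comparison:
  assumes s1: "sol N g u1 v1" and s2: "sol N g u2 v2" and h: "\<beta> < u1 0" "u1 0 < u2 0"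
    and nt: "\<not> trapped g u1 v1" and nn: "\<And>r. r \<ge> 0 \<Longrightarrow> u2 r \<ge> 0"
  shows False
proof -
  \<comment> \<open>\<open>u1\<close> decreases as long as it is positive because it is not trapped.
    \<open>u2\<close> is only known to be nonnegative and may turn, so it is followed up to its
    first turning point.\<close>
  define J1 where "J1 = {r. r \<ge> 0 \<and> (\<forall>x\<in>{0..r}. u1 x > 0)}"
  define J2 where "J2 = {r. r \<ge> 0 \<and> (\<forall>x\<in>{0<..r}. v2 x < 0)}"
  have u20: "u2 0 > b" using h \<beta>_gt by simp
  have neg1: "v1 x < 0 \<and> energy g u1 v1 x > 0" if "x \<in> J1" "x > 0" for x
    using not_trapped_dec[OF s1 h(1) nt that(2)] that(1) by (auto simp: J1_def)
  have ext1: "\<exists>y\<in>J1. x < y" if x: "x \<in> J1" for x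
  proof -
    have "continuous (at x within {0..}) u1"
      using sol_continuous_u[OF s1] x by (auto simp: J1_def continuous_on_eq_continuous_within)
    moreover have "u1 x > 0" using x by (auto simp: J1_def)
    ultimately obtain d where d: "d > 0" "\<And>y. y \<ge> 0 \<Longrightarrow> \<bar>y - x\<bar> < d \<Longrightarrow> \<bar>u1 y - u1 x\<bar> < u1 x"
      unfolding continuous_within_eps_delta dist_real_def by (metis atLeast_iff)
    have "u1 y > 0" if "0 \<le> y" "y \<le> x + d/2" for y
      using x d(2)[of y] that d(1) by (cases "y \<le> x") (auto simp: J1_def)
    then have "x + d/2 \<in> J1" using x d(1) by (auto simp: J1_def)
    then show ?thesis using d(1) by force
  qed
  have ext2: "\<exists>y\<in>J2. x < y" if x: "x \<in> J2" for x
  proof (cases "x = 0")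
    case True
    obtain d where "d > 0" "\<And>r. 0 < r \<Longrightarrow> r \<le> d \<Longrightarrow> v2 r < 0" using initially_dec[OF s2 u20] by blast
    then have "d \<in> J2" "d > x" by (auto simp: J2_def True)
    then show ?thesis by blast
  next
    case False
    with x have x0: "x > 0" "v2 x < 0" by (auto simp: J2_def)
    have "isCont v2 x" using DERIV_isCont[OF sol_deriv_v[OF s2 x0(1)]] .
    then obtain d where d: "d > 0" "\<And>y. \<bar>y - x\<bar> < d \<Longrightarrow> \<bar>v2 y - v2 x\<bar> < - v2 x"
      using x0(2) unfolding continuous_at_eps_delta dist_real_def by (metis neg_0_less_iff_less)
    have "v2 y < 0" if "0 < y" "y \<le> x + d/2" for y
      using x d(2)[of y] that d(1) by (cases "y \<le> x") (auto simp: J2_def)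
    then have "x + d/2 \<in> J2" using x d(1) by (auto simp: J2_def)
    then show ?thesis using d(1) by force
  qed
  obtain \<rho>1 where \<rho>1: "\<And>x. x \<in> J1 \<Longrightarrow> \<rho>1 (u1 x) = x"
    "\<And>x. x \<in> J1 \<Longrightarrow> x > 0 \<Longrightarrow> (\<rho>1 has_real_derivative inverse (v1 x)) (at (u1 x))"
    by (rule level_inverse[OF s1, of J1]) (use neg1 ext1 in \<open>auto simp: J1_def\<close>)
  obtain \<rho>2 where \<rho>2: "\<And>x. x \<in> J2 \<Longrightarrow> \<rho>2 (u2 x) = x"
    "\<And>x. x \<in> J2 \<Longrightarrow> x > 0 \<Longrightarrow> (\<rho>2 has_real_derivative inverse (v2 x)) (at (u2 x))"
    by (rule level_inverse[OF s2, of J2]) (use ext2 in \<open>auto simp: J2_def\<close>)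
  have J1I: "r \<in> J1" if "c > 0" "r > 0" "u1 r = c" "\<And>x. 0 \<le> x \<Longrightarrow> x < r \<Longrightarrow> u1 x > c" for c r
  proof -
    have "u1 x > 0" if "0 \<le> x" "x \<le> r" for x
      using \<open>c > 0\<close> \<open>u1 r = c\<close> that \<open>\<And>x. 0 \<le> x \<Longrightarrow> x < r \<Longrightarrow> u1 x > c\<close>[of x] by (cases "x = r") auto
    then show ?thesis using \<open>r > 0\<close> by (simp add: J1_def)
  qed
  have lev1: "\<exists>x\<in>J1. x > 0 \<and> u1 x = s" if "0 < s" "s < u1 0" for s
  proof -
    obtain r where r: "r > 0" "u1 r = s" "\<And>x. 0 \<le> x \<Longrightarrow> x < r \<Longrightarrow> u1 x > s"
      using not_trapped_hits[OF s1 h(1) nt \<open>0 < s\<close> \<open>s < u1 0\<close>] by blast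
    have "r \<in> J1" by (rule J1I[OF \<open>0 < s\<close> r])
    with \<open>r > 0\<close> \<open>u1 r = s\<close> show ?thesis by blast
  qed
  obtain r\<beta> where r\<beta>: "r\<beta> > 0" "u1 r\<beta> = \<beta>" "\<And>x. 0 \<le> x \<Longrightarrow> x < r\<beta> \<Longrightarrow> u1 x > \<beta>" "\<And>x. 0 < x \<Longrightarrow> x \<le> r\<beta> \<Longrightarrow> v1 x < 0"
    using not_trapped_hits[OF s1 h(1) nt, of \<beta>] \<beta>_gt b_pos h by auto
  obtain rb where rb: "rb > 0" "u1 rb = b" "\<And>x. 0 \<le> x \<Longrightarrow> x < rb \<Longrightarrow> u1 x > b" "\<And>x. 0 < x \<Longrightarrow> x \<le> rb \<Longrightarrow> v1 x < 0"
    using not_trapped_hits[OF s1 h(1) nt, of b] \<beta>_gt b_pos h by auto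
  have r\<beta>J: "r\<beta> \<in> J1" by (rule J1I[OF _ r\<beta>(1,2,3)]) (use \<beta>_gt b_pos in auto)
  have rbJ: "rb \<in> J1" by (rule J1I[OF b_pos rb(1,2,3)])
  \<comment> \<open>Without an intersection \<open>sturm\<close> could be applied up to
    \<open>rb\<close>, where its left side vanishes and its right side is negative.\<close>
  have "\<exists>r\<in>{0..rb}. u1 r \<ge> u2 r"
  proof (rule ccontr)
    assume "\<not> ?thesis"
    then have lt: "u1 r < u2 r" if "0 \<le> r" "r \<le> rb" for r using that by force
    have "v2 rb * (u1 rb - b) < v1 rb * (u2 rb - b)"
      by (rule sturm[OF s1 s2 rb(1)]) (use lt rb(3) in auto)
    then have "0 < v1 rb * (u2 rb - b)" using rb(2) by simp
    then show False using rb(4)[of rb] lt[of rb] rb(1,2) by (simp add: zero_less_mult_iff)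
  qed
  then obtain r where r: "0 \<le> r" "r \<le> rb" "u1 r \<ge> u2 r" by auto
  obtain rI where rI: "0 < rI" "rI \<le> r" "u1 rI - u2 rI = 0" "\<And>x. 0 \<le> x \<Longrightarrow> x < rI \<Longrightarrow> u1 x - u2 x < 0"
    using first_zero[of 0 r "\<lambda>r. u1 r - u2 r"] r h(2)
      continuous_on_subset[OF continuous_on_diff[OF sol_continuous_u[OF s1] sol_continuous_u[OF s2]], of "{0..r}"] by auto
  have st: "v2 x * (u1 x - b) < v1 x * (u2 x - b)" if "0 < x" "x \<le> rI" for x
    by (rule sturm[OF s1 s2 that(1)]) (use rI rb(3) r that in force)
  \<comment> \<open>At level \<open>b\<close> both sides of the strict inequality \<open>st\<close>
    would be 0.\<close>
  have "rI \<noteq> rb" using st[of rI] rI rb(2) by auto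
  then have rIb: "rI < rb" using rI r by simp
  have uI: "u1 rI > b" using rb(3)[of rI] rI rIb by simp
  have v21: "v2 rI < v1 rI" using st[of rI] rI(1,3) uI by simp
  have v2neg: "v2 x < 0" if "0 < x" "x \<le> rI" for x
  proof -
    have "v1 x < 0" "u1 x > b" using rb(3,4)[of x] that rIb by auto
    moreover have "u2 x \<ge> u1 x" using rI(3) rI(4)[of x] that by (cases "x = rI") auto
    ultimately have "v1 x * (u2 x - b) < 0" by (simp add: mult_neg_pos)
    with st[OF that] have "v2 x * (u1 x - b) < 0" by simp
    with \<open>u1 x > b\<close> show ?thesis by (simp add: mult_less_0_iff)
  qed
  have rIJ2: "rI \<in> J2" using rI v2neg by (auto simp: J2_def)
  have rIJ1: "rI \<in> J1" using rbJ rIb rI(1) by (auto simp: J1_def)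

  \<comment> \<open>From the first intersection on, \<open>u2\<close> is steeper; if it lies above \<open>\<beta>\<close>, \<open>erbe_tang\<close> carries this down to \<open>\<beta>\<close>.\<close>
  obtain ts r where start: "ts \<in> J2" "ts > 0" "r \<in> J1" "r > 0" "u1 r = u2 ts" "u2 ts \<le> \<beta>" "ts \<le> r"
    "r * sqrt (2 * energy g u1 v1 r) < ts * sqrt (2 * energy g u2 v2 ts)"
  proof (cases "rI \<le> r\<beta>")
    case False
    have "u1 rI < \<beta>"
      using strict_dec[OF s1, of r\<beta> rI] r\<beta> rb(4) rIb False by force
    moreover have "(- v1 rI)\<^sup>2 < (- v2 rI)\<^sup>2" using v21 rb(4)[of rI] rI(1) rIb by (intro power_strict_mono) auto
    then have "energy g u1 v1 rI < energy g u2 v2 rI" using rI(3) by (simp add: energy_def)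
    ultimately show ?thesis
      using that[of rI rI] rIJ1 rIJ2 rI(1,3) by simp
  next
    case True
    obtain t\<beta> where t\<beta>: "t\<beta> > 0" "u2 t\<beta> = \<beta>" "\<And>x. 0 < x \<Longrightarrow> x \<le> t\<beta> \<Longrightarrow> v2 x < 0"
      using reach[OF s2 \<beta>_gt] h by auto
    define \<tau> where "\<tau> = (\<lambda>r. \<rho>2 (u1 r))"
    have \<tau>: "0 < \<tau> r \<and> \<tau> r \<le> t\<beta> \<and> u2 (\<tau> r) = u1 r" if "0 \<le> r" "r \<le> r\<beta>" for r
    proof -
      have ge: "u1 r \<ge> \<beta>" using r\<beta>(2,3) that by (cases "r = r\<beta>") force+
      have le: "u1 r < u2 0" using sol_le_initial[OF s1 _ that(1)] h \<beta>_gt by simp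
      have "\<exists>x\<ge>0. x \<le> t\<beta> \<and> u2 x = u1 r"
        by (rule IVT2') (use ge le t\<beta> in \<open>auto intro: continuous_on_subset[OF sol_continuous_u[OF s2]]\<close>)
      then obtain x where x: "0 \<le> x" "x \<le> t\<beta>" "u2 x = u1 r" by blast
      then have "x \<in> J2" using t\<beta>(3) by (auto simp: J2_def)
      then have "\<tau> r = x" unfolding \<tau>_def x(3)[symmetric] by (rule \<rho>2(1))
      moreover have "x \<noteq> 0" using x(3) le by auto
      ultimately show ?thesis using x by auto
    qed
    have \<tau>J: "\<tau> r \<in> J2" if "0 \<le> r" "r \<le> r\<beta>" for r using \<tau>[OF that] t\<beta>(3) by (auto simp: J2_def)
    have \<rho>d: "(\<rho>2 has_real_derivative inverse (v2 (\<tau> r))) (at (u1 r))" if "0 \<le> r" "r \<le> r\<beta>" for r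
      using \<rho>2(2)[OF \<tau>J[OF that]] \<tau>[OF that] by simp
    have \<tau>d: "(\<tau> has_real_derivative v1 r / v2 (\<tau> r)) (at r)" if "0 < r" "r \<le> r\<beta>" for r
      using DERIV_chain2[OF \<rho>d sol_deriv_u[OF s1 that(1)], of] that
      unfolding \<tau>_def by (simp add: divide_inverse mult.commute)
    have \<tau>c: "continuous_on {0..r\<beta>} \<tau>"
      unfolding \<tau>_def
    proof (rule continuous_on_compose2[of "u1 ` {0..r\<beta>}" \<rho>2])
      show "continuous_on (u1 ` {0..r\<beta>}) \<rho>2"
        by (rule continuous_at_imp_continuous_on) (use \<rho>d DERIV_isCont in fastforce)
    qed (auto intro: continuous_on_subset[OF sol_continuous_u[OF s1]])
    have n2: "v2 x < 0" if "0 \<le> r" "r \<le> r\<beta>" "0 < x" "x \<le> \<tau> r" for r x using \<tau>[OF that(1,2)] that(3,4) t\<beta>(3) by auto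
    note ET = erbe_tang[OF s1 s2 r\<beta>(1) r\<beta>(4) _ _ n2 \<tau>d \<tau>c]
    have lt: "v2 (\<tau> r) < v1 r" if "0 \<le> r" "r \<le> r\<beta>" for r
      by (rule ET(1)) (use \<tau> r\<beta> that in auto)
    have ET2: "r\<beta> * ((v1 r\<beta>)\<^sup>2 + 2 * prim g (u1 r\<beta>)) < (- v1 r\<beta>) * et_quot g u2 v2 (\<tau> r\<beta>)"
      by (rule ET(2)) (use \<tau> r\<beta> in auto)
    have \<tau>\<beta>: "\<tau> r\<beta> > 0" "u2 (\<tau> r\<beta>) = \<beta>" "v2 (\<tau> r\<beta>) < 0" using \<tau>[of r\<beta>] r\<beta> n2[of r\<beta> "\<tau> r\<beta>"] by auto
    have "v1 r\<beta> < 0" using r\<beta> by auto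
    \<comment> \<open>The potential vanishes at level \<beta>, so \<open>et_quot\<close> is just
      radius times speed and the inequality compares the quantities with which the argument below
      \<beta> starts.\<close>
    have "(- v1 r\<beta>) * (r\<beta> * (- v1 r\<beta>)) < (- v1 r\<beta>) * (\<tau> r\<beta> * (- v2 (\<tau> r\<beta>)))"
      using ET2 \<tau>\<beta> r\<beta>(2) prim_\<beta> by (simp add: et_quot_def power2_eq_square algebra_simps)
    then have w: "r\<beta> * (- v1 r\<beta>) < \<tau> r\<beta> * (- v2 (\<tau> r\<beta>))" using \<open>v1 r\<beta> < 0\<close> by (metis mult_less_cancel_left_pos neg_0_less_iff_less)
    have "\<tau> rI = rI" unfolding \<tau>_def using \<rho>2(1)[OF rIJ2] rI(3) by simp
    \<comment> \<open>From the intersection, where both radii coincide, the steeper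
      \<open>u2\<close> needs less radius for the same descent; this gives the condition
      \<open>ts \<le> r\<close>.\<close>
    have "rI - \<tau> rI \<le> r\<beta> - \<tau> r\<beta>"
    proof (rule DERIV_nonneg_imp_increasing_open[OF True])
      fix x assume x: "rI < x" "x < r\<beta>"
      have "((\<lambda>r. r - \<tau> r) has_real_derivative 1 - v1 x / v2 (\<tau> x)) (at x)"
        by (rule DERIV_diff[OF DERIV_ident \<tau>d]) (use x rI in auto)
      moreover have "v1 x / v2 (\<tau> x) \<le> 1" using lt[of x] n2[of x "\<tau> x"] \<tau>[of x] x rI by (simp add: divide_le_eq)
      ultimately show "\<exists>y. ((\<lambda>r. r - \<tau> r) has_real_derivative y) (at x) \<and> y \<ge> 0" by (meson diff_ge_0_iff_ge)
    qed (intro continuous_intros continuous_on_subset[OF \<tau>c], use rI in auto)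
    then have "\<tau> r\<beta> \<le> r\<beta>" using \<open>\<tau> rI = rI\<close> by simp
    moreover have "sqrt (2 * energy g u1 v1 r\<beta>) = - v1 r\<beta>" "sqrt (2 * energy g u2 v2 (\<tau> r\<beta>)) = - v2 (\<tau> r\<beta>)"
      using \<open>v1 r\<beta> < 0\<close> \<tau>\<beta> r\<beta>(2) prim_\<beta> by (simp_all add: energy_def)
    ultimately show ?thesis
      using that[of "\<tau> r\<beta>" r\<beta>] \<tau>J[of r\<beta>] r\<beta>J r\<beta>(1,2) \<tau>\<beta> w by simp
  qed

  define \<delta> where "\<delta> = ts * sqrt (2 * energy g u2 v2 ts) - r * sqrt (2 * energy g u1 v1 r)"
  have \<delta>: "\<delta> > 0" using start by (simp add: \<delta>_def)
  have slope: "t * (- v2 t) \<ge> \<delta>" if t: "t \<in> J2" "ts \<le> t" for t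
  proof -
    define \<sigma> where "\<sigma> = (\<lambda>t. \<rho>1 (u2 t))"
    have \<sigma>ts: "\<sigma> ts = r" unfolding \<sigma>_def start(5)[symmetric] by (rule \<rho>1(1)[OF start(3)])
    have in2: "x \<in> J2 \<and> x > 0 \<and> v2 x < 0" if "ts \<le> x" "x \<le> t" for x
      using t(1) start(2) that by (auto simp: J2_def)
    \<comment> \<open>Strict positivity comes from \<open>J2\<close> having no last point:
      \<open>u2\<close> still decreases strictly beyond \<open>x\<close>, to a value that is
      nonnegative.\<close>
    have u2: "0 < u2 x \<and> u2 x \<le> \<beta> \<and> v2 x < 0" if x: "ts \<le> x" "x \<le> t" for x
    proof -
      obtain y where y: "y \<in> J2" "x < y" using ext2 in2[OF x] by blast
      have "u2 y < u2 x" by (rule strict_dec[OF s2]) (use y in2[OF x] in \<open>auto simp: J2_def\<close>)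
      moreover have "u2 y \<ge> 0" using nn y by (auto simp: J2_def)
      moreover have "u2 x \<le> u2 ts"
        using strict_dec[OF s2, of ts x] start(2) x in2 by (cases "x = ts") (force intro: less_imp_le)+
      ultimately show ?thesis using start(6) in2[OF x] by simp
    qed
    have \<sigma>: "\<sigma> x \<in> J1 \<and> \<sigma> x > 0 \<and> u1 (\<sigma> x) = u2 x" if x: "ts \<le> x" "x \<le> t" for x
    proof -
      obtain y where "y \<in> J1" "y > 0" "u1 y = u2 x" using lev1[of "u2 x"] u2[OF x] h by auto
      then show ?thesis unfolding \<sigma>_def using \<rho>1(1)[of y] by simp
    qed
    have \<sigma>d: "(\<sigma> has_real_derivative v2 x / v1 (\<sigma> x)) (at x)" if x: "ts \<le> x" "x \<le> t" for x
    proof -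
      have "(\<rho>1 has_real_derivative inverse (v1 (\<sigma> x))) (at (u2 x))" using \<rho>1(2)[of "\<sigma> x"] \<sigma>[OF x] by simp
      from DERIV_chain2[OF this sol_deriv_u[OF s2, of x]] in2[OF x]
      show ?thesis unfolding \<sigma>_def by (simp add: divide_inverse mult.commute)
    qed
    have "t * (- v2 t) \<ge> ts * sqrt (2 * energy g u2 v2 ts) - \<sigma> ts * sqrt (2 * energy g u1 v1 (\<sigma> ts))"
      by (rule peletier_serrin[OF s1 s2 start(2) t(2) _ u2 \<sigma>d]) (use \<sigma> neg1 \<sigma>ts start(7,8) in auto)
    then show ?thesis by (simp add: \<delta>_def \<sigma>ts)
  qed
  show False
  proof (cases "\<exists>x>0. v2 x \<ge> 0")
    case False
    then have "t \<in> J2" if "t \<ge> 0" for t using that by (force simp: J2_def)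
    then show False using log_escape[OF s2 start(2) \<delta>] slope nn start(2) by force
  next
    case True
    then obtain x where "x > 0" "v2 x \<ge> 0" by blast
    then obtain R where R: "0 < R" "v2 R = 0" "\<And>x. 0 < x \<Longrightarrow> x < R \<Longrightarrow> v2 x < 0"
      using first_turning[OF s2 u20] by metis
    have tsR: "ts < R"
    proof (rule ccontr)
      assume "\<not> ts < R"
      then have "v2 R < 0" using start(1) R(1) by (simp add: J2_def)
      with R(2) show False by simp
    qed
    \<comment> \<open>The bound holds only before the turning point \<open>R\<close>; it is carried
      to \<open>R\<close> as a limit from the left, where the slope is 0.\<close>
    have "R * (- v2 R) \<ge> \<delta>"
    proof (rule tendsto_lowerbound)
      have "isCont (\<lambda>t. t * (- v2 t)) R"
        using DERIV_isCont[OF sol_deriv_v[OF s2 R(1)]] by (intro continuous_intros)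
      then show "((\<lambda>t. t * (- v2 t)) \<longlongrightarrow> R * (- v2 R)) (at_left R)"
        unfolding isCont_def by (rule filterlim_mono) (auto simp: at_le)
      have "\<forall>\<^sub>F t in at_left R. t \<in> {ts<..<R}" by (rule eventually_at_left_real[OF tsR])
      then show "\<forall>\<^sub>F t in at_left R. \<delta> \<le> t * (- v2 t)"
        by eventually_elim (use slope R start(2) in \<open>auto simp: J2_def\<close>)
    qed simp
    with R(2) \<delta> show False by simp
  qed
qed

end

section \<open>Compactness and shooting\<close>

definition loc_unif :: "(nat \<Rightarrow> real \<Rightarrow> real) \<Rightarrow> (real \<Rightarrow> real) \<Rightarrow> bool" where
  "loc_unif w f \<longleftrightarrow> (\<forall>T. \<forall>e>0. \<exists>k0. \<forall>k\<ge>k0. \<forall>x\<in>{0..T}. \<bar>w k x - f x\<bar> < e)"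

lemma loc_unif_pointwise:
  assumes "loc_unif w f" "x \<ge> 0"
  shows "(\<lambda>k. w k x) \<longlonglongrightarrow> f x"
  unfolding LIMSEQ_iff real_norm_def using assms unfolding loc_unif_def
  by (metis atLeastAtMost_iff order_refl)

lemma loc_unif_positive:
  assumes conv: "loc_unif w f"
    and f: "continuous_on {0..T} f" "\<And>x. x \<in> {0..T} \<Longrightarrow> f x > 0" and T: "T \<ge> 0"
  obtains k0 :: nat where "\<And>k x. k \<ge> k0 \<Longrightarrow> x \<in> {0..T} \<Longrightarrow> w k x > 0"
proof -
  obtain x0 where x0: "x0 \<in> {0..T}" "\<And>x. x \<in> {0..T} \<Longrightarrow> f x0 \<le> f x"
    using continuous_attains_inf[of "{0..T}" f] f(1) T by auto
  obtain k0 where k0: "\<forall>k\<ge>k0. \<forall>x\<in>{0..T}. \<bar>w k x - f x\<bar> < f x0"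
    using conv f(2)[OF x0(1)] unfolding loc_unif_def by blast
  have "w k x > 0" if "k \<ge> k0" "x \<in> {0..T}" for k x
    using k0 x0(2)[OF that(2)] that by (smt (verit))
  then show ?thesis using that by blast
qed

text \<open>Arzela-Ascoli on \<open>{0..real i}\<close> for every \<open>i\<close>, followed by a
  diagonal extraction; the pointwise limit glues the limits \<open>h i\<close> together.\<close>

lemma locally_uniform_subsequence:
  fixes w :: "nat \<Rightarrow> real \<Rightarrow> real"
  assumes lip: "\<And>T. \<exists>L. \<forall>k. \<forall>x\<in>{0..T}. \<forall>y\<in>{0..T}. \<bar>w k x - w k y\<bar> \<le> L * \<bar>x - y\<bar>"
    and bd: "\<And>k. \<bar>w k 0\<bar> \<le> B"
  obtains \<phi> :: "nat \<Rightarrow> nat" and f where "strict_mono \<phi>" "\<And>T. continuous_on {0..T} f" "loc_unif (\<lambda>k. w (\<phi> k)) f"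
proof -
  define P where "P = (\<lambda>(i::nat) (r::nat \<Rightarrow> nat). \<exists>h. continuous_on {0..real i} h \<and>
     (\<forall>e>0. \<exists>n0. \<forall>n\<ge>n0. \<forall>x\<in>{0..real i}. \<bar>w (r n) x - h x\<bar> < e))"
  have "\<exists>k. strict_mono (k::nat \<Rightarrow> nat) \<and> P i (r \<circ> k)" for i r
  proof -
    obtain L where L: "\<And>k x y. x\<in>{0..real i} \<Longrightarrow> y\<in>{0..real i} \<Longrightarrow> \<bar>w k x - w k y\<bar> \<le> L * \<bar>x - y\<bar>"
      using lip[of "real i"] by blast
    define L' where "L' = \<bar>L\<bar> + 1"
    have L': "\<bar>w k x - w k y\<bar> \<le> L' * \<bar>x - y\<bar>" if "x\<in>{0..real i}" "y\<in>{0..real i}" for k x y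
    proof -
      have "L * \<bar>x - y\<bar> \<le> L' * \<bar>x - y\<bar>" by (rule mult_right_mono) (auto simp: L'_def)
      with L[OF that, of k] show ?thesis by linarith
    qed
    have L0: "L' > 0" by (simp add: L'_def)
    obtain h k where hk: "continuous_on {0..real i} h" "strict_mono (k::nat \<Rightarrow> nat)"
      "\<And>e. 0 < e \<Longrightarrow> \<exists>n0. \<forall>n x. n \<ge> n0 \<and> x \<in> {0..real i} \<longrightarrow> norm (w (r (k n)) x - h x) < e"
    proof (rule Arzela_Ascoli[of "{0..real i}" "\<lambda>n. w (r n)" "B + L' * real i"])
      show "norm (w (r n) x) \<le> B + L' * real i" if "x \<in> {0..real i}" for n x
      proof -
        have "L' * \<bar>x - 0\<bar> \<le> L' * real i" using that L0 by (intro mult_left_mono) auto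
        moreover have "\<bar>w (r n) x - w (r n) 0\<bar> \<le> L' * \<bar>x - 0\<bar>" by (rule L'[OF that]) (use that in auto)
        ultimately show ?thesis using bd[of "r n"] by simp
      qed
      show "\<exists>d>0. \<forall>n y. y \<in> {0..real i} \<and> norm (x - y) < d \<longrightarrow> norm (w (r n) x - w (r n) y) < e"
        if "x \<in> {0..real i}" "0 < e" for x e
      proof (intro exI[of _ "e / L'"] conjI allI impI)
        fix n y assume y: "y \<in> {0..real i} \<and> norm (x - y) < e / L'"
        then have "L' * \<bar>x - y\<bar> < e" using L0 by (simp add: field_simps)
        with L'[OF that(1), of y "r n"] y show "norm (w (r n) x - w (r n) y) < e" by simp
      qed (use L0 that in simp)
    qed auto
    have "\<exists>n0. \<forall>n\<ge>n0. \<forall>x\<in>{0..real i}. \<bar>w ((r \<circ> k) n) x - h x\<bar> < e" if "e > 0" for e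
      using hk(3)[OF that] unfolding real_norm_def comp_def by blast
    then have "P i (r \<circ> k)" unfolding P_def using hk(1) by blast
    with hk(2) show ?thesis by blast
  qed
  \<comment> \<open>The diagonal sequence is a subsequence of the \<open>i\<close>-th one only from
    some index on, and \<open>P\<close> has to survive exactly that.\<close>
  moreover have "P i (r \<circ> k2)" if P1: "P i (r \<circ> k1)" and sub: "\<And>j. n \<le> j \<Longrightarrow> \<exists>j'. j \<le> j' \<and> k2 j = k1 j'" for i and r k1 k2 :: "nat \<Rightarrow> nat" and n
  proof -
    obtain h where h: "continuous_on {0..real i} h"
      "\<And>e. e>0 \<Longrightarrow> \<exists>n0. \<forall>n\<ge>n0. \<forall>x\<in>{0..real i}. \<bar>w ((r \<circ> k1) n) x - h x\<bar> < e" using P1 unfolding P_def by blast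
    have "\<exists>n0. \<forall>n\<ge>n0. \<forall>x\<in>{0..real i}. \<bar>w ((r \<circ> k2) n) x - h x\<bar> < e" if e: "e > 0" for e
    proof -
      obtain n0 where n0: "\<And>m x. m \<ge> n0 \<Longrightarrow> x\<in>{0..real i} \<Longrightarrow> \<bar>w ((r \<circ> k1) m) x - h x\<bar> < e" using h(2)[OF e] by blast
      have "\<bar>w ((r \<circ> k2) m) x - h x\<bar> < e" if m: "m \<ge> max n n0" "x\<in>{0..real i}" for m x
      proof -
        obtain j' where "m \<le> j'" "k2 m = k1 j'" using sub[of m] m by auto
        then show ?thesis using n0[of j' x] m by simp
      qed
      then show ?thesis by blast
    qed
    with h(1) show ?thesis unfolding P_def by blast
  qed
  ultimately obtain \<phi> where \<phi>: "strict_mono \<phi>" "\<And>i. P i (id \<circ> \<phi>)"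
    using subsequence_diagonalization_lemma[of P id] by metis
  have "\<exists>h. continuous_on {0..real i} h \<and>
     (\<forall>e>0. \<exists>n0. \<forall>n\<ge>n0. \<forall>x\<in>{0..real i}. \<bar>w (\<phi> n) x - h x\<bar> < e)" for i
    using \<phi>(2)[of i] by (simp add: P_def)
  then obtain h where h: "\<And>i. continuous_on {0..real i} (h i)"
     "\<And>i e. e>0 \<Longrightarrow> \<exists>n0. \<forall>n\<ge>n0. \<forall>x\<in>{0..real i}. \<bar>w (\<phi> n) x - h i x\<bar> < e" by metis
  define f where "f = (\<lambda>x. lim (\<lambda>n. w (\<phi> n) x))"
  have f: "f x = h i x" if "x \<in> {0..real i}" for x i
  proof -
    have "(\<lambda>n. w (\<phi> n) x) \<longlonglongrightarrow> h i x"
      unfolding LIMSEQ_iff real_norm_def using h(2) that by meson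
    then show ?thesis unfolding f_def by (rule limI)
  qed
  have "continuous_on {0..T} f" for T
  proof -
    obtain i where "T \<le> real i" using real_arch_simple by blast
    then have "continuous_on {0..T} (h i)" by (intro continuous_on_subset[OF h(1)[of i]]) auto
    then show ?thesis by (rule continuous_on_eq) (rule f[symmetric], use \<open>T \<le> real i\<close> in auto)
  qed
  moreover have "\<exists>k0. \<forall>k\<ge>k0. \<forall>x\<in>{0..T}. \<bar>w (\<phi> k) x - f x\<bar> < e" if e: "e > 0" for T e
  proof -
    obtain i where i: "T \<le> real i" using real_arch_simple by blast
    obtain n0 where "\<forall>n\<ge>n0. \<forall>x\<in>{0..real i}. \<bar>w (\<phi> n) x - h i x\<bar> < e" using h(2)[OF e] by blast
    then show ?thesis using f[of _ i] i by (intro exI[of _ n0]) auto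
  qed
  ultimately show ?thesis using that[of \<phi> f] \<phi>(1) by (simp add: loc_unif_def)
qed

section \<open>The integrated equation and limits of approximate solutions\<close>

text \<open>With \<open>y t = g (u t)\<close> for a solution \<open>u\<close> this is
  \<open>- r ^ (N-1) * v r\<close>, see \<open>sol_mass_int\<close>.\<close>

definition mass_int :: "nat \<Rightarrow> (real \<Rightarrow> real) \<Rightarrow> real \<Rightarrow> real" where
  "mass_int N y r = integral {0..r} (\<lambda>t. t ^ (N-1) * y t)"

lemma mass_int_deriv:
  assumes "\<And>T. continuous_on {0..T} y" "r > 0"
  shows "(mass_int N y has_real_derivative r ^ (N-1) * y r) (at r)"
proof -
  have "((\<lambda>r. integral {0..r} (\<lambda>t. t ^ (N-1) * y t)) has_real_derivative r ^ (N-1) * y r) (at r within {0..r+1})"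
    by (rule integral_has_real_derivative) (use assms in \<open>auto intro!: continuous_intros\<close>)
  moreover have "r \<in> interior {0..r+1}" using assms(2) by simp
  ultimately show ?thesis unfolding mass_int_def[abs_def] by (simp only: at_within_interior)
qed

lemma mass_int_bound:
  assumes "continuous_on {0..r} y" "r \<ge> 0" "\<And>t. t \<in> {0..r} \<Longrightarrow> \<bar>y t\<bar> \<le> K"
  shows "\<bar>mass_int N y r\<bar> \<le> K * r ^ (N-1) * r"
proof -
  have K: "K \<ge> 0" using assms(3)[of 0] assms(2) by simp
  have "norm (integral {0..r} (\<lambda>t. t ^ (N-1) * y t)) \<le> K * r ^ (N-1) * (r - 0)"
  proof (rule integral_bound)
    show "norm (t ^ (N-1) * y t) \<le> K * r ^ (N-1)" if "t \<in> {0..r}" for t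
      using mult_mono[OF power_mono[of t r "N-1"] assms(3)[OF that]] that K by (simp add: abs_mult mult.commute)
  qed (use assms in \<open>auto intro!: continuous_intros\<close>)
  then show ?thesis by (simp add: mass_int_def)
qed

lemma mass_int_diff:
  assumes "continuous_on {0..r} y" "continuous_on {0..r} y'"
  shows "mass_int N y r - mass_int N y' r = mass_int N (\<lambda>t. y t - y' t) r"
  unfolding mass_int_def
  by (subst Henstock_Kurzweil_Integration.integral_diff[symmetric])
     (use assms in \<open>auto intro!: integrable_continuous_interval continuous_intros simp: algebra_simps\<close>)

lemma sol_mass_int:
  assumes s: "sol N g u v" and g: "continuous_on UNIV g" and N: "N > 2" and r: "r \<ge> 0"
  shows "r ^ (N-1) * v r = - mass_int N (\<lambda>t. g (u t)) r"
proof -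
  have "((\<lambda>t. - (t ^ (N-1) * g (u t))) has_integral (r ^ (N-1) * v r - 0 ^ (N-1) * v 0)) {0..r}"
  proof (rule fundamental_theorem_of_calculus_interior[OF r])
    show "continuous_on {0..r} (\<lambda>r. r ^ (N-1) * v r)" by (rule continuous_on_subset[OF sol_mass_continuous[OF s g N]]) simp
    show "((\<lambda>r. r ^ (N-1) * v r) has_vector_derivative - (x ^ (N-1) * g (u x))) (at x)" if "x \<in> {0<..<r}" for x
      using sol_mass_deriv[OF s _ N, of x] that by (simp add: has_real_derivative_iff_has_vector_derivative)
  qed
  then have "integral {0..r} (\<lambda>t. - (t ^ (N-1) * g (u t))) = r ^ (N-1) * v r"
    by (rule integral_unique[THEN trans]) (simp add: sol_v0[OF s])
  then show ?thesis by (simp add: mass_int_def)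
qed

text \<open>Limits are first known to satisfy only this first-order equation; it already contains
  the second-order one. At the origin the bound \<open>M * r\<close> for the slope and the mean
  value theorem give derivative 0.\<close>

lemma mass_int_sol:
  assumes N: "N > 2" and g: "continuous_on UNIV g" and M: "\<And>s. \<bar>g s\<bar> \<le> M"
    and w: "\<And>T. continuous_on {0..T} w"
    and d: "\<And>r. r > 0 \<Longrightarrow> (w has_real_derivative - mass_int N (\<lambda>t. g (w t)) r / r ^ (N-1)) (at r)"
  shows "sol N g w (\<lambda>r. - mass_int N (\<lambda>t. g (w t)) r / r ^ (N-1))"
proof -
  define v where "v = (\<lambda>r. - mass_int N (\<lambda>t. g (w t)) r / r ^ (N-1))"
  have cg: "continuous_on {0..T} (\<lambda>t. g (w t))" for T
    by (rule continuous_on_compose2[OF g w]) simp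
  have vb: "\<bar>v r\<bar> \<le> M * r" if "r \<ge> 0" for r
  proof (cases "r = 0")
    case False
    with that have "r ^ (N-1) > 0" by simp
    moreover have "\<bar>mass_int N (\<lambda>t. g (w t)) r\<bar> \<le> M * r ^ (N-1) * r" by (rule mass_int_bound[OF cg that]) (rule M)
    ultimately show ?thesis unfolding v_def by (simp add: abs_divide divide_le_eq algebra_simps)
  qed (simp add: v_def mass_int_def)
  have M0: "M \<ge> 0" using M[of 0] by linarith
  have "(w has_real_derivative v r) (at r within {0..})" if "r \<ge> 0" for r
  proof (cases "r = 0")
    case False
    with that show ?thesis using d[of r] by (auto simp: v_def intro: has_field_derivative_at_within)
  next
    case True
    have "\<bar>(w x - w 0) / (x - 0)\<bar> \<le> M * x" if x: "x > 0" for x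
    proof -
      have "\<exists>l z. 0 < z \<and> z < x \<and> (w has_real_derivative l) (at z) \<and> w x - w 0 = (x - 0) * l"
        by (rule MVT) (use x w d in \<open>auto simp: real_differentiable_def\<close>)
      then obtain l z where z: "0 < z" "z < x" "(w has_real_derivative l) (at z)" "w x - w 0 = (x - 0) * l" by auto
      have "l = v z" using DERIV_unique[OF z(3) d[OF z(1)]] by (simp add: v_def)
      then have "\<bar>l\<bar> \<le> M * z" using vb[of z] z by simp
      also have "\<dots> \<le> M * x" using z M0 by (intro mult_left_mono) auto
      finally show ?thesis using z x by simp
    qed
    then have ev: "\<forall>\<^sub>F x in at 0 within {0..}. norm ((w x - w 0) / (x - 0)) \<le> M * x"
      by (auto simp: eventually_at_filter intro!: always_eventually)
    have "((\<lambda>x. M * x) \<longlongrightarrow> 0) (at 0 within {0..})" by (auto intro!: tendsto_eq_intros)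
    with ev have "((\<lambda>x. (w x - w 0) / (x - 0)) \<longlongrightarrow> 0) (at 0 within {0..})"
      by (rule Lim_null_comparison)
    then show ?thesis by (simp add: has_field_derivative_iff True v_def mass_int_def)
  qed
  moreover have "(v has_real_derivative (- (real N - 1) / r * v r - g (w r))) (at r)" if r: "r > 0" for r
  proof -
    obtain m where m: "N = Suc (Suc m)" using N by (metis Suc_1 less_imp_Suc_add plus_1_eq_Suc add_Suc)
    have "(v has_real_derivative
      ((- (r ^ (N-1) * g (w r))) * r ^ (N-1) - (- mass_int N (\<lambda>t. g (w t)) r) * (real (N-1) * r ^ (N-1-1))) / (r ^ (N-1) * r ^ (N-1))) (at r)"
      unfolding v_def
      by (intro DERIV_divide DERIV_minus mass_int_deriv cg r DERIV_pow[of "N-1" r, simplified] ) (use r DERIV_pow[of "N-1" r] in auto)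
    moreover have "((- (r ^ (N-1) * g (w r))) * r ^ (N-1) - (- mass_int N (\<lambda>t. g (w t)) r) * (real (N-1) * r ^ (N-1-1))) / (r ^ (N-1) * r ^ (N-1))
      = - (real N - 1) / r * v r - g (w r)"
      using r by (simp add: v_def m field_simps)
    ultimately show ?thesis by simp
  qed
  moreover have "v 0 = 0" by (simp add: v_def mass_int_def)
  ultimately show ?thesis unfolding v_def[symmetric] sol_def by blast
qed

text \<open>The integrated equation may be violated by an error that tends to 0 uniformly on each
  \<open>{a..T}\<close> with \<open>a > 0\<close>. Nothing is asked of \<open>z\<close> near the
  origin, so an initial layer shrinking to 0 is harmless. As \<open>g\<close> is merely continuous,
  the limit is some solution, not a predetermined one.\<close>

theorem approximate_solutions_compact:
  fixes w z :: "nat \<Rightarrow> real \<Rightarrow> real"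
  assumes N: "N > 2" and g: "continuous_on UNIV g" and M: "\<And>s. \<bar>g s\<bar> \<le> M"
    and lip: "\<And>T. \<exists>L. \<forall>k. \<forall>x\<in>{0..T}. \<forall>y\<in>{0..T}. \<bar>w k x - w k y\<bar> \<le> L * \<bar>x - y\<bar>"
    and bd: "\<And>k. \<bar>w k 0\<bar> \<le> B"
    and err: "\<And>a T e. 0 < a \<Longrightarrow> 0 < e \<Longrightarrow> \<exists>k0. \<forall>k\<ge>k0. \<forall>r\<in>{a..T}. (w k has_real_derivative z k r) (at r) \<and>
       \<bar>r ^ (N-1) * z k r + mass_int N (\<lambda>t. g (w k t)) r\<bar> \<le> e"
  obtains \<phi> :: "nat \<Rightarrow> nat" and f v where "strict_mono \<phi>" "sol N g f v"
    "loc_unif (\<lambda>k. w (\<phi> k)) f" "\<And>r. r > 0 \<Longrightarrow> (\<lambda>k. z (\<phi> k) r) \<longlonglongrightarrow> v r"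
proof -
  obtain \<phi> f where \<phi>: "strict_mono \<phi>" and fc: "\<And>T. continuous_on {0..T} f"
    and lu: "loc_unif (\<lambda>k. w (\<phi> k)) f"
    using locally_uniform_subsequence[of w B, OF lip bd] by metis
  have conv: "\<exists>k0. \<forall>k\<ge>k0. \<forall>x\<in>{0..T}. \<bar>w (\<phi> k) x - f x\<bar> < e" if "e > 0" for T e
    using lu that by (simp add: loc_unif_def)
  define v where "v = (\<lambda>r. - mass_int N (\<lambda>t. g (f t)) r / r ^ (N-1))"
  have wc: "continuous_on {0..T} (w k)" for k T
  proof -
    obtain L where "\<And>x y. x\<in>{0..T} \<Longrightarrow> y\<in>{0..T} \<Longrightarrow> \<bar>w k x - w k y\<bar> \<le> L * \<bar>x - y\<bar>" using lip[of T] by blast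
    then have "\<bar>w k x - w k y\<bar> \<le> \<bar>L\<bar> * \<bar>x - y\<bar>" if "x\<in>{0..T}" "y\<in>{0..T}" for x y
      using that by (meson abs_ge_self abs_ge_zero mult_right_mono order_trans)
    then have "\<bar>L\<bar>-lipschitz_on {0..T} (w k)" by (intro lipschitz_onI) (auto simp: dist_real_def)
    then show ?thesis by (rule lipschitz_on_continuous_on)
  qed
  have gc: "continuous_on {0..T} (\<lambda>t. g (w k t))" "continuous_on {0..T} (\<lambda>t. g (f t))" for k T
    using continuous_on_compose2[OF g wc] continuous_on_compose2[OF g fc] by auto
  have gconv: "\<exists>k0. \<forall>k\<ge>k0. \<forall>x\<in>{0..T}. \<bar>g (w (\<phi> k) x) - g (f x)\<bar> < e" if e: "e > 0" for T e
  proof -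
    have "compact (f ` {0..T})" by (rule compact_continuous_image[OF fc]) simp
    then obtain C where "\<forall>x\<in>f ` {0..T}. \<bar>x\<bar> \<le> C" using compact_imp_bounded bounded_iff by (metis real_norm_def)
    then have C: "\<bar>f x\<bar> \<le> C" if "x \<in> {0..T}" for x using that by blast
    have "uniformly_continuous_on {-C-1..C+1} g"
      by (rule compact_uniformly_continuous) (auto intro: continuous_on_subset[OF g])
    then obtain d where d: "d > 0" "\<And>x y. x \<in> {-C-1..C+1} \<Longrightarrow> y \<in> {-C-1..C+1} \<Longrightarrow> \<bar>y - x\<bar> < d \<Longrightarrow> \<bar>g y - g x\<bar> < e"
      unfolding uniformly_continuous_on_def dist_real_def using e by metis
    obtain k0 where k0: "\<forall>k\<ge>k0. \<forall>x\<in>{0..T}. \<bar>w (\<phi> k) x - f x\<bar> < min d 1" using conv[of "min d 1" T] d(1) by auto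
    have "\<bar>g (w (\<phi> k) x) - g (f x)\<bar> < e" if "k \<ge> k0" "x \<in> {0..T}" for k x
    proof (rule d(2))
      have "\<bar>w (\<phi> k) x - f x\<bar> < min d 1" using k0 that by blast
      then show "f x \<in> {- C - 1..C + 1}" "w (\<phi> k) x \<in> {- C - 1..C + 1}" "\<bar>w (\<phi> k) x - f x\<bar> < d"
        using C[OF that(2)] by (auto simp: abs_if split: if_splits)
    qed
    then show ?thesis by blast
  qed
  have mconv: "\<exists>k0. \<forall>k\<ge>k0. \<forall>r\<in>{0..T}. \<bar>mass_int N (\<lambda>t. g (w (\<phi> k) t)) r - mass_int N (\<lambda>t. g (f t)) r\<bar> \<le> e" if e: "e > 0" for T e
  proof -
    define e' where "e' = e / ((\<bar>T\<bar> + 1) ^ (N-1) * (\<bar>T\<bar> + 1))"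
    have e': "e' > 0" "e' * (\<bar>T\<bar> + 1) ^ (N-1) * (\<bar>T\<bar> + 1) = e" using e by (auto simp: e'_def add_pos_nonneg)
    obtain k0 where k0: "\<And>k x. k\<ge>k0 \<Longrightarrow> x\<in>{0..T} \<Longrightarrow> \<bar>g (w (\<phi> k) x) - g (f x)\<bar> < e'" using gconv[OF e'(1)] by blast
    have "\<bar>mass_int N (\<lambda>t. g (w (\<phi> k) t)) r - mass_int N (\<lambda>t. g (f t)) r\<bar> \<le> e" if "k \<ge> k0" "r \<in> {0..T}" for k r
    proof -
      have "\<bar>mass_int N (\<lambda>t. g (w (\<phi> k) t) - g (f t)) r\<bar> \<le> e' * r ^ (N-1) * r"
        by (rule mass_int_bound) (use that k0[OF that(1)] in \<open>auto intro!: continuous_intros gc less_imp_le\<close>)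
      also have "\<dots> \<le> e' * (\<bar>T\<bar> + 1) ^ (N-1) * (\<bar>T\<bar> + 1)"
        using that e' by (intro mult_mono power_mono) auto
      finally show ?thesis using mass_int_diff[OF gc] e'(2) by simp
    qed
    then show ?thesis by blast
  qed
  have zconv: "\<exists>k0. \<forall>k\<ge>k0. \<forall>r\<in>{a..T}. (w (\<phi> k) has_real_derivative z (\<phi> k) r) (at r) \<and> \<bar>z (\<phi> k) r - v r\<bar> \<le> e"
    if a: "a > 0" and e: "e > 0" for a T e
  proof -
    define e' where "e' = e * a ^ (N-1) / 2"
    have e': "e' > 0" using a e by (simp add: e'_def)
    obtain k1 where k1: "\<And>k r. k \<ge> k1 \<Longrightarrow> r\<in>{a..T} \<Longrightarrow> (w k has_real_derivative z k r) (at r) \<and>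
       \<bar>r ^ (N-1) * z k r + mass_int N (\<lambda>t. g (w k t)) r\<bar> \<le> e'" using err[OF a e'] by blast
    obtain k2 where k2: "\<And>k r. k \<ge> k2 \<Longrightarrow> r\<in>{0..T} \<Longrightarrow> \<bar>mass_int N (\<lambda>t. g (w (\<phi> k) t)) r - mass_int N (\<lambda>t. g (f t)) r\<bar> \<le> e'"
      using mconv[OF e'] by blast
    have "(w (\<phi> k) has_real_derivative z (\<phi> k) r) (at r) \<and> \<bar>z (\<phi> k) r - v r\<bar> \<le> e" if k: "k \<ge> max k1 k2" and r: "r \<in> {a..T}" for k r
    proof
      have "\<phi> k \<ge> k1" using seq_suble[OF \<phi>, of k] k by simp
      note k1 = k1[OF this r]
      then show "(w (\<phi> k) has_real_derivative z (\<phi> k) r) (at r)" by blast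
      have r0: "r > 0" using a r by simp
      then have rp: "r ^ (N-1) > 0" by simp
      have vr: "r ^ (N-1) * v r = - mass_int N (\<lambda>t. g (f t)) r" using r0 by (simp add: v_def)
      have "\<bar>r ^ (N-1) * z (\<phi> k) r - r ^ (N-1) * v r\<bar> \<le> 2 * e'"
        unfolding vr using k1 k2[of k r] k r r0 by (auto simp: abs_le_iff)
      then have "r ^ (N-1) * \<bar>z (\<phi> k) r - v r\<bar> \<le> e * a ^ (N-1)"
        using rp by (simp add: e'_def abs_mult flip: right_diff_distrib)
      also have "\<dots> \<le> r ^ (N-1) * e" using power_mono[of a r "N-1"] a r e by (simp add: mult.commute mult_left_mono)
      finally show "\<bar>z (\<phi> k) r - v r\<bar> \<le> e" using rp by simp
    qed
    then show ?thesis by blast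
  qed
  have fd: "(f has_real_derivative v r) (at r)" if r: "r > 0" for r
  proof -
    \<comment> \<open>The derivatives converge uniformly only away from the origin; this interval
      stays away from it and has \<open>r\<close> in its interior.\<close>
    let ?S = "{r/2..r+1}"
    obtain k0 where k0: "\<And>k x. k \<ge> k0 \<Longrightarrow> x\<in>?S \<Longrightarrow> (w (\<phi> k) has_real_derivative z (\<phi> k) x) (at x)"
      using zconv[of "r/2" 1 "r+1"] r by (metis half_gt_zero zero_less_one)
    have "\<exists>h. \<forall>x\<in>?S. (\<lambda>n. w (\<phi> (n + k0)) x) \<longlonglongrightarrow> h x \<and> (h has_derivative (\<lambda>d. v x * d)) (at x within ?S)"
    proof (rule has_derivative_sequence)
      show "(w (\<phi> (n + k0)) has_derivative (\<lambda>d. z (\<phi> (n + k0)) x * d)) (at x within ?S)" if "x \<in> ?S" for n x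
        using k0[OF _ that, of "n + k0"] by (simp add: has_field_derivative_def has_derivative_at_withinI)
      show "\<forall>\<^sub>F n in sequentially. \<forall>x\<in>?S. \<forall>h. norm (z (\<phi> (n + k0)) x * h - v x * h) \<le> e * norm h" if e: "e > 0" for e
      proof -
        obtain k1 where k1: "\<And>k x. k \<ge> k1 \<Longrightarrow> x\<in>?S \<Longrightarrow> \<bar>z (\<phi> k) x - v x\<bar> \<le> e"
          using zconv[of "r/2" e "r+1"] r e by (metis half_gt_zero)
        have "norm (z (\<phi> (n + k0)) x * h - v x * h) \<le> e * norm h" if "n \<ge> k1" "x \<in> ?S" for n x h
          using mult_right_mono[OF k1[of "n+k0" x], of "\<bar>h\<bar>"] that by (simp add: abs_mult flip: left_diff_distrib)
        then show ?thesis unfolding eventually_sequentially by blast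
      qed
      show "r \<in> ?S" using r by simp
      show "(\<lambda>n. w (\<phi> (n + k0)) r) \<longlonglongrightarrow> f r"
      proof (rule LIMSEQ_ignore_initial_segment)
        show "(\<lambda>n. w (\<phi> n) r) \<longlonglongrightarrow> f r" unfolding LIMSEQ_iff real_norm_def
          using conv[of _ r] r by (metis atLeastAtMost_iff less_imp_le order_refl)
      qed
    qed simp
    then obtain h where h: "\<And>x. x \<in> ?S \<Longrightarrow> (\<lambda>n. w (\<phi> (n + k0)) x) \<longlonglongrightarrow> h x"
      "\<And>x. x \<in> ?S \<Longrightarrow> (h has_derivative (\<lambda>d. v x * d)) (at x within ?S)" by blast
    have hf: "h x = f x" if "x \<in> ?S" for x
    proof -
      have "(\<lambda>n. w (\<phi> n) x) \<longlonglongrightarrow> f x" unfolding LIMSEQ_iff real_norm_def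
          using conv[of _ "r+1"] that r by (metis atLeastAtMost_iff half_gt_zero less_imp_le order_trans)
      from LIMSEQ_ignore_initial_segment[OF this, of k0] h(1)[OF that] show ?thesis by (metis LIMSEQ_unique)
    qed
    have "(h has_real_derivative v r) (at r within ?S)" using h(2)[of r] r by (simp add: has_field_derivative_def)
    moreover have "r \<in> interior ?S" using r by simp
    ultimately have "(h has_real_derivative v r) (at r)" by (simp only: at_within_interior)
    then show ?thesis
      by (rule has_field_derivative_transform_within_open[of _ _ _ "{r/2<..<r+1}"]) (use hf r in auto)
  qed
  have "sol N g f v" unfolding v_def by (rule mass_int_sol[OF N g M fc]) (use fd in \<open>simp add: v_def\<close>)
  moreover have "(\<lambda>k. z (\<phi> k) r) \<longlonglongrightarrow> v r" if r: "r > 0" for r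
    unfolding LIMSEQ_iff real_norm_def
  proof (intro allI impI)
    fix e :: real assume "e > 0"
    then obtain k0 where "\<And>k x. k \<ge> k0 \<Longrightarrow> x\<in>{r..r} \<Longrightarrow> \<bar>z (\<phi> k) x - v x\<bar> \<le> e/2" using zconv[OF r, of "e/2" r] by (metis half_gt_zero)
    with \<open>e > 0\<close> show "\<exists>no. \<forall>n\<ge>no. \<bar>z (\<phi> n) r - v r\<bar> < e" by (intro exI[of _ k0]) force
  qed
  ultimately show ?thesis using that \<phi> lu by blast
qed

section \<open>Delayed approximations\<close>

text \<open>The second integration: a solution starting at \<open>d\<close> is a fixed point of
  \<open>u r = d - radial_int N (\<lambda>t. g (u t)) r\<close>.\<close>

definition radial_int :: "nat \<Rightarrow> (real \<Rightarrow> real) \<Rightarrow> real \<Rightarrow> real" where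
  "radial_int N y r = integral {0..r} (\<lambda>x. mass_int N y x / x ^ (N-1))"

text \<open>The empty integral provides the constant initial history that the delayed arguments
  \<open>t - h\<close> refer to when they are negative.\<close>

lemma radial_int_nonpos: "r \<le> 0 \<Longrightarrow> radial_int N y r = 0"
  by (cases "r = 0") (auto simp: radial_int_def)

lemma radial_int_max: "radial_int N y (max 0 r) = radial_int N y r"
  by (cases "r \<le> 0") (auto simp: radial_int_nonpos max_def)

lemma mass_int_quotient_bound:
  assumes "continuous_on {0..r} y" "r \<ge> 0" "\<And>t. t \<in> {0..r} \<Longrightarrow> \<bar>y t\<bar> \<le> K"
  shows "\<bar>mass_int N y r / r ^ (N-1)\<bar> \<le> K * r"
proof (cases "r = 0")
  case False
  with assms(2) have "r ^ (N-1) > 0" by simp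
  with mass_int_bound[OF assms, of N] show ?thesis by (simp add: abs_divide divide_le_eq algebra_simps)
qed (simp add: mass_int_def)

context
  fixes N :: nat and y :: "real \<Rightarrow> real" and M :: real
  assumes yc: "\<And>T. continuous_on {0..T} y" and yb: "\<And>t. \<bar>y t\<bar> \<le> M"
begin

lemma mass_int_quotient_continuous: "continuous_on {0..T} (\<lambda>x. mass_int N y x / x ^ (N-1))"
  unfolding continuous_on_eq_continuous_within
proof
  fix x assume x: "x \<in> {0..T}"
  show "continuous (at x within {0..T}) (\<lambda>x. mass_int N y x / x ^ (N-1))"
  proof (cases "x = 0")
    case False
    with x have "isCont (\<lambda>x. mass_int N y x / x ^ (N-1)) x"
      using DERIV_isCont[OF mass_int_deriv[OF yc, of x N]] by (intro continuous_intros) auto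
    then show ?thesis by (rule continuous_at_imp_continuous_at_within)
  next
    case True
    have ev: "\<forall>\<^sub>F x in at 0 within {0..T}. norm (mass_int N y x / x ^ (N-1)) \<le> M * x"
      using mass_int_quotient_bound[OF yc _ yb, of _ N]
      by (auto simp: eventually_at_filter intro!: always_eventually)
    have "((\<lambda>x. M * x) \<longlongrightarrow> 0) (at 0 within {0..T})" by (auto intro!: tendsto_eq_intros)
    with ev have "((\<lambda>x. mass_int N y x / x ^ (N-1)) \<longlongrightarrow> 0) (at 0 within {0..T})"
      by (rule Lim_null_comparison)
    then show ?thesis by (simp add: continuous_within True mass_int_def)
  qed
qed

lemma radial_int_deriv:
  assumes "r > 0" shows "(radial_int N y has_real_derivative mass_int N y r / r ^ (N-1)) (at r)"
proof -
  have "((\<lambda>r. integral {0..r} (\<lambda>x. mass_int N y x / x ^ (N-1))) has_real_derivative mass_int N y r / r ^ (N-1)) (at r within {0..r+1})"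
    by (rule integral_has_real_derivative[OF mass_int_quotient_continuous]) (use assms in auto)
  moreover have "r \<in> interior {0..r+1}" using assms by simp
  ultimately show ?thesis unfolding radial_int_def[abs_def] by (simp only: at_within_interior)
qed

lemma radial_int_lipschitz:
  assumes "a \<le> T" "c \<le> T" "T \<ge> 0"
  shows "\<bar>radial_int N y a - radial_int N y c\<bar> \<le> M * T * \<bar>a - c\<bar>"
proof -
  have M: "M \<ge> 0" using yb[of 0] by linarith
  have cont: "continuous_on {0..T} (radial_int N y)"
    unfolding radial_int_def[abs_def]
    by (rule indefinite_integral_continuous_1) (rule integrable_continuous_interval[OF mass_int_quotient_continuous])
  have *: "\<bar>radial_int N y p - radial_int N y q\<bar> \<le> M * T * (p - q)" if pq: "0 \<le> q" "q \<le> p" "p \<le> T" for p q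
  proof (cases "q = p")
    case False
    with pq have lt: "q < p" by simp
    have "\<exists>l z. q < z \<and> z < p \<and> (radial_int N y has_real_derivative l) (at z) \<and> radial_int N y p - radial_int N y q = (p - q) * l"
    proof (rule MVT[OF lt])
      show "continuous_on {q..p} (radial_int N y)" by (rule continuous_on_subset[OF cont]) (use pq in auto)
      fix x assume "q < x" "x < p"
      then have "x > 0" using pq by simp
      from radial_int_deriv[OF this] show "radial_int N y differentiable (at x)"
        unfolding real_differentiable_def by blast
    qed
    then obtain l z where z: "q < z" "z < p" "(radial_int N y has_real_derivative l) (at z)"
      "radial_int N y p - radial_int N y q = (p - q) * l" by blast
    have "l = mass_int N y z / z ^ (N-1)" using DERIV_unique[OF z(3) radial_int_deriv] z pq by auto
    then have "\<bar>l\<bar> \<le> M * z" using mass_int_quotient_bound[OF yc _ yb, of z N] z pq by auto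
    also have "\<dots> \<le> M * T" using z pq M by (intro mult_left_mono) auto
    finally show ?thesis unfolding z(4) using lt by (simp add: abs_mult mult.commute mult_left_mono)
  qed simp
  have **: "\<bar>radial_int N y p - radial_int N y q\<bar> \<le> M * T * \<bar>p - q\<bar>" if pq: "0 \<le> q" "0 \<le> p" "p \<le> T" "q \<le> T" for p q
    using *[of q p] *[of p q] pq by (cases "q \<le> p") (auto simp: abs_minus_commute)
  have "\<bar>radial_int N y a - radial_int N y c\<bar> \<le> M * T * \<bar>max 0 a - max 0 c\<bar>"
    using **[of "max 0 c" "max 0 a"] assms by (simp add: radial_int_max)
  also have "\<dots> \<le> M * T * \<bar>a - c\<bar>" using M assms by (intro mult_left_mono) auto
  finally show ?thesis .
qed

end

lemma radial_int_diff:
  assumes y: "\<And>T. continuous_on {0..T} y" "\<And>t. \<bar>y t\<bar> \<le> M"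
    and y': "\<And>T. continuous_on {0..T} y'" "\<And>t. \<bar>y' t\<bar> \<le> M"
    and e: "e \<ge> 0" "\<And>t. 0 \<le> t \<Longrightarrow> t \<le> T \<Longrightarrow> \<bar>y t - y' t\<bar> \<le> e" and r: "r \<le> T" "T \<ge> 0"
  shows "\<bar>radial_int N y r - radial_int N y' r\<bar> \<le> e * T * T"
proof (cases "r \<ge> 0")
  case False
  then show ?thesis using e(1) r by (simp add: radial_int_nonpos)
next
  case True
  have cq: "continuous_on {0..r} (\<lambda>x. mass_int N y x / x ^ (N-1))" "continuous_on {0..r} (\<lambda>x. mass_int N y' x / x ^ (N-1))"
    by (rule mass_int_quotient_continuous[OF y] mass_int_quotient_continuous[OF y'])+
  have "radial_int N y r - radial_int N y' r = integral {0..r} (\<lambda>x. mass_int N y x / x ^ (N-1) - mass_int N y' x / x ^ (N-1))"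
    unfolding radial_int_def
    by (subst Henstock_Kurzweil_Integration.integral_diff) (use cq in \<open>auto intro!: integrable_continuous_interval\<close>)
  also have "norm \<dots> \<le> (e * T) * (r - 0)"
  proof (rule integral_bound[OF True])
    show "norm (mass_int N y x / x ^ (N-1) - mass_int N y' x / x ^ (N-1)) \<le> e * T" if x: "x \<in> {0..r}" for x
    proof -
      have "\<bar>mass_int N (\<lambda>t. y t - y' t) x / x ^ (N-1)\<bar> \<le> e * x"
        by (rule mass_int_quotient_bound) (use x y y' e r in \<open>auto intro!: continuous_intros\<close>)
      also have "\<dots> \<le> e * T" using x r e by (intro mult_left_mono) auto
      finally show ?thesis using mass_int_diff[OF y(1) y'(1), where N = N] by (simp flip: diff_divide_distrib)
    qed
  qed (use cq in \<open>auto intro!: continuous_intros\<close>)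
  also have "\<dots> \<le> e * T * T" using True r e by (intro mult_left_mono) auto
  finally show ?thesis by simp
qed

text \<open>Tonelli's delayed approximations: each step is an explicit integral, so the approximants exist and
  depend continuously on the initial value although the initial value problem may lack uniqueness.\<close>
primrec tonelli :: "nat \<Rightarrow> (real \<Rightarrow> real) \<Rightarrow> real \<Rightarrow> real \<Rightarrow> nat \<Rightarrow> real \<Rightarrow> real" where
  "tonelli N g h d 0 = (\<lambda>r. d)"
| "tonelli N g h d (Suc j) = (\<lambda>r. d - radial_int N (\<lambda>t. g (tonelli N g h d j (t - h))) r)"

locale bounded_nonlinearity =
  fixes N :: nat and g :: "real \<Rightarrow> real" and M :: real
  assumes N_gt: "N > 2" and g_bound: "\<And>s. \<bar>g s\<bar> \<le> M" and g_uc: "uniformly_continuous_on UNIV g"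
begin

lemma M_nonneg: "M \<ge> 0" using g_bound[of 0] by linarith

lemma g_continuous: "continuous_on UNIV g" by (rule uniformly_continuous_imp_continuous[OF g_uc])

lemma tonelli_regular:
  "(\<forall>T. continuous_on {..T} (tonelli N g h d j)) \<and>
   (\<forall>T\<ge>0. \<forall>a\<le>T. \<forall>c\<le>T. \<bar>tonelli N g h d j a - tonelli N g h d j c\<bar> \<le> M * T * \<bar>a - c\<bar>)"
proof (induction j)
  case 0 then show ?case using M_nonneg by simp
next
  case (Suc j)
  have c: "continuous_on {0..T} (\<lambda>t. g (tonelli N g h d j (t - h)))" for T
    by (rule continuous_on_compose2[OF g_continuous continuous_on_compose2[of "{..T - h}" "tonelli N g h d j"]])
       (use Suc in \<open>auto intro!: continuous_intros\<close>)
  have lip: "\<bar>tonelli N g h d (Suc j) a - tonelli N g h d (Suc j) c\<bar> \<le> M * T * \<bar>a - c\<bar>"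
    if "a \<le> T" "c \<le> T" "T \<ge> 0" for a c T
    using radial_int_lipschitz[OF c g_bound that, of N] by (simp add: abs_minus_commute)
  have "continuous_on {..T} (tonelli N g h d (Suc j))" for T
  proof -
    have "(M * \<bar>T\<bar>)-lipschitz_on {..T} (tonelli N g h d (Suc j))"
      by (rule lipschitz_onI) (use lip[of _ "\<bar>T\<bar>"] M_nonneg in \<open>auto simp: dist_real_def\<close>)
    then show ?thesis by (rule lipschitz_on_continuous_on)
  qed
  with lip show ?case by blast
qed

lemma tonelli_continuous: "continuous_on {0..T} (tonelli N g h d j)"
proof -
  have "continuous_on {..T} (tonelli N g h d j)" using tonelli_regular by blast
  then show ?thesis by (rule continuous_on_subset) auto
qed

lemma tonelli_delayed_continuous: "continuous_on {0..T} (\<lambda>t. g (tonelli N g h d j (t - h)))"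
  by (rule continuous_on_compose2[OF g_continuous continuous_on_compose2[of "{..T - h}" "tonelli N g h d j"]])
     (use tonelli_regular[of h d j] in \<open>auto intro!: continuous_intros\<close>)

text \<open>A new iterate up to radius \<open>r\<close> looks at the old one only up to
  \<open>r - h\<close>, so the part up to \<open>j * h\<close> no longer changes after
  \<open>j\<close> rounds.\<close>

lemma tonelli_stable: "r \<le> real j * h \<Longrightarrow> tonelli N g h d (Suc j) r = tonelli N g h d j r"
proof (induction j arbitrary: r)
  case 0 then show ?case by (simp add: radial_int_nonpos)
next
  case (Suc j)
  have "radial_int N (\<lambda>t. g (tonelli N g h d (Suc j) (t - h))) r = radial_int N (\<lambda>t. g (tonelli N g h d j (t - h))) r"
    unfolding radial_int_def mass_int_def
  proof (intro integral_cong arg_cong2[of _ _ _ _ "(/)"] refl)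
    fix x t assume "x \<in> {0..r}" "t \<in> {0..x}"
    then have "t - h \<le> real j * h" using Suc.prems by (auto simp: algebra_simps)
    then show "t ^ (N-1) * g (tonelli N g h d (Suc j) (t - h)) = t ^ (N-1) * g (tonelli N g h d j (t - h))"
      using Suc.IH by metis
  qed
  then show ?case by (subst (1 2) tonelli.simps) simp
qed

lemma tonelli_initial: "tonelli N g h d j 0 = d"
  by (cases j) (auto simp: radial_int_nonpos)

text \<open>The modulus of continuity depends on the number of iterations, hence on the delay.
  Continuity in the initial value is therefore exploited for one fixed approximation at a time,
  before the limit is taken.\<close>

lemma tonelli_continuous_param:
  assumes "e > 0" "T \<ge> 0" "h \<ge> 0"
  shows "\<exists>\<delta>>0. \<forall>d d'. \<bar>d - d'\<bar> < \<delta> \<longrightarrow> (\<forall>r\<le>T. \<bar>tonelli N g h d j r - tonelli N g h d' j r\<bar> < e)"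
  using assms(1)
proof (induction j arbitrary: e)
  case 0 then show ?case by auto
next
  case (Suc j)
  define e' where "e' = e / (2 * (T * T + 1))"
  have e': "e' > 0" "e' * T * T < e / 2" using Suc.prems by (auto simp: e'_def field_simps add_pos_nonneg)
  obtain k where k: "k > 0" "\<And>x y. \<bar>y - x\<bar> < k \<Longrightarrow> \<bar>g y - g x\<bar> < e'"
    using g_uc e'(1) unfolding uniformly_continuous_on_def dist_real_def by (metis UNIV_I)
  obtain \<delta> where \<delta>: "\<delta> > 0" "\<And>d d' r. \<bar>d - d'\<bar> < \<delta> \<Longrightarrow> r \<le> T \<Longrightarrow> \<bar>tonelli N g h d j r - tonelli N g h d' j r\<bar> < k"
    using Suc.IH[OF k(1)] by blast
  have "\<bar>tonelli N g h d (Suc j) r - tonelli N g h d' (Suc j) r\<bar> < e"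
    if dd: "\<bar>d - d'\<bar> < min \<delta> (e/2)" and r: "r \<le> T" for d d' r
  proof -
    have "\<bar>radial_int N (\<lambda>t. g (tonelli N g h d j (t - h))) r - radial_int N (\<lambda>t. g (tonelli N g h d' j (t - h))) r\<bar> \<le> e' * T * T"
      by (rule radial_int_diff[where M = M])
         (use tonelli_delayed_continuous g_bound e'(1) assms r in \<open>auto intro!: less_imp_le[OF k(2)] \<delta>(2) dd[THEN less_le_trans]\<close>)
    moreover have "\<bar>d - d'\<bar> < e / 2" using dd by simp
    ultimately show ?thesis unfolding tonelli.simps using e'(2) by linarith
  qed
  then show ?case using \<delta>(1) Suc.prems by (intro exI[of _ "min \<delta> (e/2)"]) auto
qed

text \<open>With delay \<open>1 / (n + 1)\<close>, a number of \<open>(n + 1)^2\<close> iterations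
  is just enough for the fixed point equation to hold up to radius \<open>n + 1\<close>.\<close>

definition approx :: "nat \<Rightarrow> real \<Rightarrow> real \<Rightarrow> real" where
  "approx n d = tonelli N g (1 / real (Suc n)) d (Suc n * Suc n)"

lemma approx_initial: "approx n d 0 = d"
  by (simp only: approx_def tonelli_initial)

lemma approx_fixpoint:
  assumes "r \<le> real (Suc n)"
  shows "approx n d r = d - radial_int N (\<lambda>t. g (approx n d (t - 1 / real (Suc n)))) r"
proof -
  have "real (Suc n * Suc n) * (1 / real (Suc n)) = real (Suc n)" by (simp only: of_nat_mult) simp
  then have "r \<le> real (Suc n * Suc n) * (1 / real (Suc n))" using assms by simp
  from tonelli_stable[OF this, of d] show ?thesis unfolding approx_def by simp
qed

lemma approx_limit:
  assumes n: "\<And>k. n k \<ge> k" and d: "\<And>k. \<bar>d k\<bar> \<le> B"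
  obtains \<phi> :: "nat \<Rightarrow> nat" and f v where "strict_mono \<phi>" "sol N g f v"
    "loc_unif (\<lambda>k. approx (n (\<phi> k)) (d (\<phi> k))) f"
proof -
  define w where "w = (\<lambda>k. approx (n k) (d k))"
  define h where "h = (\<lambda>k. 1 / real (Suc (n k)))"
  define y where "y = (\<lambda>k t. g (w k (t - h k)))"
  define z where "z = (\<lambda>k r. - mass_int N (y k) r / r ^ (N-1))"
  have yc: "continuous_on {0..T} (y k)" for k T
    unfolding y_def w_def h_def approx_def by (rule tonelli_delayed_continuous)
  have lip: "\<bar>w k a - w k c\<bar> \<le> M * T * \<bar>a - c\<bar>" if "a \<le> T" "c \<le> T" "T \<ge> 0" for k a c T
    using tonelli_regular that unfolding w_def approx_def by blast
  have wc: "continuous_on {0..T} (w k)" for k T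
    unfolding w_def approx_def by (rule tonelli_continuous)
  have gw: "continuous_on {0..T} (\<lambda>t. g (w k t))" for k T by (rule continuous_on_compose2[OF g_continuous wc]) simp
  obtain \<phi> f v where "strict_mono \<phi>" "sol N g f v"
    "loc_unif (\<lambda>k. w (\<phi> k)) f"
  proof (rule approximate_solutions_compact[OF N_gt g_continuous g_bound, of w B z])
    show "\<exists>L. \<forall>k. \<forall>x\<in>{0..T}. \<forall>y\<in>{0..T}. \<bar>w k x - w k y\<bar> \<le> L * \<bar>x - y\<bar>" for T
      using lip[of _ T] by (intro exI[of _ "M * T"]) auto
    show "\<bar>w k 0\<bar> \<le> B" for k unfolding w_def approx_def tonelli_initial by (rule d)
    fix a T e :: real assume a: "a > 0" and e: "e > 0"
    define T' where "T' = \<bar>T\<bar> + 1"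
    have T': "T' > 0" "T < T'" by (auto simp: T'_def)
    define e' where "e' = e / (T' ^ (N-1) * T')"
    have e': "e' > 0" "e' * T' ^ (N-1) * T' = e" using e T' by (auto simp: e'_def)
    obtain \<delta> where \<delta>: "\<delta> > 0" "\<And>x y. \<bar>y - x\<bar> < \<delta> \<Longrightarrow> \<bar>g y - g x\<bar> < e'"
      using g_uc e'(1) unfolding uniformly_continuous_on_def dist_real_def by (metis UNIV_I)
    \<comment> \<open>\<open>k1\<close> makes the oscillation of an approximant over one delay
      smaller than \<delta>; \<open>k2\<close> makes the fixed point equation valid up to
      \<open>T'\<close>.\<close>
    obtain k1 :: nat where k1: "M * T' / \<delta> < real k1" using reals_Archimedean2 by blast
    obtain k2 :: nat where k2: "T' < real k2" using reals_Archimedean2 by blast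
    have "(w k has_real_derivative z k r) (at r) \<and> \<bar>r ^ (N-1) * z k r + mass_int N (\<lambda>t. g (w k t)) r\<bar> \<le> e"
      if k: "k \<ge> max k1 k2" and r: "r \<in> {a..T}" for k r
    proof
      have r0: "r > 0" "r < T'" using a r T' by auto
      have nk: "real (Suc (n k)) > T'" "real (Suc (n k)) > M * T' / \<delta>"
        using n[of k] k k1 k2 by auto
      have hk: "h k > 0" "M * T' * h k < \<delta>"
        using nk(2) \<delta>(1) by (auto simp: h_def field_simps)
      have "((\<lambda>r. d k - radial_int N (y k) r) has_real_derivative 0 - mass_int N (y k) r / r ^ (N-1)) (at r)"
        unfolding y_def by (intro DERIV_diff DERIV_const radial_int_deriv[OF yc[unfolded y_def] g_bound r0(1)])
      then have "((\<lambda>r. d k - radial_int N (y k) r) has_real_derivative z k r) (at r)" by (simp add: z_def)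
      then show "(w k has_real_derivative z k r) (at r)"
      proof (rule has_field_derivative_transform_within_open[of _ _ _ "{0<..<T'}"])
        fix x assume "x \<in> {0<..<T'}"
        then show "d k - radial_int N (y k) x = w k x"
          using approx_fixpoint[of x "n k" "d k"] nk(1) by (simp add: w_def y_def h_def)
      qed (use r0 in auto)
      have "r ^ (N-1) * z k r = - mass_int N (y k) r" using r0 by (simp add: z_def)
      then have "r ^ (N-1) * z k r + mass_int N (\<lambda>t. g (w k t)) r = mass_int N (\<lambda>t. g (w k t) - y k t) r"
        using mass_int_diff[OF gw yc, of N] by simp
      also have "\<bar>\<dots>\<bar> \<le> e' * r ^ (N-1) * r"
      proof (rule mass_int_bound)
        fix t assume t: "t \<in> {0..r}"
        have "\<bar>w k t - w k (t - h k)\<bar> \<le> M * T' * \<bar>t - (t - h k)\<bar>" by (rule lip) (use t r0 hk(1) in auto)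
        also have "\<dots> < \<delta>" using hk by simp
        finally show "\<bar>g (w k t) - y k t\<bar> \<le> e'" unfolding y_def using \<delta>(2) by (simp add: less_imp_le)
      qed (use r0 gw yc in \<open>auto intro!: continuous_intros\<close>)
      also have "\<dots> \<le> e' * T' ^ (N-1) * T'" using r0 e'(1) by (intro mult_mono power_mono) auto
      finally show "\<bar>r ^ (N-1) * z k r + mass_int N (\<lambda>t. g (w k t)) r\<bar> \<le> e" using e'(2) by simp
    qed
    then show "\<exists>k0. \<forall>k\<ge>k0. \<forall>r\<in>{a..T}. (w k has_real_derivative z k r) (at r) \<and>
       \<bar>r ^ (N-1) * z k r + mass_int N (\<lambda>t. g (w k t)) r\<bar> \<le> e" by blast
  qed blast
  then show ?thesis using that unfolding w_def by blast
qed

text \<open>By compactness the behaviour of all exact solutions from \<open>p\<close> and from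
  \<open>q\<close> is inherited by the approximants with large index. For a fixed approximant, the
  initial values giving positivity and those giving a negative value form disjoint open sets, which
  cannot cover the connected segment. The remaining initial values have a limit as the index
  grows.\<close>

lemma touching_solution:
  assumes T: "T \<ge> 0" and p: "\<And>u v. sol N g u v \<Longrightarrow> u 0 = p \<Longrightarrow> \<forall>r\<in>{0..T}. u r > 0"
    and q: "\<And>u v. sol N g u v \<Longrightarrow> u 0 = q \<Longrightarrow> \<exists>r\<in>{0..T}. u r < 0"
  obtains u v where "sol N g u v" "u 0 \<in> closed_segment p q" "\<And>r. r \<in> {0..T} \<Longrightarrow> u r \<ge> 0" "\<exists>r\<in>{0..T}. u r \<le> 0"
proof -
  have cont: "continuous_on {0..T} f" if "sol N g f v" for f v
    by (rule continuous_on_subset[OF sol_continuous_u[OF that]]) simp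
  have "\<exists>n0. \<forall>n\<ge>n0. \<forall>r\<in>{0..T}. approx n p r > 0"
  proof (rule ccontr)
    assume "\<not> ?thesis"
    then obtain n where n: "\<And>k. n k \<ge> k \<and> (\<exists>r\<in>{0..T}. \<not> approx (n k) p r > 0)" by metis
    obtain \<phi> f v where \<phi>: "strict_mono \<phi>" "sol N g f v"
      "loc_unif (\<lambda>k. approx (n (\<phi> k)) p) f"
      using approx_limit[of n "\<lambda>_. p" "\<bar>p\<bar>"] n by auto
    have "f 0 = p"
      using loc_unif_pointwise[OF \<phi>(3), of 0] T by (simp add: approx_initial LIMSEQ_const_iff)
    then have "\<And>x. x \<in> {0..T} \<Longrightarrow> f x > 0" using p[OF \<phi>(2)] by blast
    then obtain k0 where "\<And>k x. k \<ge> k0 \<Longrightarrow> x \<in> {0..T} \<Longrightarrow> approx (n (\<phi> k)) p x > 0"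
      using loc_unif_positive[OF \<phi>(3) cont[OF \<phi>(2)]] T by metis
    with n[of "\<phi> k0"] show False by blast
  qed
  then obtain n1 where n1: "\<And>n r. n \<ge> n1 \<Longrightarrow> r\<in>{0..T} \<Longrightarrow> approx n p r > 0" by blast
  have "\<exists>n0. \<forall>n\<ge>n0. \<exists>r\<in>{0..T}. approx n q r < 0"
  proof (rule ccontr)
    assume "\<not> ?thesis"
    then obtain n where n: "\<And>k. n k \<ge> k \<and> (\<forall>r\<in>{0..T}. \<not> approx (n k) q r < 0)" by metis
    obtain \<phi> f v where \<phi>: "strict_mono \<phi>" "sol N g f v"
      "loc_unif (\<lambda>k. approx (n (\<phi> k)) q) f"
      using approx_limit[of n "\<lambda>_. q" "\<bar>q\<bar>"] n by auto
    have "f 0 = q"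
      using loc_unif_pointwise[OF \<phi>(3), of 0] T by (simp add: approx_initial LIMSEQ_const_iff)
    then obtain r where r: "r \<in> {0..T}" "f r < 0" using q[OF \<phi>(2)] by blast
    have "f r \<ge> 0"
      by (rule LIMSEQ_le_const[OF loc_unif_pointwise[OF \<phi>(3)]]) (use n r in \<open>auto simp: not_less\<close>)
    with r show False by simp
  qed
  then obtain n2 where n2: "\<And>n. n \<ge> n2 \<Longrightarrow> \<exists>r\<in>{0..T}. approx n q r < 0" by blast
  have "\<exists>d\<in>closed_segment p q. (\<forall>r\<in>{0..T}. approx n d r \<ge> 0) \<and> (\<exists>r\<in>{0..T}. approx n d r \<le> 0)"
    if n: "n \<ge> max n1 n2" for n
  proof (rule ccontr)
    assume neg: "\<not> ?thesis"
    define A where "A = {d. \<forall>r\<in>{0..T}. approx n d r > 0}"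
    define C where "C = {d. \<exists>r\<in>{0..T}. approx n d r < 0}"
    have ac: "continuous_on {0..T} (approx n d)" for d
      unfolding approx_def by (rule tonelli_continuous)
    have par: "\<exists>\<delta>>0. \<forall>d'. \<bar>d' - d\<bar> < \<delta> \<longrightarrow> (\<forall>r\<in>{0..T}. \<bar>approx n d' r - approx n d r\<bar> < e)" if e: "e > 0" for d e
    proof -
      obtain \<delta> where "\<delta> > 0" "\<forall>d d'. \<bar>d - d'\<bar> < \<delta> \<longrightarrow> (\<forall>r\<le>T. \<bar>approx n d r - approx n d' r\<bar> < e)"
        using tonelli_continuous_param[OF e T, of "1 / real (Suc n)" "Suc n * Suc n"] unfolding approx_def by auto
      then show ?thesis by (intro exI[of _ \<delta>]) auto
    qed
    have "open A"
      unfolding open_dist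
    proof (intro ballI)
      fix d assume d: "d \<in> A"
      obtain x0 where x0: "x0 \<in> {0..T}" "\<And>x. x \<in> {0..T} \<Longrightarrow> approx n d x0 \<le> approx n d x"
        using continuous_attains_inf[of "{0..T}" "approx n d"] ac T by auto
      then have "approx n d x0 > 0" using d by (auto simp: A_def)
      then obtain \<delta> where \<delta>: "\<delta> > 0" "\<And>d' r. \<bar>d' - d\<bar> < \<delta> \<Longrightarrow> r\<in>{0..T} \<Longrightarrow> \<bar>approx n d' r - approx n d r\<bar> < approx n d x0"
        using par by blast
      have "d' \<in> A" if "dist d' d < \<delta>" for d'
        unfolding A_def using \<delta>(2)[of d'] x0(2) that by (simp add: dist_real_def) (smt (verit) atLeastAtMost_iff)
      with \<delta>(1) show "\<exists>e>0. \<forall>y. dist y d < e \<longrightarrow> y \<in> A" by blast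
    qed
    moreover have "open C"
      unfolding open_dist
    proof (intro ballI)
      fix d assume "d \<in> C"
      then obtain x0 where x0: "x0 \<in> {0..T}" "approx n d x0 < 0" by (auto simp: C_def)
      then obtain \<delta> where \<delta>: "\<delta> > 0" "\<And>d' r. \<bar>d' - d\<bar> < \<delta> \<Longrightarrow> r\<in>{0..T} \<Longrightarrow> \<bar>approx n d' r - approx n d r\<bar> < - approx n d x0"
        using par by (metis neg_0_less_iff_less)
      have "d' \<in> C" if "dist d' d < \<delta>" for d'
        unfolding C_def using \<delta>(2)[of d' x0] x0 that by (auto simp: dist_real_def intro!: bexI[of _ x0])
      with \<delta>(1) show "\<exists>e>0. \<forall>y. dist y d < e \<longrightarrow> y \<in> C" by blast
    qed
    moreover have "closed_segment p q \<subseteq> A \<union> C"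
    proof
      fix d assume "d \<in> closed_segment p q"
      then show "d \<in> A \<union> C" using neg by (auto simp: A_def C_def not_less not_le)
    qed
    moreover have "A \<inter> C \<inter> closed_segment p q = {}" by (force simp: A_def C_def)
    moreover have "p \<in> A" "q \<in> C" using n1 n2 n by (auto simp: A_def C_def)
    ultimately show False
      using connectedD[OF connected_segment(1)[of p q], of A C] by auto
  qed
  then have "\<exists>d. d \<in> closed_segment p q \<and> (\<forall>r\<in>{0..T}. approx (k + max n1 n2) d r \<ge> 0) \<and> (\<exists>r\<in>{0..T}. approx (k + max n1 n2) d r \<le> 0)" for k
    using le_add2[of "max n1 n2" k] by blast
  then obtain d where d: "\<And>k. d k \<in> closed_segment p q" "\<And>k r. r\<in>{0..T} \<Longrightarrow> approx (k + max n1 n2) (d k) r \<ge> 0"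
    "\<And>k. \<exists>r\<in>{0..T}. approx (k + max n1 n2) (d k) r \<le> 0" by metis
  have dB: "\<bar>d k\<bar> \<le> \<bar>p\<bar> + \<bar>q\<bar>" for k using d(1)[of k] by (auto simp: closed_segment_eq_real_ivl split: if_splits)
  obtain \<phi> f v where \<phi>: "strict_mono \<phi>" "sol N g f v"
      "loc_unif (\<lambda>k. approx (\<phi> k + max n1 n2) (d (\<phi> k))) f"
    using approx_limit[of "\<lambda>k. k + max n1 n2" d, OF _ dB] by auto
  have "(\<lambda>k. d (\<phi> k)) \<longlonglongrightarrow> f 0"
    using loc_unif_pointwise[OF \<phi>(3), of 0] T by (simp add: approx_initial)
  then have "f 0 \<in> closed_segment p q"
    using closed_sequentially[OF closed_segment, of "\<lambda>k. d (\<phi> k)" p q "f 0"] d(1) by blast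
  moreover have "f r \<ge> 0" if "r \<in> {0..T}" for r
    by (rule LIMSEQ_le_const[OF loc_unif_pointwise[OF \<phi>(3)]]) (use d(2)[OF that] that in auto)
  moreover have "\<exists>r\<in>{0..T}. f r \<le> 0"
  proof (rule ccontr)
    assume "\<not> ?thesis"
    then have "\<And>x. x \<in> {0..T} \<Longrightarrow> f x > 0" by force
    then obtain k0 where "\<And>k x. k \<ge> k0 \<Longrightarrow> x \<in> {0..T} \<Longrightarrow> approx (\<phi> k + max n1 n2) (d (\<phi> k)) x > 0"
      using loc_unif_positive[OF \<phi>(3) cont[OF \<phi>(2)]] T by metis
    with d(3)[of "\<phi> k0"] show False by force
  qed
  ultimately show ?thesis using that \<phi>(2) by blast
qed

lemma solutions_compact:
  assumes s: "\<And>k::nat. sol N g (u k) (v k)" and bd: "\<And>k. \<bar>u k 0\<bar> \<le> B"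
  obtains \<phi> :: "nat \<Rightarrow> nat" and f f' where "strict_mono \<phi>" "sol N g f f'"
    "loc_unif (\<lambda>k. u (\<phi> k)) f"
    "\<And>r. r > 0 \<Longrightarrow> (\<lambda>k. v (\<phi> k) r) \<longlonglongrightarrow> f' r"
proof (rule approximate_solutions_compact[OF N_gt g_continuous g_bound, of u B v])
  show "\<exists>L. \<forall>k. \<forall>x\<in>{0..T}. \<forall>y\<in>{0..T}. \<bar>u k x - u k y\<bar> \<le> L * \<bar>x - y\<bar>" for T
  proof (intro exI[of _ "M * T"] allI ballI)
    fix k x y assume xy: "x \<in> {0..T}" "y \<in> {0..T}"
    have "norm (u k x - u k y) \<le> M * T * norm (x - y)"
    proof (rule field_differentiable_bound[of "{0..T}" "u k" "v k"])
      fix z assume z: "z \<in> {0..T}"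
      show "(u k has_field_derivative v k z) (at z within {0..T})"
        using s[of k] z unfolding sol_def by (auto intro: DERIV_subset)
      have "\<bar>v k z\<bar> \<le> M * z / N" by (rule sol_slope_abs[OF s g_continuous N_gt]) (use z g_bound in auto)
      also have "\<dots> \<le> M * z" using N_gt z M_nonneg mult_left_mono[of 1 "real N" "M * z"] by (simp add: divide_le_eq)
      also have "\<dots> \<le> M * T" using z M_nonneg by (intro mult_left_mono) auto
      finally show "norm (v k z) \<le> M * T" by simp
    qed (use xy in auto)
    then show "\<bar>u k x - u k y\<bar> \<le> M * T * \<bar>x - y\<bar>" by simp
  qed
  show "\<exists>k0. \<forall>k\<ge>k0. \<forall>r\<in>{a..T}. (u k has_real_derivative v k r) (at r) \<and>
       \<bar>r ^ (N-1) * v k r + mass_int N (\<lambda>t. g (u k t)) r\<bar> \<le> e" if "a > 0" "e > 0" for a T e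
    using sol_deriv_u[OF s] sol_mass_int[OF s g_continuous N_gt] that by (intro exI[of _ 0]) auto
qed (use bd that in auto)

end

locale bounded_well = well + bounded_nonlinearity
begin

text \<open>Solutions are not determined by their initial value, so the hypotheses speak about all of them.\<close>
theorem shooting:
  assumes h: "p > \<beta>" "q > \<beta>"
    and p: "\<And>u v. sol N g u v \<Longrightarrow> u 0 = p \<Longrightarrow> trapped g u v"
    and q: "\<And>u v. sol N g u v \<Longrightarrow> u 0 = q \<Longrightarrow> \<exists>r\<ge>0. u r < 0"
  obtains u where "radial_ground_state N g u" "u 0 \<in> closed_segment p q" "u 0 \<noteq> p" "u 0 \<noteq> q"
proof -
  have trapped_pos: "u r > 0" if s: "sol N g u v" and t: "trapped g u v" and r: "r \<ge> 0" for u v r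
  proof -
    obtain R where R: "R \<ge> 0" "energy g u v R < 0" "\<forall>r\<in>{0..R}. u r > 0" using t unfolding trapped_def by blast
    obtain c where "c > 0" "\<And>r. r \<ge> R \<Longrightarrow> u r \<ge> c" using trap[OF s R(1,2)] by blast
    then show ?thesis using R(3) r by (cases "r \<le> R") (auto intro: less_le_trans)
  qed
  \<comment> \<open>A common crossing time for all solutions from \<open>q\<close>: solutions
    nonnegative on longer and longer intervals would have a limit from \<open>q\<close> that never
    becomes negative.\<close>
  have "\<exists>T0. \<forall>T\<ge>T0. \<forall>u v. sol N g u v \<longrightarrow> u 0 = q \<longrightarrow> (\<exists>r\<in>{0..T}. u r < 0)"
  proof (rule ccontr)
    assume neg: "\<not> ?thesis"
    have "\<exists>u v. sol N g u v \<and> u 0 = q \<and> (\<forall>r\<in>{0..real k}. u r \<ge> 0)" for k :: nat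
    proof -
      obtain T u v where T: "T \<ge> real k" "sol N g u v" "u 0 = q" "\<not> (\<exists>r\<in>{0..T}. u r < 0)"
        using neg by (meson order_refl)
      then have "\<forall>r\<in>{0..real k}. u r \<ge> 0" by (auto simp: not_less)
      with T show ?thesis by blast
    qed
    then obtain u v where uv: "\<And>k. sol N g (u k) (v k)" "\<And>k. u k 0 = q" "\<And>k r. r\<in>{0..real k} \<Longrightarrow> u k r \<ge> 0" by metis
    obtain \<phi> f f' where \<phi>: "strict_mono \<phi>" "sol N g f f'"
      "loc_unif (\<lambda>k. u (\<phi> k)) f"
    proof -
      have "\<bar>u k 0\<bar> \<le> \<bar>q\<bar>" for k by (simp add: uv(2))
      from solutions_compact[of u v, OF uv(1) this] that show thesis by metis
    qed
    have "f 0 = q" using loc_unif_pointwise[OF \<phi>(3), of 0] by (simp add: uv(2) LIMSEQ_const_iff)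
    then obtain r where r: "r \<ge> 0" "f r < 0" using q[OF \<phi>(2)] by blast
    obtain k0 :: nat where k0: "r \<le> real k0" using real_arch_simple by blast
    have "f r \<ge> 0"
    proof (rule LIMSEQ_le_const[OF loc_unif_pointwise[OF \<phi>(3), of r]])
      show "\<exists>N. \<forall>n\<ge>N. 0 \<le> u (\<phi> n) r"
      proof (intro exI[of _ k0] allI impI)
        fix n assume "k0 \<le> n"
        then have "k0 \<le> \<phi> n" using seq_suble[OF \<phi>(1), of n] by simp
        then have "r \<le> real (\<phi> n)" using k0 by (meson of_nat_mono order_trans)
        then show "0 \<le> u (\<phi> n) r" using r by (intro uv(3)) simp
      qed
    qed (use r in auto)
    with r show False by simp
  qed
  then obtain T0 where T0: "\<And>T u v. T \<ge> T0 \<Longrightarrow> sol N g u v \<Longrightarrow> u 0 = q \<Longrightarrow> \<exists>r\<in>{0..T}. u r < 0" by blast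
  \<comment> \<open>At least \<open>T0\<close>, and unbounded, so that the limit of the touching
    solutions is nonnegative on the whole half-line.\<close>
  define T where "T = (\<lambda>k. max 0 T0 + real k)"
  have "\<exists>u v. sol N g u v \<and> u 0 \<in> closed_segment p q \<and> (\<forall>r\<in>{0..T k}. u r \<ge> 0) \<and> (\<exists>r\<in>{0..T k}. u r \<le> 0)" for k
  proof -
    have Tk: "T k \<ge> 0" "T k \<ge> T0" by (auto simp: T_def)
    have pos: "\<forall>r\<in>{0..T k}. u r > 0" if "sol N g u v" "u 0 = p" for u v
      using trapped_pos[OF that(1) p[OF that]] by simp
    show ?thesis
      by (rule touching_solution[of "T k" p q, OF Tk(1) pos T0[OF Tk(2)]]) blast+
  qed
  then obtain u v where uv: "\<And>k. sol N g (u k) (v k)" "\<And>k. u k 0 \<in> closed_segment p q"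
    "\<And>k r. r\<in>{0..T k} \<Longrightarrow> u k r \<ge> 0" "\<And>k. \<exists>r\<in>{0..T k}. u k r \<le> 0" by metis
  have dB: "\<bar>u k 0\<bar> \<le> \<bar>p\<bar> + \<bar>q\<bar>" for k using uv(2)[of k] by (auto simp: closed_segment_eq_real_ivl split: if_splits)
  obtain \<phi> f f' where \<phi>: "strict_mono \<phi>" "sol N g f f'"
      "loc_unif (\<lambda>k. u (\<phi> k)) f"
      "\<And>r. r > 0 \<Longrightarrow> (\<lambda>k. v (\<phi> k) r) \<longlonglongrightarrow> f' r"
    using solutions_compact[of u v, OF uv(1) dB] by metis
  have f0: "f 0 \<in> closed_segment p q"
    using closed_sequentially[OF closed_segment _ loc_unif_pointwise[OF \<phi>(3), of 0]] uv(2) by auto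
  then have f0\<beta>: "f 0 > \<beta>" using h by (auto simp: closed_segment_eq_real_ivl split: if_splits)
  have fnn: "f r \<ge> 0" if "r \<ge> 0" for r
  proof (rule LIMSEQ_le_const[OF loc_unif_pointwise[OF \<phi>(3), of r]])
    obtain k0 :: nat where k0: "r \<le> real k0" using real_arch_simple by blast
    have "u (\<phi> n) r \<ge> 0" if "n \<ge> k0" for n
      using seq_suble[OF \<phi>(1), of n] that k0 \<open>r \<ge> 0\<close> by (intro uv(3)) (simp add: T_def max_def)
    then show "\<exists>N. \<forall>n\<ge>N. 0 \<le> u (\<phi> n) r" by blast
  qed (use that in auto)
  have nt: "\<not> trapped g f f'"
  proof
    assume "trapped g f f'"
    \<comment> \<open>Being trapped is an open condition. It would pass from \<open>f\<close> to
      some of the touching solutions, which would then be positive forever.\<close>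
    then obtain R where R: "R \<ge> 0" "energy g f f' R < 0" "\<forall>r\<in>{0..R}. f r > 0" unfolding trapped_def by blast
    have "R \<noteq> 0" using R(2) F_pos[OF f0\<beta>] by (auto simp: energy_def sol_v0[OF \<phi>(2)])
    then have R0: "R > 0" using R by simp
    obtain k1 where k1: "\<And>k x. k \<ge> k1 \<Longrightarrow> x \<in> {0..R} \<Longrightarrow> u (\<phi> k) x > 0"
      using loc_unif_positive[OF \<phi>(3) continuous_on_subset[OF sol_continuous_u[OF \<phi>(2)]], of R] R(1,3) by auto
    have "(\<lambda>k. energy g (u (\<phi> k)) (v (\<phi> k)) R) \<longlonglongrightarrow> energy g f f' R"
      unfolding energy_def
      by (intro tendsto_intros \<phi>(4)[OF R0] isCont_tendsto_compose[OF F_isCont] loc_unif_pointwise[OF \<phi>(3), of R]) (use R in auto)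
    from order_tendstoD(2)[OF this R(2)]
    obtain k2 where k2: "\<And>k. k \<ge> k2 \<Longrightarrow> energy g (u (\<phi> k)) (v (\<phi> k)) R < 0"
      unfolding eventually_sequentially by blast
    let ?k = "max k1 k2"
    have "trapped g (u (\<phi> ?k)) (v (\<phi> ?k))" unfolding trapped_def using k1[of ?k] k2[of ?k] R(1) by force
    from trapped_pos[OF uv(1) this] uv(4)[of "\<phi> ?k"] show False by force
  qed
  obtain w where w: "radial_ground_state N g w" "w 0 = f 0"
    using trichotomy[OF \<phi>(2) f0\<beta> fnn nt] by blast
  have "f 0 \<noteq> p" using p[OF \<phi>(2)] nt by blast
  moreover have "f 0 \<noteq> q" using q[OF \<phi>(2)] fnn by force
  ultimately show ?thesis using that w f0 by metis
qed

end

section \<open>Crossing solutions under (GST)\<close>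

context well
begin

lemma F_ge: "prim g s \<ge> prim g b"
proof -
  have "prim g b \<le> 0" using F_neg[of b] b_pos \<beta>_gt by simp
  then show ?thesis
    using F_mono[of b s] F_anti[of s b] by (cases "s \<le> 0"; cases "s \<le> b"; cases "s = b") auto
qed

lemma F_le: assumes "s \<le> c" "c \<ge> \<beta>" shows "prim g s \<le> prim g c"
proof (cases "s > b")
  case True
  then show ?thesis using F_mono[of s c] assms by (cases "s = c") auto
next
  case False
  have "prim g s \<le> 0" using F_neg[of s] False \<beta>_gt by (cases "s \<le> 0") auto
  also have "0 \<le> prim g c" using F_pos[of c] prim_\<beta> assms by (cases "c = \<beta>") auto
  finally show ?thesis .
qed

text \<open>If the energy stayed above \<kappa>, the solution would keep decreasing, and below
  \<beta> its speed would exceed \<open>sqrt (2 * \<kappa>)\<close>, driving it below 0. Until the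
  energy reaches \<kappa> there is no turning point, since turning happens only where the potential
  is at most 0.\<close>

lemma energy_descent:
  assumes s: "sol N g u v" and u0: "u 0 > \<beta>" and nn: "\<And>r. r \<ge> 0 \<Longrightarrow> u r \<ge> 0" and k: "0 < \<kappa>" "\<kappa> < prim g (u 0)"
  obtains R where "R > 0" "energy g u v R = \<kappa>" "\<And>r. 0 < r \<Longrightarrow> r \<le> R \<Longrightarrow> v r < 0"
proof -
  have "\<exists>R\<ge>0. energy g u v R \<le> \<kappa>"
  proof (rule ccontr)
    assume "\<not> ?thesis"
    then have E: "energy g u v r > \<kappa>" if "r \<ge> 0" for r using that by force
    have nt: "\<not> trapped g u v" unfolding trapped_def using E k by force
    have pos: "u r > 0" if "r \<ge> 0" for r
    proof (rule ccontr)
      assume "\<not> u r > 0"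
      then have ur: "u r = 0" using nn[OF that] by simp
      then have r: "r > 0" using that u0 \<beta>_gt b_pos by (cases "r = 0") auto
      have "v r = 0" by (rule DERIV_local_min[OF sol_deriv_u[OF s r], of r]) (use r ur nn in auto)
      then show False using E[OF that] k ur by (simp add: energy_def)
    qed
    have neg: "v r < 0" if "r > 0" for r
      by (rule not_trapped_dec(1)[OF s u0 nt that]) (use pos in auto)
    obtain r0 where r0: "r0 \<ge> 0" "u r0 < b" using becomes_small[OF s u0 _ b_pos] E k by (metis less_imp_le less_trans)
    have "v r \<le> - sqrt (2 * \<kappa>)" if r: "r > r0" for r
    proof -
      have "u r < u r0" by (rule strict_dec[OF s]) (use r r0 neg in auto)
      then have "prim g (u r) < 0" using F_neg[of "u r"] pos[of r] r r0 \<beta>_gt by simp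
      then have "2 * \<kappa> \<le> (v r)\<^sup>2" using E[of r] r r0 by (simp add: energy_def)
      then have "sqrt (2 * \<kappa>) \<le> \<bar>v r\<bar>" using real_le_rsqrt real_sqrt_le_mono by fastforce
      with neg[of r] r r0 show ?thesis by simp
    qed
    then show False
      using decreasing_escape[of r0 u v "sqrt (2 * \<kappa>)"] sol_deriv_u[OF s] nn r0 k by auto
  qed
  then obtain R' where R': "R' \<ge> 0" "energy g u v R' \<le> \<kappa>" by blast
  have E0: "energy g u v 0 = prim g (u 0)" by (simp add: energy_def sol_v0[OF s])
  obtain R where R: "0 < R" "R \<le> R'" "\<kappa> - energy g u v R = 0" "\<And>x. 0 \<le> x \<Longrightarrow> x < R \<Longrightarrow> \<kappa> - energy g u v x < 0"
    by (rule first_zero[of 0 R' "\<lambda>r. \<kappa> - energy g u v r"])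
       (use R' k E0 in \<open>auto intro!: continuous_intros continuous_on_subset[OF energy_cont[OF s]]\<close>)
  have "v r < 0" if r: "0 < r" "r \<le> R" for r
  proof (rule ccontr)
    assume "\<not> v r < 0"
    then have "v r \<ge> 0" by simp
    then obtain t where t: "0 < t" "t \<le> r" "v t = 0" "\<And>x. 0 < x \<Longrightarrow> x < t \<Longrightarrow> v x < 0"
      using first_turning[OF s less_trans[OF \<beta>_gt u0] r(1)] by blast
    have "energy g u v t \<ge> \<kappa>" using R(3) R(4)[of t] t(1,2) r by (cases "t = R") auto
    then have "prim g (u t) > 0" using k t(3) by (simp add: energy_def)
    then have "u t > \<beta>" using F_nonneg_imp[of "u t"] prim_\<beta> by (cases "u t > 0"; cases "u t = \<beta>") auto
    with turning_level[OF s t(1,3,4)] \<beta>_gt show False by simp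
  qed
  with R(1,3) that[of R] show ?thesis by simp
qed

section \<open>The Pohozaev functional\<close>

text \<open>The function \<open>Q\<close> of condition (GST).\<close>

definition poho_density :: "real \<Rightarrow> real" where
  "poho_density s = 2 * real N * prim g s - (real N - 2) * s * g s"

text \<open>The mass is kept as one factor, so that \<open>sol_mass_deriv\<close> and
  \<open>sol_mass_continuous\<close> give derivative and continuity up to the origin
  directly.\<close>

definition pohozaev :: "(real \<Rightarrow> real) \<Rightarrow> (real \<Rightarrow> real) \<Rightarrow> real \<Rightarrow> real" where
  "pohozaev u v r = r ^ N * ((v r)\<^sup>2 + 2 * prim g (u r)) + (real N - 2) * ((r ^ (N-1) * v r) * u r)"

lemma pohozaev_deriv:
  assumes s: "sol N g u v" and r: "r > 0"
  shows "(pohozaev u v has_real_derivative r ^ (N-1) * poho_density (u r)) (at r)"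
proof -
  have rN: "r ^ N = r * r ^ (N-1)" using N by (simp add: power_eq_if)
  have "(pohozaev u v has_real_derivative
     ((real N * r ^ (N-1)) * ((v r)\<^sup>2 + 2 * prim g (u r)) + (- 2 * (real N - 1) / r * (v r)\<^sup>2) * r ^ N)
     + (real N - 2) * ((- (r ^ (N-1) * g (u r))) * u r + v r * (r ^ (N-1) * v r))) (at r)"
    unfolding pohozaev_def[abs_def]
    by (intro DERIV_add DERIV_mult[OF DERIV_pow_N kinetic_deriv[OF s r]] DERIV_cmult
        DERIV_mult[OF sol_mass_deriv[OF s r N] sol_deriv_u[OF s r]])
  moreover have "((real N * r ^ (N-1)) * ((v r)\<^sup>2 + 2 * prim g (u r)) + (- 2 * (real N - 1) / r * (v r)\<^sup>2) * r ^ N)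
     + (real N - 2) * ((- (r ^ (N-1) * g (u r))) * u r + v r * (r ^ (N-1) * v r)) = r ^ (N-1) * poho_density (u r)"
    unfolding rN poho_density_def using r by (simp add: field_simps power2_eq_square)
  ultimately show ?thesis by simp
qed

lemma pohozaev_cont:
  assumes s: "sol N g u v" shows "continuous_on {0..} (pohozaev u v)"
  unfolding pohozaev_def[abs_def]
  by (intro continuous_intros sol_mass_continuous[OF s g_cont N] sol_continuous_u[OF s] sol_continuous_v[OF s g_cont N]
      continuous_on_compose2[OF F_cont[of UNIV]]) auto

lemma pohozaev_grow:
  assumes s: "sol N g u v" and ab: "0 \<le> x" "x \<le> y" and low: "\<And>r. x < r \<Longrightarrow> r < y \<Longrightarrow> poho_density (u r) \<ge> c"
  shows "pohozaev u v y - pohozaev u v x \<ge> c * (y ^ N - x ^ N) / N"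
proof -
  have "pohozaev u v x - c / N * x ^ N \<le> pohozaev u v y - c / N * y ^ N"
  proof (rule DERIV_nonneg_imp_increasing_open[OF ab(2)])
    fix r assume r: "x < r" "r < y"
    have "((\<lambda>r. pohozaev u v r - c / N * r ^ N) has_real_derivative r ^ (N-1) * poho_density (u r) - c / N * (real N * r ^ (N-1))) (at r)"
      by (intro DERIV_diff DERIV_cmult pohozaev_deriv[OF s] DERIV_pow_N) (use r ab in auto)
    moreover have "r ^ (N-1) * poho_density (u r) - c / N * (real N * r ^ (N-1)) = r ^ (N-1) * (poho_density (u r) - c)"
      using N by (simp add: algebra_simps)
    moreover have "\<dots> \<ge> 0" using low[OF r] r ab by simp
    ultimately show "\<exists>z. ((\<lambda>r. pohozaev u v r - c / N * r ^ N) has_real_derivative z) (at r) \<and> z \<ge> 0" by metis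
  qed (intro continuous_intros continuous_on_subset[OF pohozaev_cont[OF s]], use ab in auto)
  then show ?thesis by (simp add: right_diff_distrib diff_divide_distrib)
qed

lemma poho_density_cont: "continuous_on A poho_density"
  unfolding poho_density_def[abs_def] by (intro continuous_intros F_cont continuous_on_subset[OF g_cont]) auto

lemma pohozaev_initial: "pohozaev u v 0 = 0"
  using N by (simp add: pohozaev_def power_0_left)

text \<open>While \<open>u\<close> descends from \<open>s\<close> to \<open>\<theta> s\<close> the Pohozaev functional already picks up the quantity of condition (GST).\<close>
lemma pohozaev_first_descent:
  assumes s: "sol N g u v" and u0: "u 0 = s" and \<theta>: "0 < \<theta>" "\<theta> < 1" "b < \<theta> * s"
    and r: "r > 0" "u r = \<theta> * s" "\<And>x. 0 \<le> x \<Longrightarrow> x < r \<Longrightarrow> u x > \<theta> * s"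
    and poho_density: "\<And>t. \<theta> * s \<le> t \<Longrightarrow> t \<le> s \<Longrightarrow> poho_density t > 0"
    and M: "\<And>s1 s2. s1 \<in> {\<theta> * s..s} \<Longrightarrow> s2 \<in> {\<theta> * s..s} \<Longrightarrow> poho_density s2 * (s / g s1) powr (real N / 2) \<ge> M" "M \<ge> 0"
  shows "pohozaev u v r \<ge> (2 * real N * (1 - \<theta>)) powr (real N / 2) * M / N"
proof -
  have s0: "s > b" "s > 0" using \<theta> u0 r(3)[of 0] r(1) b_pos by auto
  have le: "\<theta> * s \<le> s" using \<theta> s0 by simp
  have rng: "u t \<in> {\<theta> * s..s}" if "0 \<le> t" "t \<le> r" for t
    using sol_le_initial[OF s, of t] u0 s0 r(2,3) that by (cases "t = r") force+
  \<comment> \<open>\<open>s1\<close> controls the speed from above and \<open>s2\<close> the growth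
    of the functional from below; (GST) bounds the product for every such pair, in particular for
    these extremal points.\<close>
  obtain s1 where s1: "s1 \<in> {\<theta> * s..s}" "\<And>t. t \<in> {\<theta> * s..s} \<Longrightarrow> g t \<le> g s1"
    using continuous_attains_sup[of "{\<theta> * s..s}" g] le continuous_on_subset[OF g_cont] by auto
  obtain s2 where s2: "s2 \<in> {\<theta> * s..s}" "\<And>t. t \<in> {\<theta> * s..s} \<Longrightarrow> poho_density s2 \<le> poho_density t"
    using continuous_attains_inf[of "{\<theta> * s..s}" poho_density] le poho_density_cont by auto
  have g1: "g s1 > 0" using g_pos[of s1] s1(1) \<theta> by simp
  have "u 0 + g s1 / (2 * real N) * 0\<^sup>2 \<le> u r + g s1 / (2 * real N) * r\<^sup>2"
  proof (rule DERIV_nonneg_imp_increasing_open[where f = "\<lambda>r. u r + g s1 / (2 * real N) * r\<^sup>2"])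
    fix x assume x: "0 < x" "x < r"
    have "((\<lambda>r. u r + g s1 / (2 * real N) * r\<^sup>2) has_real_derivative v x + g s1 / (2 * real N) * (2 * x)) (at x)"
      using DERIV_pow[of 2 x] by (intro DERIV_add DERIV_cmult sol_deriv_u[OF s x(1)]) simp
    moreover have "v x \<ge> - g s1 * x / N"
      by (rule sol_slope_ge[OF s g_cont N]) (use x s1(2)[OF rng] in auto)
    then have "v x + g s1 / (2 * real N) * (2 * x) \<ge> 0" using N by (simp add: field_simps)
    ultimately show "\<exists>y. ((\<lambda>r. u r + g s1 / (2 * real N) * r\<^sup>2) has_real_derivative y) (at x) \<and> y \<ge> 0" by blast
  qed (use r N in \<open>auto intro!: continuous_intros continuous_on_subset[OF sol_continuous_u[OF s]]\<close>)
  \<comment> \<open>The descent from \<open>s\<close> to \<open>\<theta> * s\<close> takes at least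
    this long, since the speed is at most \<open>g s1 * r / N\<close>. Raising to the power
    \<open>N / 2\<close> gives \<open>r ^ N\<close>, the weight with which the functional
    grows.\<close>
  then have "2 * real N * (1 - \<theta>) * s \<le> g s1 * r\<^sup>2" using r(2) u0 N by (simp add: field_simps)
  then have r2: "2 * real N * (1 - \<theta>) * (s / g s1) \<le> r\<^sup>2" using g1 by (simp add: field_simps)
  have "(2 * real N * (1 - \<theta>) * (s / g s1)) powr (real N / 2) \<le> (r\<^sup>2) powr (real N / 2)"
    using r2 \<theta> s0 g1 by (intro powr_mono2) simp_all
  also have "(r\<^sup>2) powr (real N / 2) = r ^ N"
  proof -
    have "r\<^sup>2 = r powr 2" using r(1) by simp
    then show ?thesis using r(1) by (simp only: powr_powr) (simp add: powr_realpow)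
  qed
  finally have rN: "(2 * real N * (1 - \<theta>)) powr (real N / 2) * (s / g s1) powr (real N / 2) \<le> r ^ N"
    using powr_mult[of "2 * real N * (1 - \<theta>)" "s / g s1" "real N / 2"] \<theta> s0 g1 by simp
  have Q2: "poho_density s2 > 0" using poho_density s2(1) by simp
  have "(2 * real N * (1 - \<theta>)) powr (real N / 2) * M \<le>
    (2 * real N * (1 - \<theta>)) powr (real N / 2) * (poho_density s2 * (s / g s1) powr (real N / 2))"
    using M(1)[OF s1(1) s2(1)] by (intro mult_left_mono) auto
  also have "\<dots> \<le> poho_density s2 * r ^ N" using mult_left_mono[OF rN, of "poho_density s2"] Q2 by (simp add: mult_ac)
  finally have "(2 * real N * (1 - \<theta>)) powr (real N / 2) * M / N \<le> poho_density s2 * r ^ N / N" by (rule divide_right_mono) simp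
  also have "\<dots> \<le> pohozaev u v r"
    using pohozaev_grow[OF s order_refl less_imp_le[OF r(1)], of "poho_density s2"] s2(2)[OF rng] N
    by (simp add: pohozaev_initial power_0_left)
  finally show ?thesis .
qed

text \<open>A nonnegative solution from a suitable large \<open>s\<close> is examined at the radius
  \<open>rb\<close> where it reaches \<open>bb\<close>. If \<open>rb\<close> is large, damping is
  too weak to use up the energy on the remaining way down. If \<open>rb\<close> is bounded, the
  large value of the Pohozaev functional means large energy, and the solution falls from
  \<open>bb\<close> below 0 within one unit of radius.\<close>

theorem gst_crossing:
  assumes gst: "GST N \<beta> g"
  obtains D where "D > S" "\<And>u v. sol N g u v \<Longrightarrow> u 0 = D \<Longrightarrow> \<exists>r\<ge>0. u r < 0"
proof -
  obtain bb \<theta> where bb: "bb > \<beta>" and \<theta>: "0 < \<theta>" "\<theta> < 1" and Qpos: "\<And>s. s > bb \<Longrightarrow> poho_density s > 0"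
    and sup: "\<And>M S. \<exists>s>S. \<forall>s1\<in>{\<theta> * s .. s}. \<forall>s2\<in>{\<theta> * s .. s}. poho_density s2 * (s / g s1) powr (real N / 2) \<ge> M"
    using gst unfolding GST_def Let_def poho_density_def by blast
  have bb0: "bb > 0" "bb > b" using bb \<beta>_gt b_pos by auto
  define E0 where "E0 = prim g bb"
  define \<Phi> where "\<Phi> = - prim g b"
  have E0: "E0 > 0" unfolding E0_def by (rule F_pos[OF bb])
  have \<Phi>: "\<Phi> \<ge> 0" unfolding \<Phi>_def using F_neg[of b] b_pos \<beta>_gt by simp
  \<comment> \<open>Chosen so that beyond \<open>R0\<close> the loss \<open>l * bb\<close> is at
    most \<open>Eb / 4\<close>; the last factor comes from \<open>V \<le> 1 + 2 * (Eb + \<Phi>)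
    \<le> Eb * ((1 + 2 * \<Phi> + 2 * E0) / E0)\<close>.\<close>
  define R0 where "R0 = 4 * (real N - 1) * bb * (1 + 2 * \<Phi> + 2 * E0) / E0"
  have R0: "R0 > 0" unfolding R0_def using N bb0 \<Phi> E0 by (intro divide_pos_pos mult_pos_pos add_pos_nonneg) auto
  obtain C where C: "C \<ge> 0" "\<And>s. 0 \<le> s \<Longrightarrow> s \<le> bb \<Longrightarrow> poho_density s \<ge> - C"
  proof -
    have "{0..bb} \<noteq> {}" using bb0 by simp
    then obtain x where "\<And>y. y \<in> {0..bb} \<Longrightarrow> poho_density x \<le> poho_density y"
      using continuous_attains_inf[of "{0..bb}" poho_density] poho_density_cont by blast
    then show thesis using that[of "\<bar>poho_density x\<bar>"] by force
  qed
  define R1 where "R1 = R0 + 1"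
  have R1: "R1 \<ge> 1" using R0 by (simp add: R1_def)
  \<comment> \<open>A value \<open>Z\<close> of the functional at a radius up to
    \<open>R1 = R0 + 1\<close> forces the energy bound of \<open>E_low\<close>; \<open>M0\<close>
    adds what the functional can lose below level \<open>bb\<close>, where its density may be
    negative.\<close>
  define Z where "Z = 2 * R1 ^ N * (E0 + (bb + 1)\<^sup>2 / 2 + 1)"
  define M0 where "M0 = Z + C * R1 ^ N"
  define c where "c = (2 * real N * (1 - \<theta>)) powr (real N / 2)"
  have c: "c > 0" unfolding c_def using N \<theta> by simp
  have Z: "Z \<ge> 0" unfolding Z_def using R1 E0 by (intro mult_nonneg_nonneg add_nonneg_nonneg) auto
  have M0: "M0 \<ge> 0" unfolding M0_def using Z C R1 by simp
  obtain s where s: "s > max S (bb / \<theta>)"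
     "\<And>s1 s2. s1 \<in> {\<theta> * s..s} \<Longrightarrow> s2 \<in> {\<theta> * s..s} \<Longrightarrow> poho_density s2 * (s / g s1) powr (real N / 2) \<ge> real N * M0 / c"
    using sup[of "max S (bb / \<theta>)" "real N * M0 / c"] by blast
  have \<theta>s: "\<theta> * s > bb" using s(1) \<theta> by (simp add: field_simps)
  have sbb: "s > bb"
  proof -
    have "s > 0" using zero_less_mult_pos[of \<theta> s] \<theta>s bb0 \<theta> by simp
    then have "\<theta> * s < s" using \<theta> by simp
    then show ?thesis using \<theta>s by simp
  qed
  have "\<exists>r\<ge>0. u r < 0" if sl: "sol N g u v" and u0: "u 0 = s" for u v
  proof (rule ccontr)
    assume "\<not> ?thesis"
    then have nn: "u r \<ge> 0" if "r \<ge> 0" for r using that by (meson not_less)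
    have u0\<beta>: "u 0 > \<beta>" using u0 sbb bb by simp
    have \<theta>s1: "\<theta> * s < s" using \<theta> sbb bb0 by simp
    obtain rt where rt: "rt > 0" "u rt = \<theta> * s" "\<And>x. 0 \<le> x \<Longrightarrow> x < rt \<Longrightarrow> u x > \<theta> * s"
    proof -
      have "b < \<theta> * s" "\<theta> * s < u 0" using \<theta>s bb0 \<theta>s1 u0 by auto
      then show thesis by (rule reach[OF sl]) (rule that)
    qed
    obtain rb where rb: "rb > 0" "u rb = bb" "\<And>x. 0 \<le> x \<Longrightarrow> x < rb \<Longrightarrow> u x > bb"
    proof -
      have "bb < u 0" using sbb u0 by simp
      then show thesis by (rule reach[OF sl bb0(2)]) (rule that)
    qed
    have rtb: "rt \<le> rb"
    proof (rule ccontr)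
      assume "\<not> rt \<le> rb"
      then have "u rb > \<theta> * s" using rt(3)[of rb] rb(1) by simp
      then show False using rb(2) \<theta>s by simp
    qed
    have "c * (real N * M0 / c) / N \<le> pohozaev u v rt"
      by (rule pohozaev_first_descent[OF sl u0 \<theta> _ rt, folded c_def])
         (use \<theta>s bb0 Qpos s(2) M0 c in auto)
    then have "M0 \<le> pohozaev u v rt" using c N by simp
    also have "\<dots> \<le> pohozaev u v rb"
      using pohozaev_grow[OF sl _ rtb, of 0] rt(1) less_imp_le[OF Qpos[OF rb(3)]] by simp
    finally have e_rb: "M0 \<le> pohozaev u v rb" .
    \<comment> \<open>At levels from \<open>bb\<close> upwards the energy is at least
      \<open>E0\<close>, so the radius at which it has fallen to \<open>E0 / 2\<close> lies beyond
      \<open>rb\<close>.\<close>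
    have "E0 / 2 < prim g (u 0)" using F_mono[of bb s] sbb bb0 E0 u0 by (simp add: E0_def)
    then obtain R where R: "R > 0" "energy g u v R = E0 / 2" "\<And>r. 0 < r \<Longrightarrow> r \<le> R \<Longrightarrow> v r < 0"
      using energy_descent[OF sl u0\<beta> nn, of "E0/2"] E0 by auto
    have uR: "u R < bb"
    proof (rule ccontr)
      assume "\<not> u R < bb"
      then have "E0 \<le> prim g (u R)" unfolding E0_def using F_le[of bb "u R"] bb by simp
      also have "\<dots> \<le> energy g u v R" by (rule F_le_energy)
      finally show False using R(2) E0 by simp
    qed
    have rbR: "rb < R"
    proof (rule ccontr)
      assume "\<not> rb < R"
      then have "u R \<ge> bb" using rb(2) rb(3)[of R] R(1) by (cases "R = rb") auto
      with uR show False by simp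
    qed
    have ule: "u r \<le> bb" if "rb \<le> r" "r \<le> R" for r
      using strict_dec[OF sl, of rb r] R(3) rb(1,2) that by (cases "r = rb") force+
    define Eb where "Eb = energy g u v rb"
    have Eb: "Eb \<ge> E0" unfolding Eb_def E0_def using F_le_energy[of u rb v] rb(2) by simp
    show False
    proof (cases "rb \<ge> R0")
      case True
      define V where "V = sqrt (2 * (Eb + \<Phi>))"
      define l where "l = (real N - 1) * V / rb"
      have V0: "V \<ge> 0" using Eb E0 \<Phi> by (simp add: V_def)
      have vV: "\<bar>v r\<bar> \<le> V" if "rb \<le> r" for r
      proof -
        have "(v r)\<^sup>2 = 2 * (energy g u v r - prim g (u r))" by (simp add: energy_def)
        also have "\<dots> \<le> 2 * (Eb + \<Phi>)"
          using energy_anti[OF sl _ that] rb(1) F_ge[of "u r"] by (simp add: Eb_def \<Phi>_def)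
        finally show ?thesis unfolding V_def using real_sqrt_le_mono by fastforce
      qed
      \<comment> \<open>Energy is lost at rate \<open>(N - 1) / r * v^2\<close>, at most
        \<open>l * |v|\<close>, so the loss is at most \<open>l\<close> times the drop of
        \<open>u\<close>. This is at most \<open>Eb / 4\<close>, while falling to
        \<open>E0 / 2\<close> costs at least \<open>Eb / 2\<close>.\<close>
      have "Eb - l * u rb \<le> energy g u v R - l * u R"
        unfolding Eb_def
      proof (rule DERIV_nonneg_imp_increasing_open[OF less_imp_le[OF rbR]])
        fix r assume r: "rb < r" "r < R"
        have "((\<lambda>r. energy g u v r - l * u r) has_real_derivative - (real N - 1) / r * (v r)\<^sup>2 - l * v r) (at r)"
          by (intro DERIV_diff DERIV_cmult energy_deriv[OF sl] sol_deriv_u[OF sl]) (use r rb in auto)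
        moreover have "- (real N - 1) / r * (v r)\<^sup>2 - l * v r = (- v r) * (l - (real N - 1) * (- v r) / r)"
          by (simp add: power2_eq_square algebra_simps diff_divide_distrib)
        moreover have "(real N - 1) * (- v r) / r \<le> l"
          unfolding l_def using vV[of r] r rb(1) N V0 by (intro frac_le mult_left_mono mult_nonneg_nonneg) auto
        then have "(- v r) * (l - (real N - 1) * (- v r) / r) \<ge> 0"
          using R(3)[of r] r rb(1) by (intro mult_nonneg_nonneg) auto
        ultimately show "\<exists>y. ((\<lambda>r. energy g u v r - l * u r) has_real_derivative y) (at r) \<and> y \<ge> 0" by metis
      qed (intro continuous_intros continuous_on_subset[OF energy_cont[OF sl]] continuous_on_subset[OF sol_continuous_u[OF sl]], use rb in auto)
      moreover have l0: "l \<ge> 0" unfolding l_def using N V0 rb(1) by simp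
      then have "l * u R \<ge> 0" using nn[of R] R(1) by simp
      moreover have "l * bb \<le> Eb / 4"
      proof -
        have "V \<le> 1 + 2 * (Eb + \<Phi>)"
          unfolding V_def by (rule real_le_lsqrt) (use Eb E0 \<Phi> in \<open>auto simp: power2_eq_square algebra_simps intro!: add_nonneg_nonneg\<close>)
        also have "\<dots> \<le> Eb * ((1 + 2 * \<Phi> + 2 * E0) / E0)"
        proof -
          have "(1 + 2 * \<Phi>) * E0 \<le> (1 + 2 * \<Phi>) * Eb" using Eb \<Phi> by (intro mult_left_mono) auto
          then show ?thesis using E0 by (simp add: field_simps)
        qed
        finally have "(real N - 1) * bb * V \<le> (real N - 1) * bb * (Eb * ((1 + 2 * \<Phi> + 2 * E0) / E0))"
          using N bb0 by (intro mult_left_mono) auto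
        also have "\<dots> = Eb / 4 * R0"
        proof -
          have "x * y * (e * (z / w)) = e / 4 * (4 * x * y * z / w)" for x y e z w :: real by simp
          then show ?thesis unfolding R0_def .
        qed
        also have "\<dots> \<le> Eb / 4 * rb" using True Eb E0 by (intro mult_left_mono) auto
        finally show ?thesis unfolding l_def using rb(1) by (simp add: field_simps)
      qed
      ultimately show False using rb(2) R(2) Eb E0 by simp
    next
      case False
      have E_low: "energy g u v r \<ge> E0 + (bb + 1)\<^sup>2 / 2 + 1" if r: "rb \<le> r" "r \<le> R" "r \<le> rb + 1" for r
      proof -
        have r0: "r > 0" "r \<le> R1" using r rb(1) False by (auto simp: R1_def)
        have "pohozaev u v r - pohozaev u v rb \<ge> - C * (r ^ N - rb ^ N) / N"
          by (rule pohozaev_grow[OF sl _ r(1)]) (use rb(1) r ule nn in \<open>auto intro!: C(2)\<close>)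
        moreover have "- C * (r ^ N - rb ^ N) / N \<ge> - (C * R1 ^ N)"
        proof -
          have "r ^ N - rb ^ N \<le> R1 ^ N" using power_mono[of r R1 N] r0 rb(1) zero_le_power[of rb N] by linarith
          then have "C * (r ^ N - rb ^ N) \<le> C * R1 ^ N" using C by (intro mult_left_mono) auto
          moreover have "C * (r ^ N - rb ^ N) / N \<le> C * (r ^ N - rb ^ N)"
          proof -
            have "C * (r ^ N - rb ^ N) \<ge> 0" using C power_mono[of rb r N] r rb(1) by simp
            then show ?thesis using N mult_left_mono[of 1 "real N" "C * (r ^ N - rb ^ N)"] by (simp add: divide_le_eq)
          qed
          ultimately show ?thesis by simp
        qed
        ultimately have "Z \<le> pohozaev u v r" using e_rb by (simp add: M0_def)
        also have "\<dots> = 2 * r ^ N * energy g u v r + (real N - 2) * ((r ^ (N-1) * v r) * u r)"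
          by (simp add: pohozaev_def energy_def algebra_simps)
        also have "\<dots> \<le> 2 * r ^ N * energy g u v r"
        proof -
          have "(r ^ (N-1) * v r) * u r \<le> 0" using R(3)[of r] r r0 nn[of r] by (intro mult_nonpos_nonneg mult_nonneg_nonpos) auto
          then have "(real N - 2) * ((r ^ (N-1) * v r) * u r) \<le> 0" using N by (intro mult_nonneg_nonpos[of "real N - 2"]) auto
          then show ?thesis by simp
        qed
        also have "\<dots> \<le> 2 * R1 ^ N * energy g u v r"
        proof -
          have "energy g u v r \<ge> energy g u v R" by (rule energy_anti[OF sl]) (use r r0 in auto)
          then have "energy g u v r \<ge> 0" using R(2) E0 by simp
          then show ?thesis using power_mono[of r R1 N] r0 by (intro mult_right_mono) auto
        qed
        finally show ?thesis unfolding Z_def using R1 by (simp add: mult_le_cancel_left_pos)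
      qed
      \<comment> \<open>Either the energy has already fallen to \<open>E0 / 2\<close> within one
        unit, against \<open>E_low\<close>, or a slope of at most \<open>- (bb + 1)\<close> persists
        for one unit and carries \<open>u\<close> from \<open>bb\<close> to -1.\<close>
      show False
      proof (cases "R \<le> rb + 1")
        case True
        have "energy g u v R \<ge> E0 + (bb + 1)\<^sup>2 / 2 + 1" by (rule E_low) (use True rbR in auto)
        then show False using R(2) E0 zero_le_power2[of "bb + 1"] by linarith
      next
        case False
        have slope: "v r \<le> - (bb + 1)" if r: "rb \<le> r" "r \<le> rb + 1" for r
        proof -
          have "prim g (u r) \<le> E0" unfolding E0_def by (rule F_le) (use ule r False bb in auto)
          then have "(v r)\<^sup>2 \<ge> (bb + 1)\<^sup>2" using E_low[of r] r False unfolding energy_def by simp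
          then have "(bb + 1)\<^sup>2 \<le> (- v r)\<^sup>2" by simp
          then have "bb + 1 \<le> - v r" by (rule power2_le_imp_le) (use R(3)[of r] r False rb(1) in auto)
          then show ?thesis by simp
        qed
        have "u (rb + 1) + (bb + 1) * (rb + 1) \<le> u rb + (bb + 1) * rb"
        proof (rule DERIV_nonpos_imp_nonincreasing[where f = "\<lambda>r. u r + (bb + 1) * r"])
          fix r assume r: "rb \<le> r" "r \<le> rb + 1"
          have "((\<lambda>r. u r + (bb + 1) * r) has_real_derivative v r + (bb + 1) * 1) (at r)"
            by (intro DERIV_add DERIV_cmult DERIV_ident sol_deriv_u[OF sl]) (use r rb in auto)
          then show "\<exists>y. ((\<lambda>r. u r + (bb + 1) * r) has_real_derivative y) (at r) \<and> y \<le> 0" using slope[OF r] by force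
        qed simp
        then have "u (rb + 1) \<le> -1" using rb(2) by (simp add: algebra_simps)
        then show False using nn[of "rb + 1"] rb(1) by simp
      qed
    qed
  qed
  then show ?thesis using that[of s] s(1) by auto
qed

end

section \<open>The steep part of the nonlinearity\<close>

lemma prim_cong: "(\<And>t. 0 \<le> t \<Longrightarrow> t \<le> s \<Longrightarrow> f t = g t) \<Longrightarrow> prim f s = prim g s"
  unfolding prim_def by (rule integral_cong) auto

text \<open>Constant above \<open>D\<close> and below 0, which makes a continuous \<open>g\<close>
  bounded and uniformly continuous as Tonelli's scheme requires. Solutions of the truncated problem
  starting between \<open>b\<close> and \<open>D\<close> stay at or below \<open>D\<close>, hence
  also solve the original one.\<close>

definition cutoff :: "real \<Rightarrow> (real \<Rightarrow> real) \<Rightarrow> real \<Rightarrow> real" where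
  "cutoff D g s = g (max 0 (min s D))"

context well
begin

lemma cutoff_eq: "s \<le> D \<Longrightarrow> D > 0 \<Longrightarrow> cutoff D g s = g s"
  by (cases "s \<le> 0") (auto simp: cutoff_def g_zero)

lemma well_cong:
  assumes "\<And>s. s \<le> D \<Longrightarrow> h s = g s" "\<And>s. s > D \<Longrightarrow> h s > 0" "continuous_on UNIV h" "D \<ge> \<beta>"
  shows "well N h b \<beta>"
proof
  show "prim h \<beta> = 0" using prim_cong[of \<beta> h g] assms prim_\<beta> by simp
  show "\<exists>e0>0. \<forall>s\<in>{0<..<e0}. h s < 0"
  proof -
    obtain e0 where "e0 > 0" "\<forall>s\<in>{0<..<e0}. g s < 0" using g_neg by blast
    then show ?thesis using assms \<beta>_gt b_pos by (intro exI[of _ "min e0 \<beta>"]) auto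
  qed
  show "h s > 0" if "s > b" for s using assms(1,2)[of s] g_pos[OF that] by (cases "s \<le> D") auto
qed (use N assms g_zero g_nonpos b_pos \<beta>_gt in auto)

lemma cutoff_bounded_well:
  assumes D: "D > \<beta>"
  obtains M where "bounded_well N (cutoff D g) b \<beta> M"
proof -
  have D0: "D > 0" "D > b" using D \<beta>_gt b_pos by auto
  have uc: "uniformly_continuous_on {0..D} g"
    by (rule compact_uniformly_continuous[OF continuous_on_subset[OF g_cont]]) auto
  have uc': "uniformly_continuous_on UNIV (cutoff D g)"
    unfolding uniformly_continuous_on_def
  proof (intro allI impI)
    fix e :: real assume "e > 0"
    then obtain d where d: "d > 0" "\<And>x x'. x\<in>{0..D} \<Longrightarrow> x'\<in>{0..D} \<Longrightarrow> dist x' x < d \<Longrightarrow> dist (g x') (g x) < e"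
      using uc unfolding uniformly_continuous_on_def by metis
    have "dist (cutoff D g x') (cutoff D g x) < e" if "dist x' x < d" for x x'
      unfolding cutoff_def by (rule d(2)) (use that D0 in \<open>auto simp: dist_real_def\<close>)
    then show "\<exists>d>0. \<forall>x\<in>UNIV. \<forall>x'\<in>UNIV. dist x' x < d \<longrightarrow> dist (cutoff D g x') (cutoff D g x) < e" using d(1) by blast
  qed
  have "compact (g ` {0..D})" by (rule compact_continuous_image[OF continuous_on_subset[OF g_cont]]) auto
  then obtain M where "\<forall>x\<in>g ` {0..D}. \<bar>x\<bar> \<le> M" using compact_imp_bounded bounded_iff by (metis real_norm_def)
  then have M: "\<bar>cutoff D g s\<bar> \<le> M" for s unfolding cutoff_def using D0 by auto
  interpret c: well N "cutoff D g" b \<beta>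
    by (rule well_cong[of D])
       (use cutoff_eq D0 D g_pos[of D] uniformly_continuous_imp_continuous[OF uc'] in \<open>auto simp: cutoff_def\<close>)
  have "bounded_well N (cutoff D g) b \<beta> M"
    by unfold_locales (use M uc' N in auto)
  then show ?thesis using that by blast
qed

text \<open>Up to the first turning point \<open>u\<close> decreases; from that point on the energy
  is at most 0, and \<open>u\<close> cannot exceed \<beta> any more.\<close>

lemma sol_stays_below:
  assumes s: "sol N g u v" and u0: "u 0 > b" and xy: "0 \<le> x" "x \<le> y"
  shows "u y \<le> max (u x) \<beta>"
proof (cases "\<exists>t. 0 < t \<and> t \<le> y \<and> v t \<ge> 0")
  case True
  then obtain r where r: "0 < r" "r \<le> y" "v r \<ge> 0" by blast
  obtain t where t: "0 < t" "t \<le> r" "v t = 0" "\<And>x. 0 < x \<Longrightarrow> x < t \<Longrightarrow> v x < 0"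
    using first_turning[OF s u0 r(1,3)] by blast
  have "u t \<le> b" by (rule turning_level[OF s t(1,3,4)])
  then have "energy g u v t \<le> 0" using t(3) F_neg[of "u t"] \<beta>_gt by (cases "u t \<le> 0") (auto simp: energy_def)
  then have "prim g (u y) \<le> 0" using energy_anti[OF s, of t y] F_le_energy[of u y v] t r by simp
  then have "u y \<le> \<beta>" using F_pos[of "u y"] by force
  then show ?thesis by simp
next
  case False
  have "u y \<le> u x"
  proof (cases "x = y")
    case neq: False
    have "v t < 0" if "x < t" "t < y" for t using False xy that by (meson le_less_trans less_imp_le not_le)
    then have "u y < u x" using strict_dec[OF s xy(1)] neq xy(2) by simp
    then show ?thesis by simp
  qed simp
  then show ?thesis by simp
qed

end

text \<open>Used with a \<open>g\<close> that vanishes on the negative axis: extending by zero instead of oddly is invisible to ground states.\<close>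
definition steep :: "(real \<Rightarrow> real) \<Rightarrow> (real \<Rightarrow> real) \<Rightarrow> real \<Rightarrow> real \<Rightarrow> real \<Rightarrow> real \<Rightarrow> real" where
  "steep g f2 \<alpha> eps A s =
     (if s \<le> \<alpha> + eps then g s
      else if s \<le> \<alpha> + 2 * eps then
        g (\<alpha> + eps) + (s - (\<alpha> + eps)) / eps * (A\<^sup>2 * f2 (\<alpha> + 2 * eps) - g (\<alpha> + eps))
      else A\<^sup>2 * f2 s)"

section \<open>Boundary layer of the glued problem\<close>

locale glue = uniq +
  fixes f2 :: "real \<Rightarrow> real" and \<alpha> :: real
  assumes f2_cont: "continuous_on {\<alpha>..} f2" and f2_pos: "s \<ge> \<alpha> \<Longrightarrow> f2 s > 0" and \<alpha>_gt: "\<alpha> > \<beta>"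
begin

abbreviation G :: "real \<Rightarrow> real \<Rightarrow> real \<Rightarrow> real" where "G \<equiv> steep g f2 \<alpha>"

lemma steep_eq: "s \<le> \<alpha> + eps \<Longrightarrow> G eps A s = g s"
  by (simp add: steep_def)

lemma steep_middle:
  assumes "eps > 0" "\<alpha> + eps \<le> s" "s \<le> \<alpha> + 2 * eps"
  shows "G eps A s = g (\<alpha> + eps) + (s - (\<alpha> + eps)) / eps * (A\<^sup>2 * f2 (\<alpha> + 2 * eps) - g (\<alpha> + eps))"
  using assms by (cases "s = \<alpha> + eps") (auto simp: steep_def)

lemma steep_upper:
  assumes "eps > 0" "\<alpha> + 2 * eps \<le> s"
  shows "G eps A s = A\<^sup>2 * f2 s"
  using assms by (cases "s = \<alpha> + 2 * eps") (auto simp: steep_def)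

lemma steep_middle_bounds:
  assumes "eps > 0" "\<alpha> + eps \<le> s" "s \<le> \<alpha> + 2 * eps"
  shows "min (g (\<alpha> + eps)) (A\<^sup>2 * f2 (\<alpha> + 2 * eps)) \<le> G eps A s"
    "G eps A s \<le> max (g (\<alpha> + eps)) (A\<^sup>2 * f2 (\<alpha> + 2 * eps))"
proof -
  define l where "l = (s - (\<alpha> + eps)) / eps"
  have l: "0 \<le> l" "l \<le> 1" using assms by (auto simp: l_def field_simps)
  define x where "x = g (\<alpha> + eps)" define y where "y = A\<^sup>2 * f2 (\<alpha> + 2 * eps)"
  have e: "G eps A s = (1 - l) * x + l * y"
    unfolding steep_middle[OF assms] l_def[symmetric] x_def[symmetric] y_def[symmetric] by (simp add: algebra_simps)
  have "(1 - l) * min x y + l * min x y \<le> (1 - l) * x + l * y"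
    using l by (intro add_mono mult_left_mono) auto
  moreover have "(1 - l) * x + l * y \<le> (1 - l) * max x y + l * max x y"
    using l by (intro add_mono mult_left_mono) auto
  ultimately show "min (g (\<alpha> + eps)) (A\<^sup>2 * f2 (\<alpha> + 2 * eps)) \<le> G eps A s"
    "G eps A s \<le> max (g (\<alpha> + eps)) (A\<^sup>2 * f2 (\<alpha> + 2 * eps))"
    unfolding e x_def[symmetric] y_def[symmetric] by (simp_all add: algebra_simps)
qed

lemma steep_well:
  assumes eps: "eps > 0" and A: "A > 0"
  shows "well N (G eps A) b \<beta>"
proof (rule well_cong[of "\<alpha> + eps"])
  show "G eps A s = g s" if "s \<le> \<alpha> + eps" for s using steep_eq[OF that] .
  show "G eps A s > 0" if s: "s > \<alpha> + eps" for s
  proof (cases "s \<le> \<alpha> + 2 * eps")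
    case True
    have "min (g (\<alpha> + eps)) (A\<^sup>2 * f2 (\<alpha> + 2 * eps)) > 0"
      using g_pos[of "\<alpha> + eps"] f2_pos[of "\<alpha> + 2 * eps"] eps A \<alpha>_gt \<beta>_gt by simp
    then show ?thesis using steep_middle_bounds(1)[OF eps _ True, of A] s by linarith
  next
    case False then show ?thesis using steep_upper[OF eps, of s A] f2_pos[of s] eps A by simp
  qed
  have "continuous_on ({..\<alpha> + eps} \<union> ({\<alpha> + eps..\<alpha> + 2 * eps} \<union> {\<alpha> + 2 * eps..})) (G eps A)"
  proof (intro continuous_on_closed_Un closed_Un)
    show "continuous_on {..\<alpha> + eps} (G eps A)"
      by (rule continuous_on_eq[OF continuous_on_subset[OF g_cont]]) (auto simp: steep_eq)
    have "continuous_on {\<alpha> + eps..\<alpha> + 2 * eps} (\<lambda>s. g (\<alpha> + eps) + (s - (\<alpha> + eps)) / eps * (A\<^sup>2 * f2 (\<alpha> + 2 * eps) - g (\<alpha> + eps)))"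
      by (intro continuous_intros) (use eps in auto)
    then show "continuous_on {\<alpha> + eps..\<alpha> + 2 * eps} (G eps A)"
      by (rule continuous_on_eq) (use steep_middle[OF eps] in auto)
    have "continuous_on {\<alpha> + 2 * eps..} (\<lambda>s. A\<^sup>2 * f2 s)"
      by (intro continuous_intros continuous_on_subset[OF f2_cont]) (use eps in auto)
    then show "continuous_on {\<alpha> + 2 * eps..} (G eps A)"
      by (rule continuous_on_eq) (use steep_upper[OF eps] in auto)
  qed auto
  moreover have "{..\<alpha> + eps} \<union> ({\<alpha> + eps..\<alpha> + 2 * eps} \<union> {\<alpha> + 2 * eps..}) = UNIV" using eps by auto
  ultimately show "continuous_on UNIV (G eps A)" by simp
qed (use eps \<alpha>_gt in auto)

text \<open>Within the time \<open>\<sigma> = O(1/A)\<close> the solution has dropped below \<open>\<alpha>\<close> by an amount independent of \<open>A\<close>; the mass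
  gained in this boundary layer is \<open>O(\<sigma>^(N-2))\<close>, which is negligible because \<open>N > 2\<close>.\<close>
lemma steep_estimates:
  assumes m: "m > 0" "\<And>s. s \<in> {\<alpha>..\<alpha> + 1} \<Longrightarrow> m \<le> f2 s \<and> f2 s \<le> M"
    and K: "\<And>s. s \<le> \<alpha> + 1 \<Longrightarrow> \<bar>g s\<bar> \<le> K"
    and \<eta>: "0 < \<eta>" "\<eta> \<le> 1" "4 * (\<eta> * (M / m)) < \<alpha> - \<beta>"
    and eps: "0 < eps" "4 * eps \<le> \<eta>" "4 * eps \<le> \<eta> * m / (M * 2 ^ (N-1))"
    and A: "A > 0" "K \<le> A\<^sup>2 * m"
    and s: "sol N (G eps A) u v" and u0: "u 0 = \<alpha> + \<eta>"
  obtains \<sigma> where "\<sigma> > 0" "\<sigma>\<^sup>2 \<le> 8 * real N * \<eta> / (A\<^sup>2 * m)"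
    "\<And>r. r \<ge> \<sigma> \<Longrightarrow> u r \<le> max (\<alpha> - \<eta> * m / (2 * (M * 2 ^ (N-1)))) \<beta>"
    "u \<sigma> \<ge> \<alpha> - 4 * (\<eta> * (M / m))"
    "\<And>r. r \<ge> \<sigma> \<Longrightarrow> \<bar>r ^ (N-1) * v r\<bar> \<le> K * r ^ N + 8 * (\<eta> * (M / m)) * \<sigma> ^ (N-2)"
proof -
  interpret G: well N "G eps A" b \<beta> by (rule steep_well[OF eps(1) A(1)])
  define a where "a = A\<^sup>2"
  have a: "a > 0" "K \<le> a * m" using A by (auto simp: a_def)
  have mM: "m \<le> M" "M > 0" using m(2)[of \<alpha>] m(1) by auto
  have ab: "\<alpha> > b" using \<alpha>_gt \<beta>_gt by simp
  have u0b: "u 0 > b" using u0 ab \<eta> by simp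
  have aM: "a * m \<le> a * M" using a mM by simp
  have up: "a * m \<le> G eps A t \<and> G eps A t \<le> a * M" if "\<alpha> + 2 * eps \<le> t" "t \<le> \<alpha> + \<eta>" for t
    using steep_upper[OF eps(1) that(1), of A] m(2)[of t] that eps \<eta> a by (simp add: a_def)
  have abs_all: "\<bar>G eps A t\<bar> \<le> a * M" if "t \<le> \<alpha> + \<eta>" for t
  proof (cases "t \<le> \<alpha> + eps")
    case True
    have "\<bar>g t\<bar> \<le> K" using K[of t] that \<eta> by simp
    then have "\<bar>g t\<bar> \<le> a * M" using a aM by linarith
    then show ?thesis using steep_eq[OF True, of A] by simp
  next
    case False
    show ?thesis
    proof (cases "t \<le> \<alpha> + 2 * eps")
      case True
      have "\<bar>g (\<alpha> + eps)\<bar> \<le> K" using K[of "\<alpha> + eps"] eps \<eta> by simp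
      then have "\<bar>g (\<alpha> + eps)\<bar> \<le> a * M" using a aM by linarith
      moreover have "0 \<le> a * f2 (\<alpha> + 2 * eps)" "a * f2 (\<alpha> + 2 * eps) \<le> a * M"
        using m(2)[of "\<alpha> + 2 * eps"] m(1) eps \<eta> a by (auto intro!: mult_nonneg_nonneg)
      ultimately show ?thesis
        using steep_middle_bounds[OF eps(1) _ True, of A] False unfolding a_def[symmetric]
        by (auto simp: min_def max_def abs_le_iff split: if_splits)
    next
      case False
      then have "\<bar>G eps A t\<bar> = G eps A t" using up[of t] that a m(1) by (smt (verit) mult_pos_pos)
      then show ?thesis using up[of t] False that by simp
    qed
  qed
  have ule: "u r \<le> \<alpha> + \<eta>" if "r \<ge> 0" for r using G.sol_le_initial[OF s _ that] u0 u0b by simp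
  have vabs: "\<bar>v r\<bar> \<le> a * M * r / N" if "r \<ge> 0" for r
    by (rule sol_slope_abs[OF s G.g_cont N that]) (use ule abs_all in auto)
  obtain rb where rb: "rb > 0" "u rb = \<alpha> + 2 * eps" "\<And>x. 0 \<le> x \<Longrightarrow> x < rb \<Longrightarrow> u x > \<alpha> + 2 * eps"
    "\<And>x. 0 < x \<Longrightarrow> x \<le> rb \<Longrightarrow> v x < 0"
  proof -
    have "b < \<alpha> + 2 * eps" "\<alpha> + 2 * eps < u 0" using ab eps u0 \<eta> by auto
    then show thesis by (rule G.reach[OF s]) (rule that)
  qed
  have quad: "u y + c / (2 * real N) * y\<^sup>2 \<le> u x + c / (2 * real N) * x\<^sup>2"
    if xy: "0 \<le> x" "x \<le> y" and sl: "\<And>r. x < r \<Longrightarrow> r < y \<Longrightarrow> v r \<le> - c * r / N" for x y c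
  proof (rule DERIV_nonpos_imp_decreasing_open[OF xy(2), where f = "\<lambda>r. u r + c / (2 * real N) * r\<^sup>2"])
    fix r assume r: "x < r" "r < y"
    have "((\<lambda>r. u r + c / (2 * real N) * r\<^sup>2) has_real_derivative v r + c / (2 * real N) * (2 * r)) (at r)"
      using DERIV_pow[of 2 r] by (intro DERIV_add DERIV_cmult sol_deriv_u[OF s]) (use r xy in auto)
    moreover have "v r + c / (2 * real N) * (2 * r) \<le> 0" using sl[OF r] N by (simp add: field_simps)
    ultimately show "\<exists>z. ((\<lambda>r. u r + c / (2 * real N) * r\<^sup>2) has_real_derivative z) (at r) \<and> z \<le> 0" by blast
  qed (use N xy in \<open>auto intro!: continuous_intros continuous_on_subset[OF sol_continuous_u[OF s]]\<close>)
  have quad2: "u y + c / (2 * real N) * y\<^sup>2 \<ge> u x + c / (2 * real N) * x\<^sup>2"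
    if xy: "0 \<le> x" "x \<le> y" and sl: "\<And>r. x < r \<Longrightarrow> r < y \<Longrightarrow> v r \<ge> - c * r / N" for x y c
  proof (rule DERIV_nonneg_imp_increasing_open[OF xy(2), where f = "\<lambda>r. u r + c / (2 * real N) * r\<^sup>2"])
    fix r assume r: "x < r" "r < y"
    have "((\<lambda>r. u r + c / (2 * real N) * r\<^sup>2) has_real_derivative v r + c / (2 * real N) * (2 * r)) (at r)"
      using DERIV_pow[of 2 r] by (intro DERIV_add DERIV_cmult sol_deriv_u[OF s]) (use r xy in auto)
    moreover have "v r + c / (2 * real N) * (2 * r) \<ge> 0" using sl[OF r] N by (simp add: field_simps)
    ultimately show "\<exists>z. ((\<lambda>r. u r + c / (2 * real N) * r\<^sup>2) has_real_derivative z) (at r) \<and> z \<ge> 0" by blast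
  qed (use N xy in \<open>auto intro!: continuous_intros continuous_on_subset[OF sol_continuous_u[OF s]]\<close>)
  have vlow: "v r \<ge> - (a * M) * r / N" if "r \<ge> 0" for r using vabs[OF that] by (simp add: abs_le_iff)
  have vup: "v r \<le> - (a * m) * r / N" if "0 \<le> r" "r \<le> rb" for r
  proof (rule sol_slope_le[OF s G.g_cont N that(1)])
    fix t assume "0 < t" "t < r"
    then show "G eps A (u t) \<ge> a * m" using up[of "u t"] rb(3)[of t] ule[of t] that by simp
  qed
  have "u rb + a * m / (2 * real N) * rb\<^sup>2 \<le> u 0 + a * m / (2 * real N) * 0\<^sup>2"
    by (rule quad) (use rb(1) vup in auto)
  then have "a * m / (2 * real N) * rb\<^sup>2 \<le> \<eta>" using rb(2) u0 eps by simp
  then have rb_up: "a * m * rb\<^sup>2 \<le> 2 * real N * \<eta>" using N by (simp add: field_simps)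
  have "u rb + a * M / (2 * real N) * rb\<^sup>2 \<ge> u 0 + a * M / (2 * real N) * 0\<^sup>2"
    by (rule quad2) (use rb(1) vlow in auto)
  moreover have "a * M / (2 * real N) * 0\<^sup>2 = 0" by simp
  ultimately have "\<eta> / 2 \<le> a * M / (2 * real N) * rb\<^sup>2" using rb(2) u0 eps(2) by linarith
  then have rb_low: "real N * \<eta> \<le> a * M * rb\<^sup>2" using N by (simp add: field_simps)
  \<comment> \<open>Until \<open>rb\<close> the solution feels the full strength of order
    \<open>A^2\<close>. From \<open>rb\<close> to \<open>2 * rb\<close> the mass still decreases, so
    the slope attained at \<open>rb\<close> is kept up to the factor \<open>2 ^ (N-1)\<close> and
    carries \<open>u\<close> below \<alpha>.\<close>
  define \<sigma> where "\<sigma> = 2 * rb"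
  have \<sigma>: "\<sigma> > 0" "rb \<le> \<sigma>" using rb(1) by (auto simp: \<sigma>_def)
  have "a * m * \<sigma>\<^sup>2 = 4 * (a * m * rb\<^sup>2)" by (simp add: \<sigma>_def power_mult_distrib)
  then have \<sigma>sq: "a * m * \<sigma>\<^sup>2 \<le> 8 * real N * \<eta>" using rb_up by linarith
  have "a * M * \<sigma>\<^sup>2 = (M / m) * (a * m * \<sigma>\<^sup>2)" using m by simp
  also have "\<dots> \<le> (M / m) * (8 * real N * \<eta>)" using \<sigma>sq m mM by (intro mult_left_mono) auto
  finally have aM\<sigma>: "a * M * \<sigma>\<^sup>2 \<le> 8 * real N * (\<eta> * (M / m))" by (simp add: mult_ac)
  have low: "u r \<ge> \<alpha> - 4 * (\<eta> * (M / m))" if "0 \<le> r" "r \<le> \<sigma>" for r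
  proof -
    have "u r + a * M / (2 * real N) * r\<^sup>2 \<ge> u 0 + a * M / (2 * real N) * 0\<^sup>2"
      by (rule quad2) (use that vlow in auto)
    moreover have "a * M / (2 * real N) * r\<^sup>2 \<le> a * M / (2 * real N) * \<sigma>\<^sup>2"
      using that a mM by (intro mult_left_mono power_mono) auto
    moreover have "a * M / (2 * real N) * \<sigma>\<^sup>2 \<le> 4 * (\<eta> * (M / m))" using aM\<sigma> N by (simp add: field_simps)
    ultimately show ?thesis using u0 \<eta> by simp
  qed
  have gtb: "u r > b" if "0 \<le> r" "r \<le> \<sigma>" for r using low[OF that] \<eta> \<beta>_gt by simp
  \<comment> \<open>The drop guaranteed between \<open>rb\<close> and \<sigma>. It starts at
    \<open>\<alpha> + 2 * eps\<close>, and \<open>4 * eps \<le> \<delta>\<close> leaves half of it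
    below \<alpha>.\<close>
  define \<delta> where "\<delta> = \<eta> * m / (M * 2 ^ (N-1))"
  have drop: "u \<sigma> \<le> \<alpha> - \<delta> / 2"
  proof -
    have slope: "v r \<le> - (a * m / N * rb / 2 ^ (N-1))" if r: "rb \<le> r" "r \<le> \<sigma>" for r
    proof -
      have "r ^ (N-1) * v r \<le> rb ^ (N-1) * v rb"
      proof (rule DERIV_nonpos_imp_decreasing_open[OF r(1), where f = "\<lambda>r. r ^ (N-1) * v r"])
        fix x assume x: "rb < x" "x < r"
        have "- (x ^ (N-1) * G eps A (u x)) \<le> 0" using G.g_pos[OF gtb[of x]] x r rb(1) by simp
        then show "\<exists>y. ((\<lambda>r. r ^ (N-1) * v r) has_real_derivative y) (at x) \<and> y \<le> 0"
          using sol_mass_deriv[OF s _ N, of x] x rb(1) by (meson less_trans)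
      qed (rule continuous_on_subset[OF sol_mass_continuous[OF s G.g_cont N]], use rb in auto)
      also have "\<dots> \<le> rb ^ (N-1) * (- (a * m) * rb / N)" using vup[of rb] rb(1) by (intro mult_left_mono) auto
      finally have *: "r ^ (N-1) * v r \<le> - (rb ^ (N-1) * (a * m * rb / N))" by simp
      have vr: "v r < 0" by (rule G.v_neg[OF s]) (use gtb r rb(1) in auto)
      have "r ^ (N-1) \<le> (2 * rb) ^ (N-1)" using r rb(1) by (intro power_mono) (auto simp: \<sigma>_def)
      then have "(2 * rb) ^ (N-1) * v r \<le> r ^ (N-1) * v r" using vr by (simp add: mult_le_cancel_right)
      with * have "rb ^ (N-1) * (2 ^ (N-1) * v r) \<le> rb ^ (N-1) * (- (a * m * rb / N))" by (simp add: power_mult_distrib mult_ac)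
      then have "2 ^ (N-1) * v r \<le> - (a * m * rb / N)" by (rule mult_left_le_imp_le) (use rb(1) in simp)
      then have "v r \<le> - (a * m * rb / N) / 2 ^ (N-1)" by (simp only: pos_le_divide_eq[of "2 ^ (N-1)"] zero_less_power zero_less_numeral mult.commute)
      then show ?thesis by simp
    qed
    define c where "c = a * m / N * rb / 2 ^ (N-1)"
    have "u \<sigma> + c * \<sigma> \<le> u rb + c * rb"
    proof (rule DERIV_nonpos_imp_nonincreasing[OF \<sigma>(2), where f = "\<lambda>r. u r + c * r"])
      fix r assume r: "rb \<le> r" "r \<le> \<sigma>"
      have "((\<lambda>r. u r + c * r) has_real_derivative v r + c * 1) (at r)"
        by (intro DERIV_add DERIV_cmult DERIV_ident sol_deriv_u[OF s]) (use r rb in auto)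
      then show "\<exists>y. ((\<lambda>r. u r + c * r) has_real_derivative y) (at r) \<and> y \<le> 0"
        using slope[OF r] unfolding c_def by force
    qed
    then have "u \<sigma> \<le> \<alpha> + 2 * eps - c * rb" using rb(2) by (simp add: \<sigma>_def algebra_simps)
    moreover have "\<delta> \<le> c * rb"
    proof -
      have "\<delta> = (m / (M * 2 ^ (N-1) * N)) * (real N * \<eta>)" using N by (simp add: \<delta>_def)
      also have "\<dots> \<le> (m / (M * 2 ^ (N-1) * N)) * (a * M * rb\<^sup>2)" using rb_low m mM by (intro mult_left_mono) auto
      also have "\<dots> = c * rb" using mM by (simp add: c_def power2_eq_square mult_ac)
      finally show ?thesis .
    qed
    moreover have "4 * eps \<le> \<delta>" using eps(3) by (simp add: \<delta>_def)
    ultimately show ?thesis by simp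
  qed
  have \<delta>2: "\<delta> / 2 = \<eta> * m / (2 * (M * 2 ^ (N-1)))" by (simp add: \<delta>_def)
  have \<delta>0: "\<delta> > 0" unfolding \<delta>_def using m mM \<eta> by simp
  have below: "u r \<le> max (\<alpha> - \<delta> / 2) \<beta>" if "r \<ge> \<sigma>" for r
    using G.sol_stays_below[OF s u0b _ that] \<sigma> drop by fastforce
  have mass: "\<bar>r ^ (N-1) * v r\<bar> \<le> K * r ^ N + 8 * (\<eta> * (M / m)) * \<sigma> ^ (N-2)" if r: "r \<ge> \<sigma>" for r
  proof -
    have "norm (r ^ (N-1) * v r - \<sigma> ^ (N-1) * v \<sigma>) \<le> (K * r ^ (N-1)) * norm (r - \<sigma>)"
    proof (rule field_differentiable_bound[of "{\<sigma>..r}" "\<lambda>r. r ^ (N-1) * v r"])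
      fix x assume x: "x \<in> {\<sigma>..r}"
      then have x0: "x > 0" using \<sigma> by simp
      show "((\<lambda>r. r ^ (N-1) * v r) has_field_derivative - (x ^ (N-1) * G eps A (u x))) (at x within {\<sigma>..r})"
        by (rule has_field_derivative_at_within[OF sol_mass_deriv[OF s x0 N]])
      have "u x \<le> \<alpha>" using below[of x] x \<delta>0 \<alpha>_gt by simp
      then have "\<bar>G eps A (u x)\<bar> \<le> K" using steep_eq[of "u x" eps A] K[of "u x"] eps by simp
      then show "norm (- (x ^ (N-1) * G eps A (u x))) \<le> K * r ^ (N-1)"
        using mult_mono[OF power_mono[of x r "N-1"], of "\<bar>G eps A (u x)\<bar>" K] x x0 by (simp add: abs_mult mult.commute)
    qed (use r in auto)
    also have "\<dots> \<le> (K * r ^ (N-1)) * r" using K[of \<alpha>] r \<sigma> by (intro mult_left_mono) auto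
    also have "\<dots> = K * r ^ N" using N by (simp add: power_eq_if[of r N] mult_ac)
    finally have 1: "\<bar>r ^ (N-1) * v r - \<sigma> ^ (N-1) * v \<sigma>\<bar> \<le> K * r ^ N" by simp
    have "\<bar>\<sigma> ^ (N-1) * v \<sigma>\<bar> \<le> \<sigma> ^ (N-1) * (a * M * \<sigma> / N)"
      using mult_left_mono[OF vabs[of \<sigma>], of "\<sigma> ^ (N-1)"] \<sigma> by (simp add: abs_mult)
    \<comment> \<open>Two powers of \<sigma> are spent on the factor \<open>A^2\<close>, since
      \<open>a * M * \<sigma>^2\<close> is bounded independently of \<open>A\<close>; the others
      remain small.\<close>
    also have "\<dots> = \<sigma> ^ (N-2) * ((a * M * \<sigma>\<^sup>2) / N)"
    proof -
      have "N - 1 = Suc (N - 2)" using N by simp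
      then have "\<sigma> ^ (N-1) = \<sigma> * \<sigma> ^ (N-2)" by (simp only: power_Suc)
      then show ?thesis by (simp add: power2_eq_square)
    qed
    also have "\<dots> \<le> \<sigma> ^ (N-2) * (8 * (\<eta> * (M / m)))" using aM\<sigma> N \<sigma> by (intro mult_left_mono) (auto simp: field_simps)
    finally have "\<bar>\<sigma> ^ (N-1) * v \<sigma>\<bar> \<le> 8 * (\<eta> * (M / m)) * \<sigma> ^ (N-2)" by (simp only: mult.commute)
    with 1 show ?thesis by linarith
  qed
  have "\<sigma>\<^sup>2 \<le> 8 * real N * \<eta> / (A\<^sup>2 * m)" using \<sigma>sq a m by (simp add: field_simps a_def)
  with that \<sigma>(1) below low[of \<sigma>] mass \<delta>2 show ?thesis by simp
qed

text \<open>Untrapped solutions for \<open>A\<close> tending to infinity are led to a contradiction.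
  The parameters \<open>eps\<close> may vary freely along the sequence, since outside the shrinking
  layer the solutions stay at or below \<alpha>, where the nonlinearity is \<open>g\<close>; hence
  the threshold \<open>Ab\<close> is uniform in \<open>eps\<close>.\<close>

theorem steep_trapped:
  assumes gs: "radial_ground_state N g ua" "ua 0 = \<alpha>"
  obtains \<eta> epsb Ab where "\<eta> > 0" "epsb > 0" "Ab > 0"
    "\<And>eps A u v. 0 < eps \<Longrightarrow> eps < epsb \<Longrightarrow> A > Ab \<Longrightarrow> sol N (G eps A) u v \<Longrightarrow> u 0 = \<alpha> + \<eta> \<Longrightarrow> trapped (G eps A) u v"
proof -
  have \<alpha>0: "\<alpha> > 0" "\<alpha> > b" using \<alpha>_gt \<beta>_gt b_pos by auto
  have f2c: "continuous_on {\<alpha>..\<alpha>+1} f2" by (rule continuous_on_subset[OF f2_cont]) auto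
  have ne: "{\<alpha>..\<alpha>+1} \<noteq> {}" by simp
  obtain x1 where x1: "x1 \<in> {\<alpha>..\<alpha>+1}" "\<And>y. y \<in> {\<alpha>..\<alpha>+1} \<Longrightarrow> f2 x1 \<le> f2 y"
    using continuous_attains_inf[OF compact_Icc ne f2c] by blast
  obtain x2 where x2: "x2 \<in> {\<alpha>..\<alpha>+1}" "\<And>y. y \<in> {\<alpha>..\<alpha>+1} \<Longrightarrow> f2 y \<le> f2 x2"
    using continuous_attains_sup[OF compact_Icc ne f2c] by blast
  define m where "m = f2 x1"
  define M where "M = f2 x2"
  have m: "m > 0" unfolding m_def using f2_pos x1(1) by simp
  have mM: "m \<le> f2 s \<and> f2 s \<le> M" if "s \<in> {\<alpha>..\<alpha>+1}" for s unfolding m_def M_def using x1(2) x2(2) that by blast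
  have M: "M > 0" "m \<le> M" using mM[of \<alpha>] m by auto
  have "compact (g ` {0..\<alpha>+1})" by (rule compact_continuous_image[OF continuous_on_subset[OF g_cont]]) auto
  then obtain K' where K': "\<forall>x\<in>g ` {0..\<alpha>+1}. \<bar>x\<bar> \<le> K'" using compact_imp_bounded bounded_iff by (metis real_norm_def)
  define K where "K = \<bar>K'\<bar> + 1"
  have K0: "K > 0" by (simp add: K_def)
  have K: "\<bar>g s\<bar> \<le> K" if "s \<le> \<alpha> + 1" for s
  proof (cases "s \<ge> 0")
    case True
    then have "\<bar>g s\<bar> \<le> K'" using K' that by auto
    then show ?thesis by (simp add: K_def)
  qed (use g_zero[of s] K0 in simp)
  define \<kappa> where "\<kappa> = M / m"
  have \<kappa>: "\<kappa> > 0" using m M by (simp add: \<kappa>_def)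
  \<comment> \<open>The descent before the limit can start costs
    \<open>4 * (\<eta> * \<kappa>)\<close> up to \<sigma> and
    \<open>C = 8 * (\<eta> * \<kappa>)\<close> from \<sigma> to \<rho>, up to vanishing terms. The
    factor 48 makes the total at most a quarter of \<open>\<alpha> - \<beta>\<close>, so the limit
    starts above \<beta>.\<close>
  define \<eta> where "\<eta> = min 1 ((\<alpha> - \<beta>) / (48 * \<kappa>))"
  have \<eta>: "0 < \<eta>" "\<eta> \<le> 1" using \<kappa> \<alpha>_gt by (auto simp: \<eta>_def)
  have "\<eta> * \<kappa> \<le> (\<alpha> - \<beta>) / (48 * \<kappa>) * \<kappa>" using \<kappa> by (intro mult_right_mono) (auto simp: \<eta>_def)
  then have \<eta>\<kappa>: "12 * (\<eta> * \<kappa>) \<le> (\<alpha> - \<beta>) / 4" "4 * (\<eta> * \<kappa>) < \<alpha> - \<beta>" "\<eta> * \<kappa> > 0" using \<kappa> \<alpha>_gt \<eta> by auto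
  define epsb where "epsb = min (\<eta> / 4) (\<eta> * m / (M * 2 ^ (N-1)) / 4)"
  have epsb: "epsb > 0" using \<eta> m M by (simp add: epsb_def)
  define \<delta> where "\<delta> = \<eta> * m / (2 * (M * 2 ^ (N-1)))"
  have \<delta>: "\<delta> > 0" using \<eta> m M by (simp add: \<delta>_def)
  define S where "S = sqrt (8 * real N * \<eta> / m)"
  have S: "S > 0" "S\<^sup>2 = 8 * real N * \<eta> / m" using N \<eta> m by (auto simp: S_def)
  define C where "C = 8 * (\<eta> * \<kappa>)"
  have C: "C > 0" using \<eta>\<kappa> by (simp add: C_def)
  have "\<exists>Ab>0. \<forall>eps A u v. 0 < eps \<longrightarrow> eps < epsb \<longrightarrow> A > Ab \<longrightarrow> sol N (G eps A) u v \<longrightarrow> u 0 = \<alpha> + \<eta> \<longrightarrow> trapped (G eps A) u v"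
  proof (rule ccontr)
    assume neg: "\<not> ?thesis"
    \<comment> \<open>The summands provide, in turn, divergence of \<open>A\<close>, the bound
      \<open>\<sigma> \<le> 1\<close>, and \<open>K \<le> A^2 * m\<close>.\<close>
    have "\<exists>eps A u v. 0 < eps \<and> eps < epsb \<and> A > real k + 1 + S + sqrt (K / m) \<and> sol N (G eps A) u v \<and> u 0 = \<alpha> + \<eta> \<and> \<not> trapped (G eps A) u v" for k :: nat
    proof -
      have "real k + 1 + S + sqrt (K / m) > 0" using S K0 m by (simp add: add_pos_nonneg)
      with neg show ?thesis by blast
    qed
    then obtain eps A u v where seq: "\<And>k. 0 < eps k" "\<And>k. eps k < epsb" "\<And>k. A k > real k + 1 + S + sqrt (K / m)"
      "\<And>k. sol N (G (eps k) (A k)) (u k) (v k)" "\<And>k. u k 0 = \<alpha> + \<eta>" "\<And>k. \<not> trapped (G (eps k) (A k)) (u k) (v k)"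
      by metis
    have A: "A k > 0" "A k > real k + 1" "A k > S" "K \<le> (A k)\<^sup>2 * m" for k
    proof -
      have sq: "sqrt (K / m) \<ge> 0" using K0 m by simp
      show "A k > 0" "A k > real k + 1" "A k > S" using seq(3)[of k] S sq by linarith+
      have "sqrt (K / m) \<le> A k" using seq(3)[of k] S(1) by linarith
      then have "(sqrt (K / m))\<^sup>2 \<le> (A k)\<^sup>2" using sq by (intro power_mono) auto
      then show "K \<le> (A k)\<^sup>2 * m" using K0 m by (simp add: divide_le_eq)
    qed
    interpret Gk: well N "G (eps k) (A k)" b \<beta> for k by (rule steep_well[OF seq(1) A(1)])
    have eq_low: "G (eps k) (A k) s = g s" if "s \<le> \<alpha>" for k s using steep_eq[of s "eps k" "A k"] that seq(1)[of k] by simp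
    have "\<exists>\<sigma>. \<sigma> > 0 \<and> \<sigma>\<^sup>2 \<le> 8 * real N * \<eta> / ((A k)\<^sup>2 * m) \<and> (\<forall>r\<ge>\<sigma>. u k r \<le> max (\<alpha> - \<delta>) \<beta>) \<and>
      u k \<sigma> \<ge> \<alpha> - 4 * (\<eta> * \<kappa>) \<and> (\<forall>r\<ge>\<sigma>. \<bar>r ^ (N-1) * v k r\<bar> \<le> K * r ^ N + C * \<sigma> ^ (N-2))" for k
    proof (rule steep_estimates[OF m mM K \<eta> _ seq(1)[of k] _ _ A(1,4)[of k] seq(4,5)[of k]])
      show "4 * (\<eta> * (M / m)) < \<alpha> - \<beta>" using \<eta>\<kappa> by (simp add: \<kappa>_def)
      show "4 * eps k \<le> \<eta>" "4 * eps k \<le> \<eta> * m / (M * 2 ^ (N-1))" using seq(2)[of k] by (auto simp: epsb_def)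
    qed (auto simp: \<delta>_def C_def \<kappa>_def)
    then obtain \<sigma> where \<sigma>: "\<And>k. \<sigma> k > 0" "\<And>k. (\<sigma> k)\<^sup>2 \<le> 8 * real N * \<eta> / ((A k)\<^sup>2 * m)"
      "\<And>k r. r \<ge> \<sigma> k \<Longrightarrow> u k r \<le> max (\<alpha> - \<delta>) \<beta>" "\<And>k. u k (\<sigma> k) \<ge> \<alpha> - 4 * (\<eta> * \<kappa>)"
      "\<And>k r. r \<ge> \<sigma> k \<Longrightarrow> \<bar>r ^ (N-1) * v k r\<bar> \<le> K * r ^ N + C * \<sigma> k ^ (N-2)" by metis
    have \<sigma>S: "\<sigma> k \<le> S / A k" for k
    proof (rule power2_le_imp_le)
      show "(\<sigma> k)\<^sup>2 \<le> (S / A k)\<^sup>2" using \<sigma>(2)[of k] by (simp add: power_divide S(2) mult.commute)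
    qed (use S A(1)[of k] in simp)
    have \<sigma>1: "\<sigma> k \<le> 1" for k using \<sigma>S[of k] A(1,3)[of k] S by (smt (verit) divide_le_eq_1)
    have \<sigma>lim: "\<sigma> \<longlonglongrightarrow> 0"
    proof (rule tendsto_sandwich[of "\<lambda>_. 0" _ _ "\<lambda>k. S * (1 / (real k + 1))"])
      have "\<sigma> k \<le> S * (1 / (real k + 1))" for k
      proof -
        have "S / A k \<le> S / (real k + 1)" using A(1,2)[of k] S by (intro divide_left_mono) auto
        with \<sigma>S[of k] show ?thesis by simp
      qed
      then show "\<forall>\<^sub>F k in sequentially. \<sigma> k \<le> S * (1 / (real k + 1))" by simp
      have "(\<lambda>k. S * (1 / (real k + 1))) \<longlonglongrightarrow> S * 0"
        by (intro tendsto_mult tendsto_const) (use LIMSEQ_inverse_real_of_nat in \<open>simp add: inverse_eq_divide add.commute\<close>)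
      then show "(\<lambda>k. S * (1 / (real k + 1))) \<longlonglongrightarrow> 0" by simp
    qed (use \<sigma>(1) in \<open>auto intro!: always_eventually less_imp_le\<close>)
    \<comment> \<open>\<open>\<rho>^N = \<sigma>^(N-2)\<close> balances the two terms of the mass bound, so that \<open>|v r|\<close> is at most a multiple of \<open>r\<close> beyond \<open>\<rho>\<close>.\<close>
    define \<rho> where "\<rho> = (\<lambda>k. \<sigma> k powr ((real N - 2) / real N))"
    have \<rho>pos: "\<rho> k > 0" for k using \<sigma>(1)[of k] by (simp add: \<rho>_def)
    have \<rho>1: "\<rho> k \<le> 1" for k unfolding \<rho>_def using powr_mono2[of "(real N - 2) / real N" "\<sigma> k" 1] \<sigma>(1)[of k] \<sigma>1[of k] N by simp
    have \<rho>\<sigma>: "\<sigma> k \<le> \<rho> k" for k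
      unfolding \<rho>_def using powr_mono'[of "(real N - 2) / real N" 1 "\<sigma> k"] \<sigma>(1)[of k] \<sigma>1[of k] N by simp
    have \<rho>N: "\<rho> k ^ N = \<sigma> k ^ (N-2)" for k
    proof -
      have "\<rho> k ^ N = \<rho> k powr real N" using \<rho>pos[of k] by (simp add: powr_realpow)
      also have "\<dots> = \<sigma> k powr (real N - 2)" unfolding \<rho>_def using N by (simp add: powr_powr)
      also have "\<dots> = \<sigma> k ^ (N-2)" using N \<sigma>(1)[of k] by (simp add: of_nat_diff flip: powr_realpow)
      finally show ?thesis .
    qed
    have \<rho>lim: "\<rho> \<longlonglongrightarrow> 0"
      unfolding \<rho>_def by (rule tendsto_zero_powrI[OF \<sigma>lim tendsto_const]) (use N \<sigma>(1) in \<open>auto intro!: always_eventually less_imp_le\<close>)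
    have rN: "r ^ N = r * r ^ (N-1)" for r :: real using N by (simp add: power_eq_if)
    have vb: "\<bar>v k r\<bar> \<le> (K + C) * r" if r: "r \<ge> \<rho> k" for k r
    proof -
      have r0: "r > 0" using r \<rho>pos[of k] by simp
      have "\<bar>r ^ (N-1) * v k r\<bar> \<le> K * r ^ N + C * \<rho> k ^ N" unfolding \<rho>N using \<sigma>(5)[of k r] r \<rho>\<sigma>[of k] by simp
      also have "\<dots> \<le> K * r ^ N + C * r ^ N" using r \<rho>pos[of k] C by (intro add_left_mono mult_left_mono power_mono) auto
      finally have "r ^ (N-1) * \<bar>v k r\<bar> \<le> r ^ (N-1) * ((K + C) * r)" using r0 by (simp add: rN abs_mult algebra_simps)
      then show ?thesis using r0 by simp
    qed
    have u\<rho>_low: "u k (\<rho> k) + K / 2 * (\<rho> k)\<^sup>2 \<ge> \<alpha> - 12 * (\<eta> * \<kappa>)" for k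
    proof -
      define c where "c = C * \<sigma> k ^ (N-2)"
      \<comment> \<open>The integral of the slope bound \<open>- K * r - c / r ^ (N-1)\<close>. As
        \<open>N > 2\<close>, the second term contributes at most
        \<open>c / ((N - 2) * \<sigma>^(N-2))\<close>, which is \<open>C / (N - 2)\<close> and does
        not depend on \<open>k\<close>.\<close>
      define f where "f = (\<lambda>r. u k r + K / 2 * r\<^sup>2 - c / (real N - 2) * inverse (r ^ (N-2)))"
      have "f (\<sigma> k) \<le> f (\<rho> k)"
      proof (rule DERIV_nonneg_imp_nondecreasing[OF \<rho>\<sigma>])
        fix r assume r: "\<sigma> k \<le> r" "r \<le> \<rho> k"
        then have r0: "r > 0" using \<sigma>(1)[of k] by simp
        obtain l where l: "N = Suc (Suc (Suc l))" using N by (metis Suc_diff_Suc diff_0_eq_0 less_imp_Suc_add numeral_2_eq_2 add_Suc add_Suc_right)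
        have "(f has_real_derivative v k r + K / 2 * (2 * r) - c / (real N - 2) * (- (inverse (r ^ (N-2)) * (real (N-2) * r ^ (N-2-1)) * inverse (r ^ (N-2))))) (at r)"
          unfolding f_def
          by (intro DERIV_diff DERIV_add DERIV_cmult sol_deriv_u[OF seq(4) r0] DERIV_inverse')
             (use r0 DERIV_pow[of 2 r] DERIV_pow[of "N-2" r] in auto)
        moreover have "c / (real N - 2) * (- (inverse (r ^ (N-2)) * (real (N-2) * r ^ (N-2-1)) * inverse (r ^ (N-2)))) = - (c / r ^ (N-1))"
        proof -
          have "c / n * (- (inverse (r * y) * (n * y) * inverse (r * y))) = - (c / (r * (r * y)))" if "n \<noteq> 0" "y \<noteq> 0" for n y :: real
            using r0 that by (simp add: field_simps)
          from this[of "real (N-2)" "r ^ (N-2-1)"] show ?thesis using r0 by (simp add: l)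
        qed
        moreover have "v k r + K * r + c / r ^ (N-1) \<ge> 0"
        proof -
          have "- (r ^ (N-1) * v k r) \<le> K * r ^ N + c" using \<sigma>(5)[OF r(1)] unfolding c_def by linarith
          then have "0 \<le> (v k r + K * r + c / r ^ (N-1)) * r ^ (N-1)" using r0 by (simp add: rN algebra_simps)
          moreover have "r ^ (N-1) > 0" using r0 by simp
          ultimately show ?thesis by (meson mult_neg_pos not_less)
        qed
        ultimately show "\<exists>y. (f has_real_derivative y) (at r) \<and> y \<ge> 0"
          by (intro exI[of _ "v k r + K * r + c / r ^ (N-1)"]) simp
      qed
      moreover have "f (\<sigma> k) \<ge> u k (\<sigma> k) - C"
      proof -
        have "c / (real N - 2) * inverse (\<sigma> k ^ (N-2)) = C / (real N - 2)" using \<sigma>(1)[of k] by (simp add: c_def field_simps)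
        moreover have "\<dots> \<le> C" using C N mult_left_mono[of 1 "real N - 2" C] by (simp add: divide_le_eq)
        moreover have "K / 2 * (\<sigma> k)\<^sup>2 \<ge> 0" using K0 by simp
        ultimately show ?thesis unfolding f_def by linarith
      qed
      moreover have "f (\<rho> k) \<le> u k (\<rho> k) + K / 2 * (\<rho> k)\<^sup>2"
        unfolding f_def c_def using C \<sigma>(1)[of k] \<rho>pos[of k] N by simp
      ultimately show ?thesis using \<sigma>(4)[of k] by (simp add: C_def)
    qed
    define g\<alpha> where "g\<alpha> = cutoff \<alpha> g"
    obtain M\<alpha> where "bounded_well N g\<alpha> b \<beta> M\<alpha>" unfolding g\<alpha>_def by (rule cutoff_bounded_well[OF \<alpha>_gt])
    then interpret c: bounded_well N g\<alpha> b \<beta> M\<alpha> .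
    have g\<alpha>_eq: "g\<alpha> s = g s" if "s \<le> \<alpha>" for s unfolding g\<alpha>_def by (rule cutoff_eq[OF that \<alpha>0(1)])
    have g\<alpha>K: "\<bar>g\<alpha> s\<bar> \<le> K" for s unfolding g\<alpha>_def cutoff_def by (rule K) (use \<alpha>0 in auto)
    \<comment> \<open>Freezing the boundary layer yields an equi-Lipschitz family of approximate solutions for \<open>g\<close>.\<close>
    define w where "w = (\<lambda>k r. u k (max r (\<rho> k)))"
    have ule: "u k r \<le> \<alpha>" if "r \<ge> \<rho> k" for k r using \<sigma>(3)[of k r] that \<rho>\<sigma>[of k] \<delta> \<alpha>_gt by simp
    have lip: "\<bar>w k x - w k y\<bar> \<le> (K + C) * (T + 1) * \<bar>x - y\<bar>" if "x \<in> {0..T}" "y \<in> {0..T}" for k x y T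
    proof -
      have "norm (u k (max x (\<rho> k)) - u k (max y (\<rho> k))) \<le> ((K + C) * (T + 1)) * norm (max x (\<rho> k) - max y (\<rho> k))"
      proof (rule field_differentiable_bound[of "{\<rho> k..T + 1}" "u k" "v k"])
        fix t assume t: "t \<in> {\<rho> k..T + 1}"
        show "(u k has_field_derivative v k t) (at t within {\<rho> k..T + 1})"
          by (rule has_field_derivative_at_within[OF sol_deriv_u[OF seq(4)]]) (use t \<rho>pos[of k] in auto)
        have "\<bar>v k t\<bar> \<le> (K + C) * t" by (rule vb) (use t in auto)
        also have "\<dots> \<le> (K + C) * (T + 1)" using t K0 C by (intro mult_left_mono) auto
        finally show "norm (v k t) \<le> (K + C) * (T + 1)" by simp
      qed (use that \<rho>1[of k] in auto)
      also have "\<dots> \<le> ((K + C) * (T + 1)) * \<bar>x - y\<bar>" using that K0 C by (intro mult_left_mono mult_nonneg_nonneg) auto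
      finally show ?thesis by (simp add: w_def)
    qed
    have wc: "continuous_on {0..T} (w k)" for k T
      unfolding w_def
      by (rule continuous_on_compose2[OF sol_continuous_u[OF seq(4)]]) (auto intro!: continuous_intros)
    have gwc: "continuous_on {0..T} (\<lambda>t. g\<alpha> (w k t))" for k T by (rule continuous_on_compose2[OF c.g_cont wc]) simp
    have H: "\<bar>r ^ (N-1) * v k r + mass_int N (\<lambda>t. g\<alpha> (w k t)) r\<bar> \<le> (2 * K + C) * \<rho> k" if r: "r \<ge> \<rho> k" for k r
    proof -
      define h where "h = (\<lambda>r. r ^ (N-1) * v k r + mass_int N (\<lambda>t. g\<alpha> (w k t)) r)"
      have "norm (h r - h (\<rho> k)) \<le> 0 * norm (r - \<rho> k)"
      proof (rule field_differentiable_bound[of "{\<rho> k..r}" h "\<lambda>_. 0"])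
        fix x assume x: "x \<in> {\<rho> k..r}"
        have x0: "x > 0" using x \<rho>pos[of k] by auto
        have "g\<alpha> (w k x) = G (eps k) (A k) (u k x)"
          using ule[of k x] x g\<alpha>_eq[of "u k x"] eq_low[of "u k x" k] by (simp add: w_def max_absorb1)
        moreover have "(h has_real_derivative - (x ^ (N-1) * G (eps k) (A k) (u k x)) + x ^ (N-1) * g\<alpha> (w k x)) (at x)"
          unfolding h_def by (intro DERIV_add sol_mass_deriv[OF seq(4) x0 N] mass_int_deriv gwc x0)
        ultimately have "(h has_real_derivative 0) (at x)" by simp
        then show "(h has_field_derivative 0) (at x within {\<rho> k..r})" by (rule has_field_derivative_at_within)
      qed (use r in auto)
      then have hr: "h r = h (\<rho> k)" by simp
      have "\<bar>\<rho> k ^ (N-1) * v k (\<rho> k)\<bar> \<le> 1 * ((K + C) * \<rho> k)"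
        unfolding abs_mult by (intro mult_mono vb) (use \<rho>pos[of k] \<rho>1[of k] K0 C in \<open>auto intro!: power_le_one\<close>)
      moreover have "\<bar>mass_int N (\<lambda>t. g\<alpha> (w k t)) (\<rho> k)\<bar> \<le> K * \<rho> k ^ (N-1) * \<rho> k"
        by (rule mass_int_bound[OF gwc]) (use \<rho>pos[of k] g\<alpha>K in auto)
      moreover have "K * \<rho> k ^ (N-1) * \<rho> k \<le> K * 1 * \<rho> k"
        using \<rho>pos[of k] \<rho>1[of k] K0 by (intro mult_right_mono mult_left_mono power_le_one) auto
      moreover have "(2 * K + C) * \<rho> k = 1 * ((K + C) * \<rho> k) + K * 1 * \<rho> k" by (simp add: algebra_simps)
      ultimately have "\<bar>h (\<rho> k)\<bar> \<le> (2 * K + C) * \<rho> k" unfolding h_def by linarith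
      then show ?thesis unfolding hr[symmetric] by (simp add: h_def)
    qed
    obtain \<phi> f f' where \<phi>: "strict_mono (\<phi> :: nat \<Rightarrow> nat)" "sol N g\<alpha> f f'" "loc_unif (\<lambda>k. w (\<phi> k)) f"
      "\<And>r. r > 0 \<Longrightarrow> (\<lambda>k. v (\<phi> k) r) \<longlonglongrightarrow> f' r"
    proof (rule approximate_solutions_compact[OF N c.g_cont c.g_bound, of w "\<alpha> + 12 * (\<eta> * \<kappa>) + K" v])
      show "\<exists>L. \<forall>k. \<forall>x\<in>{0..T}. \<forall>y\<in>{0..T}. \<bar>w k x - w k y\<bar> \<le> L * \<bar>x - y\<bar>" for T using lip by blast
      show "\<bar>w k 0\<bar> \<le> \<alpha> + 12 * (\<eta> * \<kappa>) + K" for k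
      proof -
        have w0: "w k 0 = u k (\<rho> k)" using \<rho>pos[of k] by (simp add: w_def max_def)
        have "K / 2 * (\<rho> k)\<^sup>2 \<le> K / 2 * 1" using \<rho>pos[of k] \<rho>1[of k] K0 by (intro mult_left_mono power_le_one) auto
        then show ?thesis using u\<rho>_low[of k] ule[of k "\<rho> k", OF order_refl] K0 \<eta>\<kappa>(3) \<alpha>0(1) unfolding w0 by linarith
      qed
      show "\<exists>k0. \<forall>k\<ge>k0. \<forall>r\<in>{a..T}. (w k has_real_derivative v k r) (at r) \<and> \<bar>r ^ (N-1) * v k r + mass_int N (\<lambda>t. g\<alpha> (w k t)) r\<bar> \<le> e"
        if "a > 0" "e > 0" for a T e
      proof -
        have "min a (e / (2 * K + C)) > 0" using that K0 C by simp
        then obtain k0 where k0: "\<And>k. k \<ge> k0 \<Longrightarrow> \<rho> k < min a (e / (2 * K + C))"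
          using order_tendstoD(2)[OF \<rho>lim] unfolding eventually_sequentially by blast
        have "(w k has_real_derivative v k r) (at r) \<and> \<bar>r ^ (N-1) * v k r + mass_int N (\<lambda>t. g\<alpha> (w k t)) r\<bar> \<le> e"
          if k: "k \<ge> k0" and r: "r \<in> {a..T}" for k r
        proof
          have \<rho>r: "\<rho> k < r" using k0[OF k] r by simp
          show "(w k has_real_derivative v k r) (at r)"
            by (rule has_field_derivative_transform_within_open[OF sol_deriv_u[OF seq(4)], of r "{\<rho> k<..}"])
               (use \<rho>r \<rho>pos[of k] in \<open>auto simp: w_def max_def\<close>)
          have "\<bar>r ^ (N-1) * v k r + mass_int N (\<lambda>t. g\<alpha> (w k t)) r\<bar> \<le> (2 * K + C) * \<rho> k" by (rule H) (use \<rho>r in simp)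
          also have "\<dots> \<le> e" using k0[OF k] K0 C by (simp add: field_simps)
          finally show "\<bar>r ^ (N-1) * v k r + mass_int N (\<lambda>t. g\<alpha> (w k t)) r\<bar> \<le> e" .
        qed
        then show ?thesis by blast
      qed
    qed blast
    have w0: "w k 0 = u k (\<rho> k)" for k using \<rho>pos[of k] by (simp add: w_def max_def)
    have lim0: "(\<lambda>k. u (\<phi> k) (\<rho> (\<phi> k))) \<longlonglongrightarrow> f 0" using loc_unif_pointwise[OF \<phi>(3), of 0] by (simp add: w0)
    have \<rho>lim': "(\<lambda>k. \<rho> (\<phi> k)) \<longlonglongrightarrow> 0" using LIMSEQ_subseq_LIMSEQ[OF \<rho>lim \<phi>(1)] by (simp add: comp_def)
    have "f 0 \<le> max (\<alpha> - \<delta>) \<beta>"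
      by (rule LIMSEQ_le_const2[OF lim0]) (use \<sigma>(3) \<rho>\<sigma> in blast)
    then have f0\<alpha>: "f 0 < \<alpha>" using \<delta> \<alpha>_gt by simp
    have "(\<lambda>k. u (\<phi> k) (\<rho> (\<phi> k)) + K / 2 * (\<rho> (\<phi> k))\<^sup>2) \<longlonglongrightarrow> f 0 + K / 2 * 0\<^sup>2"
      by (intro tendsto_intros lim0 \<rho>lim')
    then have "\<alpha> - 12 * (\<eta> * \<kappa>) \<le> f 0 + K / 2 * 0\<^sup>2"
      by (rule LIMSEQ_le_const) (use u\<rho>_low in blast)
    then have f0\<beta>: "f 0 > \<beta>" using \<eta>\<kappa> \<alpha>_gt by simp
    have fle: "f r \<le> \<alpha>" if "r \<ge> 0" for r using c.sol_le_initial[OF \<phi>(2) _ that] f0\<beta> \<beta>_gt f0\<alpha> by simp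
    have sf: "sol N g f f'" by (rule sol_cong[OF \<phi>(2)]) (use fle g\<alpha>_eq in simp)
    obtain va where va: "sol N g ua va" and uann: "\<And>r. r \<ge> 0 \<Longrightarrow> ua r \<ge> 0" using gs(1) unfolding radial_ground_state_iff by blast
    \<comment> \<open>\<open>f\<close> starts between \<beta> and \<alpha>, so
      \<open>comparison\<close> applies with the ground state \<open>ua\<close> as the upper
      solution.\<close>
    have "trapped g f f'"
    proof (rule ccontr)
      assume nt: "\<not> trapped g f f'"
      show False by (rule comparison[OF sf va f0\<beta> _ nt uann]) (use gs(2) f0\<alpha> in simp)
    qed
    then obtain R where R: "R \<ge> 0" "energy g f f' R < 0" "\<forall>r\<in>{0..R}. f r > 0" unfolding trapped_def by blast
    have "R \<noteq> 0" using R(2) F_pos[OF f0\<beta>] by (auto simp: energy_def sol_v0[OF sf])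
    then have R0: "R > 0" using R by simp
    obtain k1 where k1: "\<And>k x. k \<ge> k1 \<Longrightarrow> x \<in> {0..R} \<Longrightarrow> w (\<phi> k) x > 0"
      using loc_unif_positive[OF \<phi>(3) continuous_on_subset[OF sol_continuous_u[OF sf]], of R] R(1,3) by auto
    have "(\<lambda>k. energy g (w (\<phi> k)) (v (\<phi> k)) R) \<longlonglongrightarrow> energy g f f' R"
      unfolding energy_def
      by (intro tendsto_intros \<phi>(4)[OF R0] isCont_tendsto_compose[OF F_isCont] loc_unif_pointwise[OF \<phi>(3), of R]) (use R in auto)
    from order_tendstoD(2)[OF this R(2)]
    obtain k2 where k2: "\<And>k. k \<ge> k2 \<Longrightarrow> energy g (w (\<phi> k)) (v (\<phi> k)) R < 0" unfolding eventually_sequentially by blast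
    from order_tendstoD(2)[OF \<rho>lim' R0]
    obtain k3 where k3: "\<And>k. k \<ge> k3 \<Longrightarrow> \<rho> (\<phi> k) < R" unfolding eventually_sequentially by blast
    from order_tendstoD(1)[OF lim0 f0\<beta>]
    obtain k4 where k4: "\<And>k. k \<ge> k4 \<Longrightarrow> \<beta> < u (\<phi> k) (\<rho> (\<phi> k))" unfolding eventually_sequentially by blast
    define k where "k = max (max k1 k2) (max k3 k4)"
    have kk: "k \<ge> k1" "k \<ge> k2" "k \<ge> k3" "k \<ge> k4" by (auto simp: k_def)
    define j where "j = \<phi> k"
    have wR: "w j R = u j R" using k3[OF kk(3)] by (simp add: w_def j_def)
    have "u j R \<le> \<alpha>" using ule[of j R] k3[OF kk(3)] by (simp add: j_def)
    then have "prim (G (eps j) (A j)) (u j R) = prim g (u j R)" by (intro prim_cong) (use eq_low in auto)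
    then have "energy (G (eps j) (A j)) (u j) (v j) R = energy g (w j) (v j) R" by (simp add: energy_def wR)
    then have EJ: "energy (G (eps j) (A j)) (u j) (v j) R < 0" using k2[OF kk(2)] by (simp add: j_def)
    have "u j x > 0" if x: "x \<in> {0..R}" for x
    proof (cases "x \<ge> \<rho> j")
      case True
      then show ?thesis using k1[OF kk(1) x] by (simp add: w_def j_def max_def)
    next
      case False
      \<comment> \<open>The convergence says nothing about radii inside the layer. There
        \<open>sol_stays_below\<close> is used backwards: a value above \<beta> at \<rho> rules out
        smaller values before.\<close>
      have "u j 0 > b" using seq(5)[of j] \<eta> \<alpha>0 by simp
      then have "u j (\<rho> j) \<le> max (u j x) \<beta>" using Gk.sol_stays_below[OF seq(4), of j x "\<rho> j"] x False by simp
      then show ?thesis using k4[OF kk(4)] \<beta>_gt b_pos by (simp add: j_def)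
    qed
    with EJ R(1) have "trapped (G (eps j) (A j)) (u j) (v j)" unfolding trapped_def by blast
    with seq(6) show False by blast
  qed
  then obtain Ab where "Ab > 0" "\<forall>eps A u v. 0 < eps \<longrightarrow> eps < epsb \<longrightarrow> A > Ab \<longrightarrow> sol N (G eps A) u v \<longrightarrow> u 0 = \<alpha> + \<eta> \<longrightarrow> trapped (G eps A) u v" by blast
  with that[OF \<eta>(1) epsb] show ?thesis by blast
qed

end

section \<open>Three ground states\<close>

lemma radial_ground_state_cong:
  assumes "radial_ground_state N g u" "\<And>r. r \<ge> 0 \<Longrightarrow> g (u r) = h (u r)"
  shows "radial_ground_state N h u"
  using assms unfolding radial_ground_state_iff by (meson sol_cong less_imp_le)

lemma GST_cong:
  assumes gst: "GST N \<beta> f" and eq: "\<And>s. s \<ge> 0 \<Longrightarrow> f s = g s" and \<beta>: "\<beta> \<ge> 0"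
  shows "GST N \<beta> g"
proof -
  have p: "prim f s = prim g s" for s by (rule prim_cong) (rule eq)
  define Qf where "Qf = (\<lambda>s. 2 * real N * prim f s - (real N - 2) * s * f s)"
  define Qg where "Qg = (\<lambda>s. 2 * real N * prim g s - (real N - 2) * s * g s)"
  have Q: "Qf s = Qg s" if "s \<ge> 0" for s by (simp add: Qf_def Qg_def p eq[OF that])
  obtain \<delta> M bb \<theta> where *: "\<delta> > 0" "\<And>s. 0 \<le> s \<Longrightarrow> s < \<delta> \<Longrightarrow> Qf s \<ge> M" "bb > \<beta>" "0 < \<theta>" "\<theta> < 1"
    "\<And>s. s > bb \<Longrightarrow> Qf s > 0" "\<And>M S. \<exists>s>S. \<forall>s1\<in>{\<theta> * s .. s}. \<forall>s2\<in>{\<theta> * s .. s}. Qf s2 * (s / f s1) powr (real N / 2) \<ge> M"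
    using gst unfolding GST_def Let_def Qf_def by blast
  have 1: "\<exists>\<delta>>0. \<exists>M. \<forall>s. 0 \<le> s \<and> s < \<delta> \<longrightarrow> Qg s \<ge> M"
    using *(1,2) Q by (intro exI[of _ \<delta>] conjI exI[of _ M]) auto
  have 2: "\<forall>s>bb. Qg s > 0" using *(3,6) Q \<beta> by fastforce
  have 3: "\<exists>s>S. \<forall>s1\<in>{\<theta> * s .. s}. \<forall>s2\<in>{\<theta> * s .. s}. Qg s2 * (s / g s1) powr (real N / 2) \<ge> L" for L S
  proof -
    \<comment> \<open>The lower bound 0 keeps the whole interval from \<open>\<theta> * s\<close> to
      \<open>s\<close> on the half-line where \<open>f\<close> and \<open>g\<close> agree.\<close>
    obtain s where s: "s > max S 0" "\<forall>s1\<in>{\<theta> * s .. s}. \<forall>s2\<in>{\<theta> * s .. s}. Qf s2 * (s / f s1) powr (real N / 2) \<ge> L"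
      using *(7) by blast
    have "0 \<le> \<theta> * s" using s(1) *(4) by simp
    then have "t \<ge> 0" if "t \<in> {\<theta> * s .. s}" for t using that by simp
    then show ?thesis using s Q eq by (intro exI[of _ s]) auto
  qed
  show ?thesis unfolding GST_def Let_def Qg_def[symmetric] using 1 2 3 *(3,4,5) unfolding Qg_def by blast
qed

context glue
begin

text \<open>Two shootings, both from the trapped height \<open>\<alpha> + \<eta>\<close>: one down
  to a crossing height just above \<alpha>, one up to the crossing height from (GST). As
  \<open>shooting\<close> excludes the end points, the initial values are separated.\<close>

theorem three_ground_states:
  assumes gs: "radial_ground_state N g ua" "ua 0 = \<alpha>"
  obtains epsb Ab where "epsb > 0" "Ab > 0"
    "\<And>eps A. 0 < eps \<Longrightarrow> eps < epsb \<Longrightarrow> A > Ab \<Longrightarrow> GST N \<beta> (G eps A) \<Longrightarrow>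
       \<exists>u2 u3. radial_ground_state N (G eps A) ua \<and> radial_ground_state N (G eps A) u2 \<and> radial_ground_state N (G eps A) u3 \<and>
         ua 0 < u2 0 \<and> u2 0 < u3 0"
proof -
  obtain \<eta> epsb Ab where \<eta>: "\<eta> > 0" and epsb: "epsb > 0" "Ab > 0"
    and tr: "\<And>eps A u v. 0 < eps \<Longrightarrow> eps < epsb \<Longrightarrow> A > Ab \<Longrightarrow> sol N (G eps A) u v \<Longrightarrow> u 0 = \<alpha> + \<eta> \<Longrightarrow> trapped (G eps A) u v"
    by (rule steep_trapped[OF gs]) blast
  have "\<exists>u2 u3. radial_ground_state N (G eps A) ua \<and> radial_ground_state N (G eps A) u2 \<and> radial_ground_state N (G eps A) u3 \<and>
         ua 0 < u2 0 \<and> u2 0 < u3 0"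
    if eps: "0 < eps" "eps < epsb" and A: "A > Ab" and gst: "GST N \<beta> (G eps A)" for eps A
  proof -
    have A0: "A > 0" using A epsb by simp
    interpret G: well N "G eps A" b \<beta> by (rule steep_well[OF eps(1) A0])
    obtain D where D: "D > \<alpha> + \<eta>" and Dcross: "\<And>u v. sol N (G eps A) u v \<Longrightarrow> u 0 = D \<Longrightarrow> \<exists>r\<ge>0. u r < 0"
      by (rule G.gst_crossing[OF gst, of "\<alpha> + \<eta>"]) blast
    \<comment> \<open>Low enough for solutions starting there to see only \<open>g\<close>, so that
      \<open>comparison\<close> with \<open>ua\<close> applies to them, and below the trapped
      height.\<close>
    define q where "q = \<alpha> + min eps \<eta> / 2"
    have q: "q > \<alpha>" "q < \<alpha> + \<eta>" "q \<le> \<alpha> + eps" using eps(1) \<eta> by (auto simp: q_def min_def)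
    have D\<beta>: "D > \<beta>" "D > 0" using D \<eta> \<alpha>_gt \<beta>_gt b_pos by auto
    obtain M where "bounded_well N (cutoff D (G eps A)) b \<beta> M" by (rule G.cutoff_bounded_well[OF D\<beta>(1)])
    then interpret c: bounded_well N "cutoff D (G eps A)" b \<beta> M .
    have ce: "cutoff D (G eps A) s = G eps A s" if "s \<le> D" for s by (rule G.cutoff_eq[OF that D\<beta>(2)])
    have ule: "u r \<le> u 0" if "sol N (cutoff D (G eps A)) u v" "u 0 > \<beta>" "r \<ge> 0" for u v r
      using c.sol_le_initial[OF that(1) _ that(3)] that(2) \<beta>_gt by simp
    have cG: "sol N (G eps A) u v" if "sol N (cutoff D (G eps A)) u v" "u 0 > \<beta>" "u 0 \<le> D" for u v
      by (rule sol_cong[OF that(1)]) (use ce ule[OF that(1,2)] that(3) in \<open>meson less_imp_le order_trans\<close>)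
    have p: "trapped (cutoff D (G eps A)) u v" if s: "sol N (cutoff D (G eps A)) u v" and u0: "u 0 = \<alpha> + \<eta>" for u v
    proof -
      have u0': "u 0 > \<beta>" "u 0 \<le> D" using u0 D \<alpha>_gt \<eta> by auto
      have "trapped (G eps A) u v" by (rule tr[OF eps A cG[OF s u0'] u0])
      moreover have "energy (cutoff D (G eps A)) u v r = energy (G eps A) u v r" if "r \<ge> 0" for r
      proof -
        have "u r \<le> D" using ule[OF s u0'(1) that] u0'(2) by simp
        then have "prim (cutoff D (G eps A)) (u r) = prim (G eps A) (u r)" by (intro prim_cong ce) simp
        then show ?thesis by (simp add: energy_def)
      qed
      ultimately show ?thesis unfolding trapped_def by auto
    qed
    have qD: "\<exists>r\<ge>0. u r < 0" if s: "sol N (cutoff D (G eps A)) u v" and u0: "u 0 = D" for u v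
      by (rule Dcross[OF cG[OF s] u0]) (use u0 D\<beta> in auto)
    obtain va where va: "sol N g ua va" and lim: "(ua \<longlongrightarrow> 0) at_top" and uann: "\<And>r. r \<ge> 0 \<Longrightarrow> ua r \<ge> 0"
      using gs(1) unfolding radial_ground_state_iff by blast
    have qq: "\<exists>r\<ge>0. u r < 0" if s: "sol N (cutoff D (G eps A)) u v" and u0: "u 0 = q" for u v
    proof (rule ccontr)
      assume "\<not> ?thesis"
      then have nn: "u r \<ge> 0" if "r \<ge> 0" for r using that by (meson not_less)
      have u0': "u 0 > \<beta>" using u0 q \<alpha>_gt by simp
      have "sol N g u v"
      proof (rule sol_cong[OF s])
        fix r :: real assume "r > 0"
        then have "u r \<le> q" using ule[OF s u0', of r] u0 by simp
        then show "cutoff D (G eps A) (u r) = g (u r)" using ce[of "u r"] steep_eq[of "u r" eps A] q D by simp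
      qed
      from comparison[OF va this _ _ vanishing_not_trapped[OF va lim] nn] show False
        using gs(2) u0 q(1) \<alpha>_gt by simp
    qed
    have gsG: "radial_ground_state N (G eps A) w" if gw: "radial_ground_state N (cutoff D (G eps A)) w" and w0: "w 0 > \<beta>" "w 0 \<le> D" for w
    proof (rule radial_ground_state_cong[OF gw])
      obtain vw where sw: "sol N (cutoff D (G eps A)) w vw" using gw unfolding radial_ground_state_iff by blast
      show "cutoff D (G eps A) (w r) = G eps A (w r)" if "r \<ge> 0" for r
        using ule[OF sw w0(1) that] w0(2) by (intro ce) simp
    qed
    have h: "\<alpha> + \<eta> > \<beta>" "q > \<beta>" "D > \<beta>" using \<alpha>_gt \<eta> q(1) D\<beta>(1) by auto
    obtain u2 where u2: "radial_ground_state N (cutoff D (G eps A)) u2" "u2 0 \<in> closed_segment (\<alpha> + \<eta>) q" "u2 0 \<noteq> \<alpha> + \<eta>" "u2 0 \<noteq> q"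
      by (rule c.shooting[OF h(1,2) p qq])
    obtain u3 where u3: "radial_ground_state N (cutoff D (G eps A)) u3" "u3 0 \<in> closed_segment (\<alpha> + \<eta>) D" "u3 0 \<noteq> \<alpha> + \<eta>" "u3 0 \<noteq> D"
      by (rule c.shooting[OF h(1,3) p qD])
    have u20: "q < u2 0" "u2 0 < \<alpha> + \<eta>" using u2(2-4) q(2) by (auto simp: closed_segment_eq_real_ivl split: if_splits)
    have u30: "\<alpha> + \<eta> < u3 0" "u3 0 < D" using u3(2-4) D by (auto simp: closed_segment_eq_real_ivl split: if_splits)
    have "radial_ground_state N (G eps A) ua"
    proof (rule radial_ground_state_cong[OF gs(1)])
      fix r :: real assume "r \<ge> 0"
      then have "ua r \<le> \<alpha>" using sol_le_initial[OF va] gs(2) \<alpha>_gt \<beta>_gt by simp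
      then show "g (ua r) = G eps A (ua r)" using steep_eq[of "ua r" eps A] eps by simp
    qed
    moreover have "radial_ground_state N (G eps A) u2" by (rule gsG[OF u2(1)]) (use u20 q D \<alpha>_gt in auto)
    moreover have "radial_ground_state N (G eps A) u3" by (rule gsG[OF u3(1)]) (use u30 h in auto)
    moreover have "ua 0 < u2 0" "u2 0 < u3 0" using gs(2) q(1) u20 u30 by auto
    ultimately show ?thesis by blast
  qed
  with that[OF epsb] show ?thesis by blast
qed

end

theorem theorem4p2:
  fixes N :: nat and f1 f2 :: "real \<Rightarrow> real" and \<alpha> b \<beta> :: real
  assumes N: "N > 2"
    and H1_cont: "continuous_on {0..} f1"
    and H1_C1: "(\<forall>s>0. f1 differentiable (at s)) \<and> continuous_on {0<..} (deriv f1)"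
    and H1_zero: "f1 0 = 0"
    and H1_b: "b \<ge> 0" "\<forall>s>b. f1 s > 0" "\<forall>s\<in>{0..b}. f1 s \<le> 0"
    and H1_neg: "\<exists>e0>0. \<forall>s\<in>{0<..<e0}. f1 s < 0"
    and H1_beta: "\<beta> \<ge> b" "prim f1 \<beta> = 0" "\<forall>t\<ge>b. prim f1 t = 0 \<longrightarrow> t = \<beta>"
    and H2: "\<forall>s>\<beta>. deriv (\<lambda>t. prim f1 t / f1 t) s > (real N - 2) / (2 * real N)"
    and H3: "strict_mono_on {b<..} (\<lambda>s. f1 s / (s - b))"
    and H4: "\<exists>u. u 0 = \<alpha> \<and> radial_ground_state N f1 u"
    and H5: "continuous_on {\<alpha>..} f2" "\<forall>s\<ge>\<alpha>. f2 s > 0"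
  shows "\<exists>epsb Ab. epsb > 0 \<and> Ab > 0 \<and>
           (\<forall>eps A. 0 < eps \<and> eps < epsb \<and> A > Ab \<and> GST N \<beta> (glued f1 f2 \<alpha> eps A) \<longrightarrow>
              (\<exists>u1 u2 u3.
                 radial_ground_state N (glued f1 f2 \<alpha> eps A) u1 \<and>
                 radial_ground_state N (glued f1 f2 \<alpha> eps A) u2 \<and>
                 radial_ground_state N (glued f1 f2 \<alpha> eps A) u3 \<and>
                 (\<exists>r\<ge>0. u1 r \<noteq> u2 r) \<and> (\<exists>r\<ge>0. u1 r \<noteq> u3 r) \<and> (\<exists>r\<ge>0. u2 r \<noteq> u3 r)))"
proof -
  define g where "g = (\<lambda>s. f1 (max 0 s))"
  have gf: "g s = f1 s" if "s \<ge> 0" for s using that by (simp add: g_def)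
  have g0: "g s = 0" if "s \<le> 0" for s using that H1_zero by (simp add: g_def max_def)
  have gc: "continuous_on UNIV g"
    unfolding g_def by (rule continuous_on_compose2[OF H1_cont]) (auto intro!: continuous_intros)
  have pg: "prim g s = prim f1 s" for s by (rule prim_cong) (rule gf)
  obtain e0 where e0: "e0 > 0" "\<forall>s\<in>{0<..<e0}. f1 s < 0" using H1_neg by blast
  \<comment> \<open>Negativity of \<open>f1\<close> near 0 contradicts its positivity above
    \<open>b\<close> if \<open>b\<close> is 0.\<close>
  have b0: "b > 0"
  proof (rule ccontr)
    assume "\<not> b > 0"
    then have "f1 (e0/2) > 0" using H1_b e0 by simp
    then show False using e0(2)[rule_format, of "e0/2"] e0(1) by simp
  qed
  have pd: "(prim g has_real_derivative g s) (at s)" for s by (rule prim_deriv[OF gc g0])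
  have "prim g b < 0"
  proof -
    define t where "t = min b (e0/2)"
    have t: "0 < t" "t \<le> b" "t < e0" using b0 e0 by (auto simp: t_def)
    have "prim g t < prim g 0"
    proof (rule DERIV_neg_imp_decreasing_open[OF t(1)])
      fix x assume "0 < x" "x < t"
      then show "\<exists>y. (prim g has_real_derivative y) (at x) \<and> y < 0"
        using pd[of x] e0(2) t gf[of x] by (intro exI[of _ "g x"]) auto
    qed (use DERIV_isCont[OF pd] in \<open>auto intro: continuous_at_imp_continuous_on\<close>)
    moreover have "prim g b \<le> prim g t"
    proof (rule DERIV_nonpos_imp_nonincreasing[OF t(2)])
      fix x assume "t \<le> x" "x \<le> b"
      then show "\<exists>y. (prim g has_real_derivative y) (at x) \<and> y \<le> 0"
        using pd[of x] H1_b(3) t gf[of x] by (intro exI[of _ "g x"]) auto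
    qed
    ultimately show ?thesis by simp
  qed
  \<comment> \<open>The potential is negative at \<open>b\<close> and vanishes at \<beta>, so the
    two cannot coincide.\<close>
  then have \<beta>b: "\<beta> > b" using H1_beta(1,2) pg by (cases "\<beta> = b") auto
  interpret W: well N g b \<beta>
  proof
    show "\<exists>e0>0. \<forall>s\<in>{0<..<e0}. g s < 0" using e0 gf by (intro exI[of _ e0]) auto
    show "g s > 0" if "b < s" for s using H1_b(2) gf[of s] b0 that by simp
    show "g s \<le> 0" if "0 \<le> s" "s \<le> b" for s using H1_b(3) gf[of s] that by simp
    show "prim g \<beta> = 0" using H1_beta(2) pg by simp
  qed (rule N gc g0 b0 \<beta>b, assumption?)+
  interpret U: uniq N g b \<beta>
  proof
    fix s assume s: "s > \<beta>"
    have s0: "s > 0" "s > b" using s \<beta>b b0 by auto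
    \<comment> \<open>(H2) only bounds a value of \<open>deriv\<close>; that the quotient is
      differentiable has to come from \<open>f1\<close> being differentiable and nonzero at
      \<open>s\<close>.\<close>
    obtain d where "(f1 has_real_derivative d) (at s)" using H1_C1 s0 by (auto simp: real_differentiable_def)
    then have "(g has_real_derivative d) (at s)"
      by (rule has_field_derivative_transform_within_open[of _ _ _ "{0<..}"]) (use s0 gf in auto)
    then have "((\<lambda>t. prim g t / g t) has_real_derivative (g s * g s - prim g s * d) / (g s * g s)) (at s)" (is "(_ has_real_derivative ?D) _")
      using W.g_pos[OF s0(2)] by (intro DERIV_divide pd) auto
    moreover from this have "((\<lambda>t. prim f1 t / f1 t) has_real_derivative ?D) (at s)"
      by (rule has_field_derivative_transform_within_open[of _ _ _ "{0<..}"]) (use s0 gf pg in auto)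
    then have "deriv (\<lambda>t. prim f1 t / f1 t) s = ?D" by (rule DERIV_imp_deriv)
    then have "2 * real N * ?D > real N - 2" using H2[rule_format, OF s] N by (simp add: field_simps)
    ultimately show "\<exists>D. ((\<lambda>t. prim g t / g t) has_real_derivative D) (at s) \<and> 2 * real N * D > real N - 2" by blast
  next
    show "strict_mono_on {b<..} (\<lambda>s. g s / (s - b))"
    proof (rule strict_mono_onI)
      fix r s assume "r \<in> {b<..}" "s \<in> {b<..}" "r < s"
      then show "g r / (r - b) < g s / (s - b)" using strict_mono_onD[OF H3, of r s] gf b0 by simp
    qed
  qed
  obtain ua where ua: "ua 0 = \<alpha>" "radial_ground_state N f1 ua" using H4 by blast
  have gua: "radial_ground_state N g ua"
    by (rule radial_ground_state_cong[OF ua(2)]) (use ua(2) gf in \<open>auto simp: radial_ground_state_iff\<close>)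
  interpret glue N g b \<beta> f2 \<alpha>
    by unfold_locales (use H5 W.ground_state_height[OF gua] ua(1) in auto)
  \<comment> \<open>Agreement on the nonnegative half-line suffices, as ground states take only such
    values; the junction \<open>\<alpha> + eps\<close> is itself nonnegative.\<close>
  have GL: "steep g f2 \<alpha> eps A s = glued f1 f2 \<alpha> eps A s" if "s \<ge> 0" "eps > 0" for s eps A
    using that gf[of s] gf[of "\<alpha> + eps"] \<alpha>_gt \<beta>b b0 by (simp add: steep_def glued_def glued_pos_def)
  obtain epsb Ab where E: "epsb > 0" "Ab > 0"
    "\<And>eps A. 0 < eps \<Longrightarrow> eps < epsb \<Longrightarrow> A > Ab \<Longrightarrow> GST N \<beta> (steep g f2 \<alpha> eps A) \<Longrightarrow>
       \<exists>u2 u3. radial_ground_state N (steep g f2 \<alpha> eps A) ua \<and> radial_ground_state N (steep g f2 \<alpha> eps A) u2 \<and>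
         radial_ground_state N (steep g f2 \<alpha> eps A) u3 \<and> ua 0 < u2 0 \<and> u2 0 < u3 0"
    by (rule three_ground_states[OF gua ua(1)]) blast
  have "\<exists>u1 u2 u3. radial_ground_state N (glued f1 f2 \<alpha> eps A) u1 \<and> radial_ground_state N (glued f1 f2 \<alpha> eps A) u2 \<and>
       radial_ground_state N (glued f1 f2 \<alpha> eps A) u3 \<and>
       (\<exists>r\<ge>0. u1 r \<noteq> u2 r) \<and> (\<exists>r\<ge>0. u1 r \<noteq> u3 r) \<and> (\<exists>r\<ge>0. u2 r \<noteq> u3 r)"
    if eps: "0 < eps" "eps < epsb" "A > Ab" and gst: "GST N \<beta> (glued f1 f2 \<alpha> eps A)" for eps A
  proof -
    have "GST N \<beta> (steep g f2 \<alpha> eps A)" by (rule GST_cong[OF gst]) (use GL eps \<beta>b b0 in auto)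
    from E(3)[OF eps this] obtain u2 u3 where u: "radial_ground_state N (steep g f2 \<alpha> eps A) ua"
      "radial_ground_state N (steep g f2 \<alpha> eps A) u2" "radial_ground_state N (steep g f2 \<alpha> eps A) u3" "ua 0 < u2 0" "u2 0 < u3 0" by blast
    have tr: "radial_ground_state N (glued f1 f2 \<alpha> eps A) w" if w: "radial_ground_state N (steep g f2 \<alpha> eps A) w" for w
      by (rule radial_ground_state_cong[OF w]) (use w GL eps(1) in \<open>auto simp: radial_ground_state_iff\<close>)
    have "\<exists>r\<ge>0. ua r \<noteq> u2 r" "\<exists>r\<ge>0. ua r \<noteq> u3 r" "\<exists>r\<ge>0. u2 r \<noteq> u3 r"
      using u(4,5) by (auto intro!: exI[of _ 0])
    with tr[OF u(1)] tr[OF u(2)] tr[OF u(3)] show ?thesis by blast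
  qed
  with E(1,2) show ?thesis by blast
qed

end
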